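(* For each integer $k\ge 0$ there is a set $\{\bar{\mathfrak m}_i\}$, $i=1,\dots,\tilde T(k)$, of simple $\Gamma$-valued braid monodromy factorizations of length $k+2$ that share the same (a) monodromy at infinity $\mathfrak m_\infty(\bar{\mathfrak m}_i)=(\mathbb X\mathbb Y)^{-5k-4}$, (b) transcendental lattice $\mathcal T(\bar{\mathfrak m}_i)$ (up to isomorphism), and (c) fundamental group $\pi_1(\bar{\mathfrak m}_i)$ (up to isomorphism), which is $\mathbb Z$ for $k\ge2$, but are pairwise not strongly equivalent: the monodromy groups $\operatorname{Im}(\bar{\mathfrak m}_i)\subset\Gamma$ are pairwise distinct subgroups of index $6(k+1)$.
   Context: $\tilde T(k)=\frac{5k+4}{k+2}C(k)$, where $C(k)=\binom{2k}{k}/(k+1)$ is the $k$-th Catalan number. $\mathcal H=\mathbb Za\oplus\mathbb Zb$ with the skew-symmetric form $a\cdot b=1$; $\tilde\Gamma=SL(2,\mathbb Z)=\operatorname{Sp}\mathcal H$ is generated by $\mathbb X=\begin{pmatrix}-1&1\\-1&0\end{pmatrix}$, $\mathbb Y=\begin{pmatrix}0&-1\\1&0\end{pmatrix}$ (matrices in the basis $a,b$, so $\mathbb Xa=-a-b$, $\mathbb Xb=a$, $\mathbb Ya=b$, $\mathbb Yb=-a$); $\Gamma=PSL(2,\mathbb Z)=\tilde\Gamma/\{\pm\mathrm{id}\}$, and the images of $\mathbb X,\mathbb Y$ in $\Gamma$ are denoted by the same letters. Given a group $G$, a $G$-valued braid monodromy factorization of length $r$ is a sequence $\bar{\mathfrak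 m}=(\mathfrak m_1,\dots,\mathfrak m_r)$ of elements of $G$. Two of them are strongly (Hurwitz) equivalent if they are related by a finite sequence of Hurwitz moves $(\dots,\mathfrak m_i,\mathfrak m_{i+1},\dots)\mapsto(\dots,\mathfrak m_i^{-1}\mathfrak m_{i+1}\mathfrak m_i,\mathfrak m_i,\dots)$ and their inverses. A $\Gamma$-valued (respectively $\tilde\Gamma$-valued) factorization is simple if each $\mathfrak m_i$ is conjugate to $\mathbb X\mathbb Y$ in $\Gamma$ (respectively in $\tilde\Gamma$); a factorization with values in the braid group $B_3=\langle\sigma_1,\sigma_2\mid\sigma_1\sigma_2\sigma_1=\sigma_2\sigma_1\sigma_2\rangle$ is simple if each $\mathfrak m_i$ is conjugate to $\sigma_1$. Under the epimorphisms $B_3\to\tilde\Gamma\to\Gamma$, $\sigma_1\mapsto\mathbb X\mathbb Y$, $\sigma_2\mapsto\mathbb X^2\mathbb Y\mathbb X^{-1}$, each simple $\Gamma$-valued factorization has a unique simple $\tilde\Gamma$-valued lift and a unique simple $B_3$-valued lift. The monodromy at infinity is $\mathfrak m_\infty(\bar{\mathfrak m})=\mathfrak m_r\cdots\mathfrak m_1\in G$; the monodromy group is $\operatorname{Im}(\bar{\mathfrak m})=\langle\mathfrak m_1,\dots,\mathfrak m_r\rangle\subset G$. The fundamental group of a simple $\Gamma$-valued factorization is computed from its simple $B_3$-valued lift $(\mathfrak m_i)$: $\pi_1(\bar{\mathfrak m})=\langle\alpha_1,\alpha_2,\alpha_3\mid \mathfrak m_i(\alpha_j)=\alpha_j,\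 i=1,\dots,r,\ j=1,2,3\rangle$, where $B_3$ acts on the free group $\langle\alpha_1,\alpha_2,\alpha_3\rangle$ by the standard Artin action ($\sigma_i:\alpha_i\mapsto\alpha_i\alpha_{i+1}\alpha_i^{-1}$, $\alpha_{i+1}\mapsto\alpha_i$, the other generator being fixed). The transcendental lattice of a simple $\Gamma$-valued factorization is computed from its simple $\tilde\Gamma$-valued lift $(\mathfrak m_i)$: on $\bigoplus_{i=1}^r\mathcal H$ consider $\chi(\bigoplus x_i)=\sum_i(\mathfrak m_i-1)x_i\in\mathcal H$ and $q(\bigoplus x_i)=-\sum_i x_i\cdot\mathfrak m_ix_i+\sum_{i<j}(\mathfrak m_i-1)x_i\cdot(\mathfrak m_j-1)x_j\in\mathbb Z$. Let $\mathcal L=\operatorname{Ker}\chi$ and $\mathcal L^\perp=\{x\in\mathcal L\mid q(y+x)=q(y)\text{ for all }y\in\mathcal L\}$. Then $\mathcal T(\bar{\mathfrak m})=\mathcal L/\mathcal L^\perp$ with the induced quadratic form $q$. *)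

theory Defs
  imports
    "HOL-Analysis.Cartesian_Space"
    "HOL-Analysis.Determinants"
    "HOL-Algebra.Elementary_Groups"
    "HOL-Algebra.Generated_Groups"
    "HOL-Algebra.Product_Groups"
begin

definition catalan :: "nat \<Rightarrow> rat" where
  "catalan k = of_nat ((2 * k) choose k) / of_nat (k + 1)"

definition T_tilde :: "nat \<Rightarrow> rat" where
  "T_tilde k = of_nat (5 * k + 4) / of_nat (k + 2) * catalan k"

text \<open>A word is a list of signed generators: \<open>(x, True)\<close> is the letter \<open>x\<close> and
  \<open>(x, False)\<close> its formal inverse.  A presentation has all elements of the type \<open>'x\<close>
  as generators; a pair \<open>(u, v)\<close> of words stands for the relation \<open>u = v\<close>.\<close>

type_synonym 'x word = "('x \<times> bool) list"

definition inv_word :: "'x word \<Rightarrow> 'x word" where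
  "inv_word w = rev (map (\<lambda>(x, e). (x, \<not> e)) w)"

inductive word_eq :: "('x word \<times> 'x word) set \<Rightarrow> 'x word \<Rightarrow> 'x word \<Rightarrow> bool"
  for R :: "('x word \<times> 'x word) set" where
  word_eq_refl: "word_eq R u u"
| word_eq_sym: "word_eq R u v \<Longrightarrow> word_eq R v u"
| word_eq_trans: "word_eq R u v \<Longrightarrow> word_eq R v w \<Longrightarrow> word_eq R u w"
| word_eq_append: "word_eq R u u' \<Longrightarrow> word_eq R v v' \<Longrightarrow> word_eq R (u @ v) (u' @ v')"
| word_eq_cancel: "word_eq R [(x, e), (x, \<not> e)] []"
| word_eq_relation: "(u, v) \<in> R \<Longrightarrow> word_eq R u v"

definition word_class :: "('x word \<times> 'x word) set \<Rightarrow> 'x word \<Rightarrow> 'x word set" where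
  "word_class R u = {v. word_eq R u v}"

definition presented_group :: "('x word \<times> 'x word) set \<Rightarrow> 'x word set monoid" where
  "presented_group R = \<lparr>
     carrier = range (word_class R),
     mult = (\<lambda>c d. \<Union>u\<in>c. \<Union>v\<in>d. word_class R (u @ v)),
     one = word_class R []\<rparr>"

definition eval_word :: "('g, 'm) monoid_scheme \<Rightarrow> ('x \<Rightarrow> 'g) \<Rightarrow> 'x word \<Rightarrow> 'g" where
  "eval_word G f w =
     foldr (\<lambda>(x, e) g. (if e then f x else inv\<^bsub>G\<^esub> (f x)) \<otimes>\<^bsub>G\<^esub> g) w \<one>\<^bsub>G\<^esub>"

definition SL2Z :: "(int^2^2) monoid" where
  "SL2Z = \<lparr>carrier = {A. det A = 1}, mult = (**), one = mat 1\<rparr>"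

definition PSL2Z :: "(int^2^2) set monoid" where
  "PSL2Z = SL2Z Mod {mat 1, - mat 1}"

definition to_PSL2Z :: "int^2^2 \<Rightarrow> (int^2^2) set" where
  "to_PSL2Z A = {mat 1, - mat 1} #>\<^bsub>SL2Z\<^esub> A"

definition matX :: "int^2^2" where
  "matX = vector [vector [-1, 1], vector [-1, 0]]"

definition matY :: "int^2^2" where
  "matY = vector [vector [0, -1], vector [1, 0]]"

datatype braid_gen = Sigma1 | Sigma2

definition braid_rels :: "(braid_gen word \<times> braid_gen word) set" where
  "braid_rels = {([(Sigma1, True), (Sigma2, True), (Sigma1, True)],
                  [(Sigma2, True), (Sigma1, True), (Sigma2, True)])}"

definition B3 :: "braid_gen word set monoid" where
  "B3 = presented_group braid_rels"

definition sigma1 :: "braid_gen word set" where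
  "sigma1 = word_class braid_rels [(Sigma1, True)]"

fun braid_gen_matrix :: "braid_gen \<Rightarrow> int^2^2" where
  "braid_gen_matrix Sigma1 = matX ** matY"
| "braid_gen_matrix Sigma2 = matX ** matX ** matY ** inv\<^bsub>SL2Z\<^esub> matX"

text \<open>\<open>eval_word SL2Z braid_gen_matrix\<close> is constant on each element of \<open>B3\<close>, because the
  two matrices satisfy the braid relation.\<close>

definition B3_to_SL2Z :: "braid_gen word set \<Rightarrow> int^2^2" where
  "B3_to_SL2Z c = the_elem (eval_word SL2Z braid_gen_matrix ` c)"

definition conjugate_in :: "('g, 'm) monoid_scheme \<Rightarrow> 'g \<Rightarrow> 'g \<Rightarrow> bool" where
  "conjugate_in G g h \<longleftrightarrow> (\<exists>x\<in>carrier G. h = x \<otimes>\<^bsub>G\<^esub> g \<otimes>\<^bsub>G\<^esub> inv\<^bsub>G\<^esub> x)"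

definition all_conjugate :: "('g, 'm) monoid_scheme \<Rightarrow> 'g \<Rightarrow> 'g list \<Rightarrow> bool" where
  "all_conjugate G g ms \<longleftrightarrow> (\<forall>m\<in>set ms. conjugate_in G g m)"

abbreviation simple_PSL2Z :: "(int^2^2) set list \<Rightarrow> bool" where
  "simple_PSL2Z \<equiv> all_conjugate PSL2Z (to_PSL2Z (matX ** matY))"

abbreviation simple_SL2Z :: "(int^2^2) list \<Rightarrow> bool" where
  "simple_SL2Z \<equiv> all_conjugate SL2Z (matX ** matY)"

abbreviation simple_B3 :: "braid_gen word set list \<Rightarrow> bool" where
  "simple_B3 \<equiv> all_conjugate B3 sigma1"

definition hurwitz_move :: "('g, 'm) monoid_scheme \<Rightarrow> 'g list \<Rightarrow> 'g list \<Rightarrow> bool" where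
  "hurwitz_move G ms ms' \<longleftrightarrow>
     (\<exists>xs g h ys. ms = xs @ [g, h] @ ys \<and>
        ms' = xs @ [inv\<^bsub>G\<^esub> g \<otimes>\<^bsub>G\<^esub> h \<otimes>\<^bsub>G\<^esub> g, g] @ ys)"

definition strongly_equivalent :: "('g, 'm) monoid_scheme \<Rightarrow> 'g list \<Rightarrow> 'g list \<Rightarrow> bool" where
  "strongly_equivalent G = equivclp (hurwitz_move G)"

text \<open>The product is taken in reverse order: \<open>m\<^sub>r \<cdots> m\<^sub>1\<close>.\<close>

definition monodromy_at_infinity :: "('g, 'm) monoid_scheme \<Rightarrow> 'g list \<Rightarrow> 'g" where
  "monodromy_at_infinity G ms = foldl (\<lambda>g m. m \<otimes>\<^bsub>G\<^esub> g) \<one>\<^bsub>G\<^esub> ms"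

definition monodromy_group :: "('g, 'm) monoid_scheme \<Rightarrow> 'g list \<Rightarrow> 'g set" where
  "monodromy_group G ms = generate G (set ms)"

text \<open>The simple lifts of a simple factorization exist and are unique.\<close>

definition lift_SL2Z :: "(int^2^2) set list \<Rightarrow> (int^2^2) list" where
  "lift_SL2Z ms = (THE ns. simple_SL2Z ns \<and> map to_PSL2Z ns = ms)"

definition lift_B3 :: "(int^2^2) set list \<Rightarrow> braid_gen word set list" where
  "lift_B3 ms = (THE bs. simple_B3 bs \<and> map (to_PSL2Z \<circ> B3_to_SL2Z) bs = ms)"

datatype free_gen = Alpha1 | Alpha2 | Alpha3

fun artin_gen :: "braid_gen \<times> bool \<Rightarrow> free_gen \<Rightarrow> free_gen word" where
  "artin_gen (Sigma1, True) Alpha1 = [(Alpha1, True), (Alpha2, True), (Alpha1, False)]"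
| "artin_gen (Sigma1, True) Alpha2 = [(Alpha1, True)]"
| "artin_gen (Sigma1, True) Alpha3 = [(Alpha3, True)]"
| "artin_gen (Sigma2, True) Alpha1 = [(Alpha1, True)]"
| "artin_gen (Sigma2, True) Alpha2 = [(Alpha2, True), (Alpha3, True), (Alpha2, False)]"
| "artin_gen (Sigma2, True) Alpha3 = [(Alpha2, True)]"
| "artin_gen (Sigma1, False) Alpha1 = [(Alpha2, True)]"
| "artin_gen (Sigma1, False) Alpha2 = [(Alpha2, False), (Alpha1, True), (Alpha2, True)]"
| "artin_gen (Sigma1, False) Alpha3 = [(Alpha3, True)]"
| "artin_gen (Sigma2, False) Alpha1 = [(Alpha1, True)]"
| "artin_gen (Sigma2, False) Alpha2 = [(Alpha3, True)]"
| "artin_gen (Sigma2, False) Alpha3 = [(Alpha3, False), (Alpha2, True), (Alpha3, True)]"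

definition subst_word :: "('x \<Rightarrow> 'y word) \<Rightarrow> 'x word \<Rightarrow> 'y word" where
  "subst_word f w = concat (map (\<lambda>(x, e). if e then f x else inv_word (f x)) w)"

text \<open>This is a left action: \<open>artin (v @ w) u = artin v (artin w u)\<close>.\<close>

definition artin :: "braid_gen word \<Rightarrow> free_gen word \<Rightarrow> free_gen word" where
  "artin w u = foldr (\<lambda>s. subst_word (artin_gen s)) w u"

text \<open>A braid is a class of words.  Different words \<open>w\<close> in the class give values
  \<open>artin w [(x, True)]\<close> that are equal in the free group, so ranging over all of them
  amounts to one relation for each braid and each generator.\<close>

definition fundamental_group :: "(int^2^2) set list \<Rightarrow> free_gen word set monoid" where
  "fundamental_group ms = presented_group
     {(artin w [(x, True)], [(x, True)]) | b w x. b \<in> set (lift_B3 ms) \<and> w \<in> b}"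

text \<open>Vectors are columns of coordinates in the basis \<open>a, b\<close>, so \<open>a \<cdot> b = 1\<close> reads as follows.\<close>

definition skew :: "int^2 \<Rightarrow> int^2 \<Rightarrow> int" where
  "skew x y = x$1 * y$2 - x$2 * y$1"

definition H_group :: "(int^2) monoid" where
  "H_group = \<lparr>carrier = UNIV, mult = (+), one = 0\<rparr>"

definition H_sum :: "nat \<Rightarrow> (nat \<Rightarrow> int^2) monoid" where
  "H_sum r = product_group {..<r} (\<lambda>_. H_group)"

definition chi :: "(int^2^2) list \<Rightarrow> (nat \<Rightarrow> int^2) \<Rightarrow> int^2" where
  "chi ns x = (\<Sum>i<length ns. ns ! i *v x i - x i)"

definition q_form :: "(int^2^2) list \<Rightarrow> (nat \<Rightarrow> int^2) \<Rightarrow> int" where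
  "q_form ns x =
     - (\<Sum>i<length ns. skew (x i) (ns ! i *v x i))
     + (\<Sum>j<length ns. \<Sum>i<j. skew (ns ! i *v x i - x i) (ns ! j *v x j - x j))"

definition ker_chi :: "(int^2^2) list \<Rightarrow> (nat \<Rightarrow> int^2) set" where
  "ker_chi ns = kernel (H_sum (length ns)) H_group (chi ns)"

definition ker_chi_perp :: "(int^2^2) list \<Rightarrow> (nat \<Rightarrow> int^2) set" where
  "ker_chi_perp ns =
     {x \<in> ker_chi ns. \<forall>y\<in>ker_chi ns. q_form ns (y \<otimes>\<^bsub>H_sum (length ns)\<^esub> x) = q_form ns y}"

definition transcendental_lattice :: "(int^2^2) set list \<Rightarrow> (nat \<Rightarrow> int^2) set monoid" where
  "transcendental_lattice ms = (let ns = lift_SL2Z ms in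
     (H_sum (length ns)\<lparr>carrier := ker_chi ns\<rparr>) Mod ker_chi_perp ns)"

text \<open>\<open>q_form\<close> is constant on the cosets of \<open>ker_chi_perp\<close>.\<close>

definition transcendental_form :: "(int^2^2) set list \<Rightarrow> (nat \<Rightarrow> int^2) set \<Rightarrow> int" where
  "transcendental_form ms c = the_elem (q_form (lift_SL2Z ms) ` c)"

definition isometric ::
  "('g, 'm) monoid_scheme \<Rightarrow> ('g \<Rightarrow> int) \<Rightarrow> ('h, 'n) monoid_scheme \<Rightarrow> ('h \<Rightarrow> int) \<Rightarrow> bool" where
  "isometric G q G' q' \<longleftrightarrow> (\<exists>\<phi>\<in>iso G G'. \<forall>x\<in>carrier G. q' (\<phi> x) = q x)"

end

theory Submission
  imports Defs "HOL-Computational_Algebra.Formal_Power_Series"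
begin

text \<open>The factorizations come from plane binary trees.  Put a loop at every leaf of a plane trivalent
  tree with \<open>k + 2\<close> leaves: the result is a trivalent ribbon graph with \<open>2 (k + 1)\<close> vertices whose faces
  are the \<open>k + 2\<close> loops and one outer face of width \<open>5 k + 4\<close>.  The modular group, being the free product
  of the cyclic groups generated by \<open>X\<close> (rotate about a vertex) and \<open>Y\<close> (reverse an edge), acts on its
  \<open>6 (k + 1)\<close> half-edges; the stabilizer of a half-edge is generated by the \<open>k + 2\<close> parabolic elements that
  run to a leaf, round its loop and back.  Taken in the order of the leaves they form the factorization,
  and their product runs once round the outer face.  If the base half-edge lies on that face, the product
  is \<open>(XY)\<close> to the power \<open>- (5 k + 4)\<close>.  The tree and the base half-edge can be read off from the stabilizer,
  and Hurwitz moves do not change the generated subgroup, so different choices are never strongly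
  equivalent.  An outer base half-edge is either one of the two ends of a tree edge, which splits the
  tree into an ordered pair of rooted trees, or it belongs to a loop, and then removing the leaf leaves
  a rooted tree.  There are \<open>C (k + 1)\<close> choices of the first and \<open>C k\<close> of the second kind, and
  \<open>C (k + 1) + C k = (5 k + 4) / (k + 2) * C k\<close> (\<open>T_tilde_card\<close>).

  Transcendental lattice.  The lift of each factor is a transvection \<open>x - (x \<cdot> v) v\<close>, so the lattice only
  depends on the sequence of the vectors \<open>v\<close>: it is the form \<open>\<Sum> c\<^sub>i\<^sup>2 + \<Sum>\<^sub>i\<^sub><\<^sub>j c\<^sub>i c\<^sub>j v\<^sub>i \<cdot> v\<^sub>j\<close> on the integer
  relations \<open>\<Sum> c\<^sub>i v\<^sub>i = 0\<close>, modulo its radical.  Sequences are considered up to integral changes of basis that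
  preserve the form and the map \<open>c \<mapsto> \<Sum> c\<^sub>i v\<^sub>i\<close>.  This is coarser than Hurwitz equivalence once terms of
  square \<open>- 1\<close> are admitted, since a pair of terms of square \<open>1\<close> can be traded for a pair of square \<open>- 1\<close>.
  Up to this relation a branch of the tree depends on its number of leaves only: it has a normal form with
  one term \<open>(1, \<plusminus>1)\<close>, all others being multiples of \<open>(0, 1)\<close> by \<open>3\<close> or \<open>1\<close> of square \<open>- 1\<close>
  (\<open>seq_equiv_branch\<close>).  On relations the form is moreover invariant under cyclic rotation, which moves
  the base edge next to a leaf (\<open>lat_equiv_skeleton\<close>).

  Fundamental group.  It only depends on the set of braids, and conjugating all braids does not change it,
  so the base half-edge is irrelevant.  For \<open>k \<le> 1\<close> there is only one unrooted tree.  For \<open>k \<ge> 2\<close>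
  the tree contains, after a change of the base edge, one of three small branches, whose relations alone
  identify the three generators (\<open>fundamental_group_skeleton_integer\<close>).  The lift to the braid group
  is well defined because the kernel of the projection to the modular group is generated by the full
  twist, which has exponent sum \<open>6\<close> (\<open>braid_eqI\<close>).\<close>

section \<open>The modular group\<close>

definition mat2 :: "int \<Rightarrow> int \<Rightarrow> int \<Rightarrow> int \<Rightarrow> int^2^2" where
  "mat2 a b c d = vector [vector [a, b], vector [c, d]]"

definition vec2 :: "int \<Rightarrow> int \<Rightarrow> int^2" where
  "vec2 x y = vector [x, y]"

lemma mat2_nth [simp]:
  "mat2 a b c d $ 1 $ 1 = a" "mat2 a b c d $ 1 $ 2 = b"
  "mat2 a b c d $ 2 $ 1 = c" "mat2 a b c d $ 2 $ 2 = d"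
  by (simp_all add: mat2_def)

lemma vec2_nth [simp]: "vec2 x y $ 1 = x" "vec2 x y $ 2 = y"
  by (simp_all add: vec2_def)

lemma mat2_eq_iff [simp]:
  "mat2 a b c d = mat2 a' b' c' d' \<longleftrightarrow> a = a' \<and> b = b' \<and> c = c' \<and> d = d'"
  by (metis mat2_nth)

lemma vec2_eq_iff [simp]: "vec2 x y = vec2 x' y' \<longleftrightarrow> x = x' \<and> y = y'"
  by (metis vec2_nth)

lemma mat2_cases: obtains a b c d where "A = mat2 a b c d"
proof
  show "A = mat2 (A$1$1) (A$1$2) (A$2$1) (A$2$2)"
    by (simp add: vec_eq_iff forall_2)
qed

lemma vec2_cases: obtains x y where "v = vec2 x y"
proof
  show "v = vec2 (v$1) (v$2)"
    by (simp add: vec_eq_iff forall_2)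
qed

lemma mat2_mult [simp]:
  "mat2 a b c d ** mat2 a' b' c' d' =
     mat2 (a * a' + b * c') (a * b' + b * d') (c * a' + d * c') (c * b' + d * d')"
  by (simp add: vec_eq_iff forall_2 matrix_matrix_mult_def sum_2)

lemma mat2_mult_vec [simp]:
  "mat2 a b c d *v vec2 x y = vec2 (a * x + b * y) (c * x + d * y)"
  by (simp add: vec_eq_iff forall_2 matrix_vector_mult_def sum_2)

lemma det_mat2 [simp]: "det (mat2 a b c d) = a * d - b * c"
  by (simp add: det_2)

lemma mat2_uminus [simp]: "- mat2 a b c d = mat2 (- a) (- b) (- c) (- d)"
  by (simp add: vec_eq_iff forall_2)

lemma vec2_arith [simp]:
  "- vec2 x y = vec2 (- x) (- y)"
  "vec2 x y + vec2 x' y' = vec2 (x + x') (y + y')"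
  "vec2 x y - vec2 x' y' = vec2 (x - x') (y - y')"
  "0 = vec2 x y \<longleftrightarrow> x = 0 \<and> y = 0"
  "vec2 x y = 0 \<longleftrightarrow> x = 0 \<and> y = 0"
  "k *s vec2 x y = vec2 (k * x) (k * y)"
  by (auto simp: vec_eq_iff forall_2)

lemma mat_1_mat2: "mat 1 = mat2 1 0 0 1"
  by (simp add: vec_eq_iff forall_2 mat_def)

lemma matX_mat2: "matX = mat2 (-1) 1 (-1) 0" and matY_mat2: "matY = mat2 0 (-1) 1 0"
  by (simp_all add: matX_def matY_def mat2_def)

lemma minus_mult_mat [simp]:
  fixes A B :: "int^2^2"
  shows "(- A) ** B = - (A ** B)" "A ** (- B) = - (A ** B)"
  by (cases A rule: mat2_cases; cases B rule: mat2_cases; simp)+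

lemma minus_mat_vec [simp]: "(- A :: int^2^2) *v v = - (A *v v)"
  by (cases A rule: mat2_cases; cases v rule: vec2_cases; simp)

lemma det_minus_2 [simp]: "det (- A) = det (A :: int^2^2)"
  by (cases A rule: mat2_cases; simp)

lemma SL2Z_carrier: "A \<in> carrier SL2Z \<longleftrightarrow> det A = 1"
  by (simp add: SL2Z_def)

lemma SL2Z_mult [simp]: "A \<otimes>\<^bsub>SL2Z\<^esub> B = A ** B" and SL2Z_one [simp]: "\<one>\<^bsub>SL2Z\<^esub> = mat 1"
  by (simp_all add: SL2Z_def)

lemma group_SL2Z: "group SL2Z"
proof (rule groupI)
  fix A assume A: "A \<in> carrier SL2Z"
  obtain a b c d where "A = mat2 a b c d" by (rule mat2_cases)
  with A show "\<exists>B\<in>carrier SL2Z. B \<otimes>\<^bsub>SL2Z\<^esub> A = \<one>\<^bsub>SL2Z\<^esub>"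
    by (intro bexI[of _ "mat2 d (-b) (-c) a"])
       (auto simp: SL2Z_carrier mat_1_mat2 algebra_simps)
qed (auto simp: SL2Z_carrier det_mul matrix_mul_assoc)

interpretation SL2Z: group SL2Z by (rule group_SL2Z)

lemma inv_SL2Z_mat2:
  assumes "a * d - b * c = 1"
  shows "inv\<^bsub>SL2Z\<^esub> (mat2 a b c d) = mat2 d (-b) (-c) a"
  using assms
  by (intro SL2Z.inv_equality) (auto simp: SL2Z_carrier mat_1_mat2 algebra_simps)

lemma minus_one_SL2Z: "- mat 1 \<in> carrier SL2Z" "mat 1 \<in> carrier SL2Z"
  by (simp_all add: SL2Z_carrier)

lemma minus_in_SL2Z [simp]: "A \<in> carrier SL2Z \<Longrightarrow> - A \<in> carrier SL2Z"
  by (simp add: SL2Z_carrier)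

lemma matX_in [simp]: "matX \<in> carrier SL2Z" and matY_in [simp]: "matY \<in> carrier SL2Z"
  by (simp_all add: SL2Z_carrier matX_mat2 matY_mat2)

lemma mult_in_SL2Z [simp]: "A \<in> carrier SL2Z \<Longrightarrow> B \<in> carrier SL2Z \<Longrightarrow> A ** B \<in> carrier SL2Z"
  using SL2Z.m_closed by simp

lemma inv_minus_SL2Z:
  assumes "A \<in> carrier SL2Z"
  shows "inv\<^bsub>SL2Z\<^esub> (- A) = - (inv\<^bsub>SL2Z\<^esub> A)"
  using assms SL2Z.l_inv[OF assms]
  by (intro SL2Z.inv_equality) auto

abbreviation pm_one :: "(int^2^2) set" where "pm_one \<equiv> {mat 1, - mat 1}"

lemma pm_one_normal: "pm_one \<lhd> SL2Z"
proof (rule SL2Z.normalI)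
  show "subgroup pm_one SL2Z"
    using inv_minus_SL2Z[of "mat 1"] SL2Z.inv_one
    by (intro SL2Z.subgroupI) (auto simp: minus_one_SL2Z)
  show "\<forall>A\<in>carrier SL2Z. pm_one #>\<^bsub>SL2Z\<^esub> A = A <#\<^bsub>SL2Z\<^esub> pm_one"
    by (auto simp: r_coset_def l_coset_def)
qed

interpretation pm_one: normal pm_one SL2Z by (rule pm_one_normal)

lemma to_PSL2Z_eq: "to_PSL2Z A = {A, - A}"
  by (auto simp: to_PSL2Z_def r_coset_def)

lemma to_PSL2Z_eq_iff: "to_PSL2Z A = to_PSL2Z B \<longleftrightarrow> A = B \<or> A = - B"
  by (auto simp: to_PSL2Z_eq doubleton_eq_iff)

lemma to_PSL2Z_minus [simp]: "to_PSL2Z (- A) = to_PSL2Z A"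
  by (simp add: to_PSL2Z_eq_iff)

lemma carrier_PSL2Z: "carrier PSL2Z = to_PSL2Z ` carrier SL2Z"
  by (auto simp: PSL2Z_def FactGroup_def RCOSETS_def to_PSL2Z_def)

lemma to_PSL2Z_in [simp]: "A \<in> carrier SL2Z \<Longrightarrow> to_PSL2Z A \<in> carrier PSL2Z"
  by (simp add: carrier_PSL2Z)

lemma to_PSL2Z_mult:
  "A \<in> carrier SL2Z \<Longrightarrow> B \<in> carrier SL2Z \<Longrightarrow>
   to_PSL2Z A \<otimes>\<^bsub>PSL2Z\<^esub> to_PSL2Z B = to_PSL2Z (A ** B)"
  using pm_one.rcos_sum[of A B] by (simp add: PSL2Z_def to_PSL2Z_def FactGroup_def)

lemma group_PSL2Z: "group PSL2Z"
  unfolding PSL2Z_def by (rule pm_one.factorgroup_is_group)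

interpretation PSL2Z: group PSL2Z by (rule group_PSL2Z)

lemma to_PSL2Z_one: "\<one>\<^bsub>PSL2Z\<^esub> = to_PSL2Z (mat 1)"
  by (auto simp: PSL2Z_def FactGroup_def to_PSL2Z_eq)

lemma to_PSL2Z_inv:
  assumes "A \<in> carrier SL2Z"
  shows "inv\<^bsub>PSL2Z\<^esub> (to_PSL2Z A) = to_PSL2Z (inv\<^bsub>SL2Z\<^esub> A)"
  using assms SL2Z.l_inv[OF assms]
  by (intro PSL2Z.inv_equality) (auto simp: to_PSL2Z_mult to_PSL2Z_one)

subsection \<open>Words in the two generators\<close>

datatype modgen = GX | GY

primrec modgen_mat :: "modgen \<Rightarrow> int^2^2" where
  "modgen_mat GX = matX"
| "modgen_mat GY = matY"

definition modmat :: "modgen list \<Rightarrow> int^2^2" where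
  "modmat w = foldr (\<lambda>c A. modgen_mat c ** A) w (mat 1)"

lemma modmat_Nil [simp]: "modmat [] = mat 1"
  and modmat_Cons: "modmat (c # w) = modgen_mat c ** modmat w"
  by (simp_all add: modmat_def)

lemma modmat_append: "modmat (u @ v) = modmat u ** modmat v"
  by (induction u) (simp_all add: modmat_Cons matrix_mul_assoc)

lemma modmat_in [simp]: "modmat w \<in> carrier SL2Z"
proof (induction w)
  case (Cons c w)
  then show ?case by (cases c) (simp_all add: modmat_Cons)
qed (simp add: minus_one_SL2Z)

lemma modmat_XXX: "modmat [GX, GX, GX] = mat 1"
  by (simp add: modmat_Cons matX_mat2 mat_1_mat2)

lemma modmat_YY: "modmat [GY, GY] = - mat 1"
  by (simp add: modmat_Cons matY_mat2 mat_1_mat2)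

text \<open>The relations \<open>X\<^sup>3 = 1\<close> and \<open>Y\<^sup>2 = - 1\<close> shorten exactly the words with one of these factors.\<close>

definition reducible :: "modgen list \<Rightarrow> bool" where
  "reducible w \<longleftrightarrow> (\<exists>u v. w = u @ [GX, GX, GX] @ v \<or> w = u @ [GY, GY] @ v)"

lemma reducible_Cons: "reducible w \<Longrightarrow> reducible (c # w)"
  unfolding reducible_def by (metis append_Cons)

lemma reducible_start: "reducible (GX # GX # GX # w)" "reducible (GY # GY # w)"
  unfolding reducible_def by (metis append_Cons append_Nil)+

primrec modgen_act :: "modgen \<Rightarrow> int \<times> int \<Rightarrow> int \<times> int" where
  "modgen_act GX p = (snd p - fst p, - fst p)"
| "modgen_act GY p = (- snd p, fst p)"

lemma modmat_vec:
  "modmat w *v vec2 x y = (case foldr modgen_act w (x, y) of (x', y') \<Rightarrow> vec2 x' y')"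
proof (induction w)
  case (Cons c w)
  then show ?case
    by (cases c)
       (auto simp: modmat_Cons matX_mat2 matY_mat2 split: prod.splits
         simp flip: matrix_vector_mul_assoc)
qed simp

text \<open>Ping-pong.  \<open>Y\<close> exchanges the vectors with coordinates of equal and of opposite sign, while \<open>X\<close> and \<open>X\<^sup>2\<close>
  map the latter to the former and increase \<open>\<bar>x\<bar> + \<bar>y\<bar>\<close>.  The start vector is chosen so that the last
  block of the word meets a vector of the kind that it moves in this way.\<close>

lemma ping_pong:
  assumes "\<not> reducible w" "w \<noteq> []"
    and "x = 1" "y = (if last w = GY then 1 else - 1)"
  shows "(case foldr modgen_act w (x, y) of (x', y') \<Rightarrow>
     if hd w = GY then x' * y' < 0 \<and> (if GX \<in> set w then \<bar>x'\<bar> + \<bar>y'\<bar> > 2 else \<bar>x'\<bar> + \<bar>y'\<bar> = 2) else x' * y' > 0 \<and> \<bar>x'\<bar> + \<bar>y'\<bar> > 2)"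
  using assms
proof (induction w rule: length_induct)
  case (1 w)
  define x' y' where "x' u = fst (foldr modgen_act u (x, y))"
    and "y' u = snd (foldr modgen_act u (x, y))" for u
  have step: "x' (GX # u) = y' u - x' u" "y' (GX # u) = - x' u"
    "x' (GY # u) = - y' u" "y' (GY # u) = x' u" for u
    by (simp_all add: x'_def y'_def)
  have IH: "if hd u = GY then x' u * y' u < 0 \<and>
        (if GX \<in> set u then \<bar>x' u\<bar> + \<bar>y' u\<bar> > 2 else \<bar>x' u\<bar> + \<bar>y' u\<bar> = 2)
      else x' u * y' u > 0 \<and> \<bar>x' u\<bar> + \<bar>y' u\<bar> > 2"
    if "length u < length w" "u \<noteq> []" "\<not> reducible u" "last u = last w" for u
    using 1(1)[rule_format, OF that(1,3,2)] 1(4,5) that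
    by (simp add: case_prod_beta x'_def y'_def)
  have nil: "x' [] = 1" "y' [] = (if last w = GY then 1 else - 1)"
    using 1(4,5) by (simp_all add: x'_def y'_def)
  have goal: "?case \<longleftrightarrow> (if hd w = GY then x' w * y' w < 0 \<and>
        (if GX \<in> set w then \<bar>x' w\<bar> + \<bar>y' w\<bar> > 2 else \<bar>x' w\<bar> + \<bar>y' w\<bar> = 2)
      else x' w * y' w > 0 \<and> \<bar>x' w\<bar> + \<bar>y' w\<bar> > 2)"
    by (simp add: case_prod_beta x'_def y'_def)
  have GX_if: "GX \<in> set u" if "hd u = GX" "u \<noteq> []" for u
    using that by (cases u) auto
  have step_X: ?case if w: "w = GX # u" and "u = [] \<or> hd u = GY" for u
  proof (cases "u = []")
    case False
    have "\<not> reducible u" using 1(2) w reducible_Cons by blast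
    then have "x' u * y' u < 0" "\<bar>x' u\<bar> + \<bar>y' u\<bar> \<ge> 2"
      using IH[of u] that False by (auto split: if_splits)
    then show ?thesis unfolding goal unfolding w
      by (auto simp: step mult_less_0_iff zero_less_mult_iff)
  qed (use w goal step nil in simp)
  have step_XX: ?case if w: "w = GX # GX # u" and "u = [] \<or> hd u = GY" for u
  proof (cases "u = []")
    case False
    have "\<not> reducible u" using 1(2) w reducible_Cons by blast
    then have "x' u * y' u < 0" "\<bar>x' u\<bar> + \<bar>y' u\<bar> \<ge> 2"
      using IH[of u] that False by (auto split: if_splits)
    then show ?thesis unfolding goal unfolding w
      by (auto simp: step mult_less_0_iff zero_less_mult_iff)
  qed (use w goal step nil in simp)
  have step_Y: ?case if w: "w = GY # u" and "u = [] \<or> hd u = GX" for u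
  proof (cases "u = []")
    case False
    have "\<not> reducible u" using 1(2) w reducible_Cons by blast
    then have "x' u * y' u > 0" "\<bar>x' u\<bar> + \<bar>y' u\<bar> > 2" "GX \<in> set u"
      using IH[of u] that False GX_if by (auto split: if_splits)
    then show ?thesis unfolding goal unfolding w
      by (auto simp: step mult_less_0_iff zero_less_mult_iff)
  qed (use w goal step nil in simp)
  show ?case
  proof (cases w)
    case (Cons c u)
    show ?thesis
    proof (cases c)
      case GY
      with \<open>\<not> reducible w\<close> Cons reducible_start have "u = [] \<or> hd u = GX"
        by (metis list.collapse modgen.exhaust)
      then show ?thesis by (rule step_Y[rotated]) (simp add: Cons GY)
    next
      case GX
      show ?thesis
      proof (cases "u = [] \<or> hd u = GY")
        case True
        then show ?thesis by (rule step_X[rotated]) (simp add: Cons GX)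
      next
        case False
        then obtain u' where u': "u = GX # u'"
          by (metis list.collapse modgen.exhaust)
        with \<open>\<not> reducible w\<close> Cons GX reducible_start have "u' = [] \<or> hd u' = GY"
          by (metis list.collapse modgen.exhaust)
        then show ?thesis by (rule step_XX[rotated]) (simp add: Cons GX u')
      qed
    qed
  qed (use 1 in simp)
qed

text \<open>An irreducible word with value \<open>\<plusminus>1\<close> would map the start vector to itself up to sign, hence preserve
  its norm and the sign of the product of its coordinates.\<close>

lemma kernel_reducible:
  assumes "modmat w = mat 1 \<or> modmat w = - mat 1" "w \<noteq> []"
  shows "reducible w"
proof (rule ccontr)
  assume "\<not> reducible w"
  note pp = ping_pong[OF this assms(2) refl refl]
  define y :: int where "y = (if last w = GY then 1 else - 1)"
  have yy: "\<bar>y\<bar> = 1" by (simp add: y_def)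
  have "modmat w *v vec2 1 y = vec2 1 y \<or> modmat w *v vec2 1 y = - vec2 1 y"
    using assms(1) by (auto simp: mat_1_mat2)
  then have "foldr modgen_act w (1, y) = (1, y) \<or> foldr modgen_act w (1, y) = (- 1, - y)"
    unfolding modmat_vec by (auto split: prod.splits)
  with pp yy have "hd w = GY" "y < 0"
    unfolding y_def[symmetric] by (auto split: if_splits)
  then have "last w = GX" using y_def modgen.exhaust by (auto split: if_splits)
  then have "GX \<in> set w" using assms(2) last_in_set by metis
  with pp yy \<open>foldr modgen_act w (1, y) = (1, y) \<or> _\<close> \<open>hd w = GY\<close> show False
    unfolding y_def[symmetric] by auto
qed

text \<open>The modular group is presented by \<open>X\<^sup>3 = Y\<^sup>2 = 1\<close>, in the form in which it is used: whatever holds for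
  the empty word and is stable under inserting a relator holds for all words with value \<open>\<plusminus>1\<close>.\<close>

lemma modmat_kernel_induct [consumes 1, case_names Nil XXX YY]:
  assumes "modmat w = mat 1 \<or> modmat w = - mat 1"
    and "P []"
    and "\<And>u v. P (u @ v) \<Longrightarrow> P (u @ [GX, GX, GX] @ v)"
    and "\<And>u v. P (u @ v) \<Longrightarrow> P (u @ [GY, GY] @ v)"
  shows "P w"
  using assms(1)
proof (induction w rule: length_induct)
  case (1 w)
  show ?case
  proof (cases "w = []")
    case False
    then obtain u v where "w = u @ [GX, GX, GX] @ v \<or> w = u @ [GY, GY] @ v"
      using kernel_reducible 1(2) unfolding reducible_def by blast
    then show ?thesis
    proof
      assume w: "w = u @ [GX, GX, GX] @ v"
      then have len: "length (u @ v) < length w" by simp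
      from w have "modmat w = modmat (u @ v)"
        by (simp only: modmat_append modmat_XXX matrix_mul_lid)
      then have "P (u @ v)" using 1(1) 1(2) w by (metis len)
      then show "P w" using assms(3) w by simp
    next
      assume w: "w = u @ [GY, GY] @ v"
      then have len: "length (u @ v) < length w" by simp
      from w have "modmat w = - modmat (u @ v)"
        by (simp only: modmat_append modmat_YY minus_mult_mat matrix_mul_lid)
      then have "modmat (u @ v) = mat 1 \<or> modmat (u @ v) = - mat 1"
        using 1(2) by (metis minus_minus)
      then have "P (u @ v)" using 1(1) w by (metis len)
      then show "P w" using assms(4) w by simp
    qed
  qed (use assms(2) in simp)
qed

text \<open>Euclid's algorithm on the first column.\<close>

lemma modmat_generates:
  assumes "A \<in> carrier SL2Z"
  shows "\<exists>w. A = modmat w \<or> A = - modmat w"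
  using assms
proof (induction "nat \<bar>A$2$1\<bar>" arbitrary: A rule: less_induct)
  case less
  obtain a b c d where A: "A = mat2 a b c d" by (rule mat2_cases)
  have det: "a * d - b * c = 1" using less.prems A by (simp add: SL2Z_carrier)
  have U: "modmat (concat (replicate n [GX, GY])) = mat2 1 (int n) 0 1" for n
    by (induction n) (simp_all add: modmat_append modmat_Cons matX_mat2 matY_mat2 mat_1_mat2)
  have V: "\<exists>w. mat2 1 (- int n) 0 1 = modmat w \<or> mat2 1 (- int n) 0 1 = - modmat w" for n
  proof (induction n)
    case (Suc n)
    then obtain w where w: "mat2 1 (- int n) 0 1 = modmat w \<or> mat2 1 (- int n) 0 1 = - modmat w" by blast
    have "modmat ([GY, GX, GX] @ w) = - (mat2 1 (-1) 0 1 ** modmat w)"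
      by (cases "modmat w" rule: mat2_cases)
         (simp add: modmat_append modmat_Cons matX_mat2 matY_mat2 mat_1_mat2)
    moreover have "mat2 1 (-1) 0 1 ** modmat w = mat2 1 (- int (Suc n)) 0 1
       \<or> mat2 1 (-1) 0 1 ** modmat w = - mat2 1 (- int (Suc n)) 0 1"
    proof -
      have "modmat w = mat2 1 (- int n) 0 1 \<or> modmat w = - mat2 1 (- int n) 0 1"
        using w by (metis minus_minus)
      then show ?thesis by (elim disjE) simp_all
    qed
    ultimately show ?case by (metis minus_minus)
  qed (use mat_1_mat2 in \<open>intro exI[of _ "[]"], simp\<close>)
  have T: "\<exists>w. mat2 1 k 0 1 = modmat w \<or> mat2 1 k 0 1 = - modmat w" for k
  proof (cases "k \<ge> 0")
    case True
    then show ?thesis using U[of "nat k"] by (metis nat_0_le)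
  next
    case False
    then show ?thesis using V[of "nat (- k)"] by simp
  qed
  show ?case
  proof (cases "c = 0")
    case True
    then have "(a = 1 \<and> d = 1) \<or> (a = -1 \<and> d = -1)"
      using det zmult_eq_1_iff by auto
    then have "A = mat2 1 b 0 1 \<or> A = - mat2 1 (- b) 0 1" using A True by auto
    moreover obtain u where "mat2 1 b 0 1 = modmat u \<or> mat2 1 b 0 1 = - modmat u"
      using T by blast
    moreover obtain v where "mat2 1 (- b) 0 1 = modmat v \<or> mat2 1 (- b) 0 1 = - modmat v"
      using T by blast
    ultimately show ?thesis by (metis minus_minus)
  next
    case False
    \<comment> \<open>subtract \<open>q\<close> times the second row from the first, then exchange the rows\<close>
    define q where "q = a div c"
    define B where "B = mat2 0 1 (- 1) 0 ** (mat2 1 (- q) 0 1 ** A)"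
    have "B $ 2 $ 1 = - (a mod c)"
      by (simp add: B_def A q_def mult.commute minus_mult_div_eq_mod)
    then have "nat \<bar>B $ 2 $ 1\<bar> < nat \<bar>A $ 2 $ 1\<bar>"
      using False A abs_mod_less[of c a] by simp
    moreover have "B \<in> carrier SL2Z"
      using less.prems by (simp add: B_def SL2Z_carrier det_mul)
    ultimately obtain w where w: "B = modmat w \<or> B = - modmat w"
      using less.hyps by blast
    have "A = mat2 1 q 0 1 ** (matY ** B)"
      by (simp add: B_def A matY_mat2)
    moreover obtain u where "mat2 1 q 0 1 = modmat u \<or> mat2 1 q 0 1 = - modmat u"
      using T by blast
    ultimately have "A = modmat (u @ [GY] @ w) \<or> A = - modmat (u @ [GY] @ w)"
      using w by (auto simp: modmat_append modmat_Cons)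
    then show ?thesis by blast
  qed
qed

section \<open>Binary trees and Catalan numbers\<close>

datatype btree = Leaf | Node btree btree

primrec leaves :: "btree \<Rightarrow> nat" where
  "leaves Leaf = 1"
| "leaves (Node l r) = leaves l + leaves r"

lemma leaves_pos [simp]: "leaves t > 0"
  by (induction t) simp_all

definition trees :: "nat \<Rightarrow> btree set" where
  "trees k = {t. leaves t = k + 1}"

lemma trees_0: "trees 0 = {Leaf}"
proof -
  have "t = Leaf" if "leaves t = 1" for t
  proof (cases t)
    case (Node l r)
    then show ?thesis using that leaves_pos[of l] leaves_pos[of r] by simp
  qed
  then show ?thesis by (auto simp: trees_def)
qed

lemma trees_Suc:
  "trees (Suc k) = (\<Union>i\<in>{..k}. (\<lambda>(l, r). Node l r) ` (trees i \<times> trees (k - i)))"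
proof (intro equalityI subsetI)
  fix t assume t: "t \<in> trees (Suc k)"
  then obtain l r where lr: "t = Node l r"
    by (cases t) (auto simp: trees_def)
  then have "leaves l - 1 \<le> k" "l \<in> trees (leaves l - 1)" "r \<in> trees (k - (leaves l - 1))"
    using t leaves_pos[of l] leaves_pos[of r] by (auto simp: trees_def simp del: leaves_pos)
  then show "t \<in> (\<Union>i\<in>{..k}. (\<lambda>(l, r). Node l r) ` (trees i \<times> trees (k - i)))"
    using lr by force
qed (auto simp: trees_def)

lemma finite_trees [simp]: "finite (trees k)"
proof (induction k rule: less_induct)
  case (less k)
  then show ?case by (cases k) (auto simp: trees_0 trees_Suc)
qed

lemma card_trees_Suc: "card (trees (Suc k)) = (\<Sum>i\<le>k. card (trees i) * card (trees (k - i)))"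
proof -
  have "card (trees (Suc k)) = (\<Sum>i\<in>{..k}. card ((\<lambda>(l, r). Node l r) ` (trees i \<times> trees (k - i))))"
    unfolding trees_Suc by (rule card_UN_disjoint) (simp, simp, auto simp: trees_def)
  also have "\<dots> = (\<Sum>i\<in>{..k}. card (trees i \<times> trees (k - i)))"
    by (intro sum.cong card_image refl) (auto simp: inj_on_def)
  finally show ?thesis by (simp add: card_cartesian_product)
qed

text \<open>The generating function \<open>C\<close> satisfies \<open>C = 1 + x C\<^sup>2\<close>, so \<open>D = 1 - 2 x C\<close> is a square root of \<open>1 - 4 x\<close>.
  Differentiating gives \<open>(1 - 4 x) D' = - 2 D\<close>, a two-term recurrence for the coefficients.\<close>

lemma card_trees_recurrence:
  "rat_of_nat (k + 2) * of_nat (card (trees (Suc k))) = of_nat (4 * k + 2) * of_nat (card (trees k))"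
proof -
  define C :: "rat fps" where "C = Abs_fps (\<lambda>k. of_nat (card (trees k)))"
  define D where "D = 1 - fps_const 2 * (fps_X * C)"
  have C: "C = 1 + fps_X * C * C"
  proof (rule fps_ext)
    fix n
    show "fps_nth C n = fps_nth (1 + fps_X * C * C) n"
    proof (cases n)
      case 0
      then show ?thesis by (simp add: C_def trees_0 mult.assoc)
    next
      case (Suc m)
      have "fps_nth (1 + fps_X * C * C) (Suc m) = fps_nth (C * C) m"
        by (simp add: mult.assoc)
      also have "\<dots> = fps_nth C (Suc m)"
        by (simp add: C_def card_trees_Suc fps_mult_nth atLeast0AtMost)
      finally show ?thesis using Suc by simp
    qed
  qed
  have "D * D = 1 - fps_const 4 * fps_X * (C - fps_X * C * C)"
    unfolding D_def by (simp add: algebra_simps fps_const_mult[symmetric] numeral_fps_const[symmetric] del: fps_const_mult)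
  also have "C - fps_X * C * C = 1"
    using C by (simp add: algebra_simps)
  finally have DD: "D * D = 1 - fps_const 4 * fps_X" by simp
  have "2 * (D * fps_deriv D) = fps_deriv (D * D)"
    by (simp add: algebra_simps)
  also have "\<dots> = - fps_const 4"
    unfolding DD by simp
  finally have "2 * (D * fps_deriv D) = 2 * (- fps_const 2)"
    by (simp add: numeral_fps_const)
  then have e: "D * fps_deriv D = - fps_const 2"
    by (metis mult_left_cancel zero_neq_numeral)
  have "D * D * fps_deriv D = D * (D * fps_deriv D)" by (simp only: mult.assoc)
  also have "\<dots> = - (fps_const 2 * D)" by (simp only: e mult_minus_right mult.commute)
  finally have "D * D * fps_deriv D = - (fps_const 2 * D)" .
  then have "fps_nth ((1 - fps_const 4 * fps_X) * fps_deriv D) (Suc k) = fps_nth (- (fps_const 2 * D)) (Suc k)"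
    unfolding DD by simp
  then have "of_nat (k + 2) * fps_nth D (k + 2) - 4 * (of_nat (k + 1) * fps_nth D (k + 1)) = - 2 * fps_nth D (k + 1)"
    by (simp add: algebra_simps fps_mult_left_const_nth)
  moreover have "fps_nth D (Suc n) = - 2 * of_nat (card (trees n))" for n
    by (simp add: D_def C_def)
  ultimately show ?thesis by (simp add: algebra_simps)
qed

lemma central_binomial_Suc:
  "(k + 1) * ((2 * Suc k) choose (Suc k)) = (4 * k + 2) * ((2 * k) choose k)"
proof -
  define A B C where "A = (2 * k) choose k" and "B = (2 * k + 1) choose k"
    and "C = (2 * Suc k) choose (Suc k)"
  have "B = (2 * k + 1) choose (Suc k)"
    using binomial_symmetric[of "Suc k" "2 * k + 1"] by (simp add: B_def)
  then have "(k + 1) * B = (2 * k + 1) * A"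
    using Suc_times_binomial[of k "2 * k"] by (simp add: A_def)
  moreover have "(k + 1) * C = (2 * k + 2) * B"
    using Suc_times_binomial[of k "2 * k + 1"] by (simp add: B_def C_def)
  ultimately have "(k + 1) * C = (4 * k + 2) * A" by algebra
  then show ?thesis by (simp add: A_def C_def)
qed

lemma card_trees: "of_nat (card (trees k)) = catalan k"
proof (induction k)
  case 0
  then show ?case by (simp add: trees_0 catalan_def)
next
  case (Suc k)
  have c: "rat_of_nat (k + 1) * of_nat ((2 * Suc k) choose (Suc k)) = of_nat (4 * k + 2) * of_nat ((2 * k) choose k)"
    using central_binomial_Suc[of k] by (metis of_nat_mult)
  have "of_nat (k + 2) * rat_of_nat (card (trees (Suc k))) =
      of_nat (4 * k + 2) * of_nat ((2 * k) choose k) / of_nat (k + 1)"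
    using card_trees_recurrence[of k] Suc by (simp add: catalan_def)
  also have "\<dots> = of_nat ((2 * Suc k) choose (Suc k))"
    unfolding c[symmetric] by (simp del: binomial_Suc_Suc mult_Suc_right)
  finally show ?case
    unfolding catalan_def by (simp add: field_simps del: binomial_Suc_Suc mult_Suc_right of_nat_add)
qed

text \<open>The two summands count the two kinds of base half-edges on the outer face: ends of tree edges, where the
  tree splits into the two branches of one larger rooted tree, and loops.\<close>

lemma T_tilde_card: "T_tilde k = of_nat (card (trees (Suc k)) + card (trees k))"
  using card_trees_recurrence[of k]
  by (simp add: T_tilde_def card_trees[of k, symmetric] field_simps)

section \<open>Factorizations attached to trees\<close>

text \<open>The inverse up to sign, spelled with positive powers of the generators.\<close>

definition modinv :: "modgen list \<Rightarrow> modgen list" where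
  "modinv w = concat (map (\<lambda>c. case c of GX \<Rightarrow> [GX, GX] | GY \<Rightarrow> [GY]) (rev w))"

definition cls :: "modgen list \<Rightarrow> (int^2^2) set" where
  "cls w = to_PSL2Z (modmat w)"

lemma modinv_simps [simp]: "modinv [] = []" "modinv (u @ v) = modinv v @ modinv u"
  "modinv (c # w) = modinv w @ (case c of GX \<Rightarrow> [GX, GX] | GY \<Rightarrow> [GY])"
  by (simp_all add: modinv_def)

lemma PSL2Z_cancel:
  assumes "x \<in> carrier PSL2Z" "y \<in> carrier PSL2Z"
  shows "inv\<^bsub>PSL2Z\<^esub> x \<otimes>\<^bsub>PSL2Z\<^esub> (x \<otimes>\<^bsub>PSL2Z\<^esub> y) = y"
  using assms by (simp flip: PSL2Z.m_assoc)

lemma cls_in [simp]: "cls w \<in> carrier PSL2Z"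
  by (simp add: cls_def)

lemma cls_append: "cls (u @ v) = cls u \<otimes>\<^bsub>PSL2Z\<^esub> cls v"
  by (simp add: cls_def modmat_append to_PSL2Z_mult)

lemma cls_Nil: "cls [] = \<one>\<^bsub>PSL2Z\<^esub>"
  by (simp add: cls_def to_PSL2Z_one)

lemma cls_XXX: "cls [GX, GX, GX] = \<one>\<^bsub>PSL2Z\<^esub>" and cls_YY: "cls [GY, GY] = \<one>\<^bsub>PSL2Z\<^esub>"
  by (simp_all add: cls_def modmat_XXX modmat_YY to_PSL2Z_one)

lemma cls_inv: "inv\<^bsub>PSL2Z\<^esub> (cls w) = cls (modinv w)"
proof (rule PSL2Z.inv_equality)
  show "cls (modinv w) \<otimes>\<^bsub>PSL2Z\<^esub> cls w = \<one>\<^bsub>PSL2Z\<^esub>"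
  proof (induction w)
    case (Cons c w)
    have c: "cls (case c of GX \<Rightarrow> [GX, GX] | GY \<Rightarrow> [GY]) \<otimes>\<^bsub>PSL2Z\<^esub> cls [c] = \<one>\<^bsub>PSL2Z\<^esub>"
      by (cases c) (simp_all add: cls_XXX cls_YY flip: cls_append)
    have "cls (modinv (c # w)) \<otimes>\<^bsub>PSL2Z\<^esub> cls (c # w) =
       cls (modinv w) \<otimes>\<^bsub>PSL2Z\<^esub> (cls (case c of GX \<Rightarrow> [GX, GX] | GY \<Rightarrow> [GY]) \<otimes>\<^bsub>PSL2Z\<^esub> cls [c]) \<otimes>\<^bsub>PSL2Z\<^esub> cls w"
      using cls_append[of "[c]" w] by (simp add: cls_append PSL2Z.m_assoc)
    then show ?case unfolding c using Cons by simp
  qed (simp add: cls_Nil)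
qed simp_all

lemma cls_surj: "g \<in> carrier PSL2Z \<Longrightarrow> \<exists>w. g = cls w"
  using modmat_generates by (auto simp: carrier_PSL2Z cls_def to_PSL2Z_eq_iff)

lemma cls_eq_iff: "cls u = cls v \<longleftrightarrow> modmat (u @ modinv v) = mat 1 \<or> modmat (u @ modinv v) = - mat 1"
proof -
  have "cls u = cls v \<longleftrightarrow> cls (u @ modinv v) = \<one>\<^bsub>PSL2Z\<^esub>"
    by (metis PSL2Z.inv_equality PSL2Z.inv_inv PSL2Z.r_inv cls_append cls_in cls_inv)
  then show ?thesis by (simp add: cls_def to_PSL2Z_one to_PSL2Z_eq_iff)
qed

text \<open>The factor attached to a word is the conjugate of \<open>XY\<close> by its value.  The same word gives the lifts of
  the factor to \<open>SL2Z\<close> and to the braid group.\<close>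

definition twist :: "modgen list \<Rightarrow> int^2^2" where
  "twist w = modmat w ** (matX ** matY) ** inv\<^bsub>SL2Z\<^esub> (modmat w)"

definition factor :: "modgen list list \<Rightarrow> (int^2^2) set list" where
  "factor ws = map (\<lambda>w. to_PSL2Z (twist w)) ws"

lemma twist_in [simp]: "twist w \<in> carrier SL2Z"
  by (simp add: twist_def)

lemma twist_cls: "to_PSL2Z (twist w) = cls (w @ [GX, GY] @ modinv w)"
proof -
  have "to_PSL2Z (twist w) = cls w \<otimes>\<^bsub>PSL2Z\<^esub> to_PSL2Z (matX ** matY) \<otimes>\<^bsub>PSL2Z\<^esub> inv\<^bsub>PSL2Z\<^esub> (cls w)"
    by (simp add: twist_def cls_def to_PSL2Z_inv to_PSL2Z_mult)
  also have "to_PSL2Z (matX ** matY) = cls [GX, GY]"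
    by (simp add: cls_def modmat_Cons)
  also have "cls w \<otimes>\<^bsub>PSL2Z\<^esub> cls [GX, GY] \<otimes>\<^bsub>PSL2Z\<^esub> inv\<^bsub>PSL2Z\<^esub> (cls w) = cls (w @ [GX, GY] @ modinv w)"
    unfolding cls_inv cls_append by (rule PSL2Z.m_assoc) simp_all
  finally show ?thesis .
qed

lemma factor_append: "factor (us @ vs) = factor us @ factor vs"
  by (simp add: factor_def)

lemma simple_factor: "simple_PSL2Z (factor ws)"
proof -
  have "to_PSL2Z (twist w) = cls w \<otimes>\<^bsub>PSL2Z\<^esub> to_PSL2Z (matX ** matY) \<otimes>\<^bsub>PSL2Z\<^esub> inv\<^bsub>PSL2Z\<^esub> (cls w)" for w
    by (simp add: twist_def cls_def to_PSL2Z_inv to_PSL2Z_mult)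
  then have "\<exists>x\<in>carrier PSL2Z. to_PSL2Z (twist w) =
     x \<otimes>\<^bsub>PSL2Z\<^esub> to_PSL2Z (matX ** matY) \<otimes>\<^bsub>PSL2Z\<^esub> inv\<^bsub>PSL2Z\<^esub> x" for w
    using cls_in by blast
  then have "conjugate_in PSL2Z (to_PSL2Z (matX ** matY)) (to_PSL2Z (twist w))" for w
    unfolding conjugate_in_def .
  then show ?thesis
    by (simp add: all_conjugate_def factor_def)
qed

text \<open>One word per leaf, in the order of the leaves.  From the half-edge at the root of a branch that points
  out of the branch, \<open>XY\<close> and \<open>X\<^sup>2Y\<close> lead to the roots of its two subtrees.  At a leaf, the remaining two half-edges form the loop,
  and \<open>X\<close> turns \<open>XY\<close> into the element \<open>X\<^sup>2 Y X\<^sup>-\<^sup>1\<close> that runs once round it.\<close>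

primrec branch :: "btree \<Rightarrow> modgen list list" where
  "branch Leaf = [[GX]]"
| "branch (Node l r) = map ((@) [GX, GY]) (branch l) @ map ((@) [GX, GX, GY]) (branch r)"

text \<open>The root of the tree is not a vertex of the skeleton but the midpoint of the base edge, which joins the
  roots of the two subtrees.  A single leaf has no base edge, and the value there is a dummy.\<close>

fun skeleton :: "btree \<Rightarrow> modgen list list" where
  "skeleton (Node l r) = branch l @ map ((@) [GY]) (branch r)"
| "skeleton Leaf = []"

lemma length_branch: "length (branch t) = leaves t"
  by (induction t) simp_all

lemma length_skeleton: "t \<noteq> Leaf \<Longrightarrow> length (skeleton t) = leaves t"
  by (cases t) (simp_all add: length_branch)

subsection \<open>Monodromy at infinity\<close>

text \<open>The product is taken from right to left; an initial value stays at the right end.\<close>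

lemma monodromy_foldl:
  assumes "group G" "set ms \<subseteq> carrier G" "g \<in> carrier G"
  shows "foldl (\<lambda>g m. m \<otimes>\<^bsub>G\<^esub> g) g ms = monodromy_at_infinity G ms \<otimes>\<^bsub>G\<^esub> g \<and>
    monodromy_at_infinity G ms \<in> carrier G"
proof -
  interpret group G by fact
  show ?thesis
    using assms(2,3)
  proof (induction ms arbitrary: g)
    case (Cons m ms)
    then have "foldl (\<lambda>g m. m \<otimes>\<^bsub>G\<^esub> g) (m \<otimes>\<^bsub>G\<^esub> g) ms = monodromy_at_infinity G ms \<otimes>\<^bsub>G\<^esub> (m \<otimes>\<^bsub>G\<^esub> g)"
      and "foldl (\<lambda>g m. m \<otimes>\<^bsub>G\<^esub> g) (m \<otimes>\<^bsub>G\<^esub> \<one>\<^bsub>G\<^esub>) ms = monodromy_at_infinity G ms \<otimes>\<^bsub>G\<^esub> (m \<otimes>\<^bsub>G\<^esub> \<one>\<^bsub>G\<^esub>)"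
      and "monodromy_at_infinity G ms \<in> carrier G"
      by auto
    with Cons.prems show ?case
      by (simp add: monodromy_at_infinity_def m_assoc)
  qed (simp add: monodromy_at_infinity_def)
qed

lemma factor_carrier: "set (factor ws) \<subseteq> carrier PSL2Z"
  by (auto simp: factor_def)

lemma monodromy_in: "monodromy_at_infinity PSL2Z (factor ws) \<in> carrier PSL2Z"
  using monodromy_foldl[OF group_PSL2Z factor_carrier PSL2Z.one_closed] by blast

lemma monodromy_append:
  "monodromy_at_infinity PSL2Z (factor (us @ vs)) =
   monodromy_at_infinity PSL2Z (factor vs) \<otimes>\<^bsub>PSL2Z\<^esub> monodromy_at_infinity PSL2Z (factor us)"
  using monodromy_foldl[OF group_PSL2Z factor_carrier monodromy_in, of us vs]
  unfolding monodromy_at_infinity_def factor_append foldl_append by blast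

lemma twist_append:
  "to_PSL2Z (twist (u @ w)) = cls u \<otimes>\<^bsub>PSL2Z\<^esub> to_PSL2Z (twist w) \<otimes>\<^bsub>PSL2Z\<^esub> inv\<^bsub>PSL2Z\<^esub> (cls u)"
  by (simp only: twist_cls cls_inv cls_append modinv_simps PSL2Z.m_assoc cls_in PSL2Z.m_closed)

lemma monodromy_conj:
  "monodromy_at_infinity PSL2Z (factor (map ((@) u) ws)) =
   cls u \<otimes>\<^bsub>PSL2Z\<^esub> monodromy_at_infinity PSL2Z (factor ws) \<otimes>\<^bsub>PSL2Z\<^esub> inv\<^bsub>PSL2Z\<^esub> (cls u)"
proof (induction ws rule: rev_induct)
  case Nil
  then show ?case by (simp add: monodromy_at_infinity_def factor_def)
next
  case (snoc w ws)
  have *: "monodromy_at_infinity PSL2Z (factor [w]) = to_PSL2Z (twist w)" for w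
    by (simp add: monodromy_at_infinity_def factor_def)
  have "cls u \<otimes>\<^bsub>PSL2Z\<^esub> a \<otimes>\<^bsub>PSL2Z\<^esub> inv\<^bsub>PSL2Z\<^esub> (cls u) \<otimes>\<^bsub>PSL2Z\<^esub> (cls u \<otimes>\<^bsub>PSL2Z\<^esub> b \<otimes>\<^bsub>PSL2Z\<^esub> inv\<^bsub>PSL2Z\<^esub> (cls u))
      = cls u \<otimes>\<^bsub>PSL2Z\<^esub> (a \<otimes>\<^bsub>PSL2Z\<^esub> b) \<otimes>\<^bsub>PSL2Z\<^esub> inv\<^bsub>PSL2Z\<^esub> (cls u)"
    if "a \<in> carrier PSL2Z" "b \<in> carrier PSL2Z" for a b
    using that by (simp add: PSL2Z.m_assoc PSL2Z_cancel)
  with snoc monodromy_in show ?case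
    by (simp add: monodromy_append * twist_append)
qed

lemma cls_mat2:
  "cls [] = to_PSL2Z (mat2 1 0 0 1)"
  "cls [GX, GY] = to_PSL2Z (mat2 1 1 0 1)"
  "cls [GX, GX, GY] = to_PSL2Z (mat2 1 0 1 1)"
  "cls [GY] = to_PSL2Z (mat2 0 (-1) 1 0)"
  by (simp_all add: cls_def to_PSL2Z_eq_iff modmat_Cons matX_mat2 matY_mat2 mat_1_mat2)

lemma to_PSL2Z_conj:
  assumes "g \<in> carrier SL2Z" "A \<in> carrier SL2Z"
  shows "to_PSL2Z g \<otimes>\<^bsub>PSL2Z\<^esub> to_PSL2Z A \<otimes>\<^bsub>PSL2Z\<^esub> inv\<^bsub>PSL2Z\<^esub> (to_PSL2Z g) =
    to_PSL2Z (g ** A ** inv\<^bsub>SL2Z\<^esub> g)"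
  using assms by (simp add: to_PSL2Z_mult to_PSL2Z_inv)

lemma mat2_in: "a * d - b * c = 1 \<Longrightarrow> mat2 a b c d \<in> carrier SL2Z"
  by (simp add: SL2Z_carrier)

text \<open>Going round a branch one always takes the same turn, so its monodromy is \<open>X\<^sup>2 (Y X\<^sup>2)\<^sup>s\<close> with \<open>s\<close> determined
  by the number of turns, hence by the number of leaves: \<open>s = 5 n - 4\<close>.\<close>

lemma monodromy_branch:
  "monodromy_at_infinity PSL2Z (factor (branch t)) =
   to_PSL2Z (mat2 0 (-1) 1 (3 - 5 * int (leaves t)))"
proof (induction t)
  case Leaf
  have "twist [GX] = mat2 0 1 (-1) 2"
    by (simp add: twist_def modmat_Cons matX_mat2 matY_mat2 mat_1_mat2 inv_SL2Z_mat2)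
  then show ?case
    by (simp add: monodromy_at_infinity_def factor_def mat2_in to_PSL2Z_eq_iff)
next
  case (Node l r)
  define A where "A n = mat2 0 (-1) 1 (3 - 5 * int n)" for n
  have A: "A n \<in> carrier SL2Z" for n by (simp add: A_def mat2_in)
  have g: "mat2 1 1 0 1 \<in> carrier SL2Z" "mat2 1 0 1 1 \<in> carrier SL2Z"
    by (simp_all add: mat2_in)
  have c: "mat2 1 0 1 1 ** A m ** inv\<^bsub>SL2Z\<^esub> (mat2 1 0 1 1) ** (mat2 1 1 0 1 ** A n ** inv\<^bsub>SL2Z\<^esub> (mat2 1 1 0 1)) =
      A (n + m)" for n m
    by (simp add: A_def inv_SL2Z_mat2 algebra_simps)
  have "monodromy_at_infinity PSL2Z (factor (branch (Node l r))) =
      to_PSL2Z (mat2 1 0 1 1 ** A (leaves r) ** inv\<^bsub>SL2Z\<^esub> (mat2 1 0 1 1)) \<otimes>\<^bsub>PSL2Z\<^esub>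
      to_PSL2Z (mat2 1 1 0 1 ** A (leaves l) ** inv\<^bsub>SL2Z\<^esub> (mat2 1 1 0 1))"
    by (simp only: branch.simps monodromy_append monodromy_conj Node cls_mat2 to_PSL2Z_conj A g
        flip: A_def)
  also have "\<dots> = to_PSL2Z (A (leaves l + leaves r))"
    unfolding c[symmetric] by (rule to_PSL2Z_mult) (simp_all add: A g)
  finally show ?case by (simp add: A_def)
qed

lemma pow_XY: "to_PSL2Z (matX ** matY) [^]\<^bsub>PSL2Z\<^esub> (j :: int) = to_PSL2Z (mat2 1 j 0 1)"
proof -
  have U: "matX ** matY = mat2 1 1 0 1" by (simp add: matX_mat2 matY_mat2)
  have nat: "to_PSL2Z (mat2 1 1 0 1) [^]\<^bsub>PSL2Z\<^esub> (n :: nat) = to_PSL2Z (mat2 1 (int n) 0 1)" for n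
    by (induction n) (simp_all add: to_PSL2Z_one mat_1_mat2 to_PSL2Z_mult mat2_in add.commute)
  show ?thesis
    unfolding U using nat[of "nat j"] nat[of "nat (- j)"]
    by (simp add: int_pow_def2 to_PSL2Z_inv mat2_in inv_SL2Z_mat2)
qed

lemma monodromy_skeleton:
  assumes "t \<noteq> Leaf" "u = [] \<or> u = [GX, GY]"
  shows "monodromy_at_infinity PSL2Z (factor (map ((@) u) (skeleton t))) =
    to_PSL2Z (matX ** matY) [^]\<^bsub>PSL2Z\<^esub> (6 - 5 * int (leaves t))"
proof -
  obtain l r where t: "t = Node l r" using assms(1) by (cases t) auto
  define A where "A n = mat2 0 (-1) 1 (3 - 5 * int n)" for n
  have A: "A n \<in> carrier SL2Z" for n by (simp add: A_def mat2_in)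
  have g: "mat2 0 (-1) 1 0 \<in> carrier SL2Z" "mat2 1 1 0 1 \<in> carrier SL2Z"
    by (simp_all add: mat2_in)
  have c: "mat2 0 (-1) 1 0 ** A m ** inv\<^bsub>SL2Z\<^esub> (mat2 0 (-1) 1 0) ** A n =
      - mat2 1 (6 - 5 * int (n + m)) 0 1" for n m
    by (simp add: A_def inv_SL2Z_mat2 algebra_simps)
  have "monodromy_at_infinity PSL2Z (factor (skeleton t)) =
      to_PSL2Z (mat2 0 (-1) 1 0 ** A (leaves r) ** inv\<^bsub>SL2Z\<^esub> (mat2 0 (-1) 1 0)) \<otimes>\<^bsub>PSL2Z\<^esub>
      to_PSL2Z (A (leaves l))"
    by (simp only: t skeleton.simps monodromy_append monodromy_conj monodromy_branch cls_mat2
        to_PSL2Z_conj A g flip: A_def)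
  also have "\<dots> = to_PSL2Z (mat2 0 (-1) 1 0 ** A (leaves r) ** inv\<^bsub>SL2Z\<^esub> (mat2 0 (-1) 1 0) ** A (leaves l))"
    by (rule to_PSL2Z_mult) (simp_all add: A g)
  also have "\<dots> = to_PSL2Z (mat2 1 (6 - 5 * int (leaves t)) 0 1)"
    unfolding c t by (simp add: to_PSL2Z_eq_iff)
  finally have s: "monodromy_at_infinity PSL2Z (factor (skeleton t)) = to_PSL2Z (mat2 1 (6 - 5 * int (leaves t)) 0 1)" .
  have nil: "map ((@) []) ws = ws" for ws :: "modgen list list"
    by (induction ws) auto
  from assms(2) show ?thesis
  proof
    assume "u = []"
    then show ?thesis by (simp only: nil s pow_XY)
  next
    assume u: "u = [GX, GY]"
    have "monodromy_at_infinity PSL2Z (factor (map ((@) u) (skeleton t))) =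
      to_PSL2Z (mat2 1 1 0 1 ** mat2 1 (6 - 5 * int (leaves t)) 0 1 ** inv\<^bsub>SL2Z\<^esub> (mat2 1 1 0 1))"
      unfolding u monodromy_conj s cls_mat2 by (rule to_PSL2Z_conj) (simp_all add: mat2_in)
    then show ?thesis by (simp add: inv_SL2Z_mat2 pow_XY)
  qed
qed

section \<open>Monodromy groups as stabilizers\<close>

text \<open>A vertex is given by the path to it, where \<open>True\<close> stands for a step to the right.\<close>

fun subtree :: "btree \<Rightarrow> bool list \<Rightarrow> btree option" where
  "subtree t [] = Some t"
| "subtree (Node l r) (b # p) = subtree (if b then r else l) p"
| "subtree Leaf (b # p) = None"

lemma subtree_append:
  "subtree t (p @ q) = (case subtree t p of None \<Rightarrow> None | Some s \<Rightarrow> subtree s q)"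
  by (induction t p rule: subtree.induct) auto

lemma subtree_snoc:
  "subtree t (p @ [b]) \<noteq> None \<longleftrightarrow> subtree t p \<noteq> None \<and> subtree t p \<noteq> Some Leaf"
  unfolding subtree_append by (auto split: option.splits) (metis btree.exhaust option.distinct(1) subtree.simps)+

text \<open>The half-edges of the skeleton: number \<open>0\<close> points to the root, \<open>1\<close> and \<open>2\<close> point to the left and right
  subtree, or form the loop at a leaf.  The empty path is the midpoint of the base edge, not a vertex.\<close>

definition ends :: "btree \<Rightarrow> (bool list \<times> nat) set" where
  "ends t = {p. p \<noteq> [] \<and> subtree t p \<noteq> None} \<times> {..<3}"

text \<open>\<open>X\<close> rotates about the vertex, \<open>Y\<close> passes to the other half of the edge.  The base edge joins the two
  vertices at depth \<open>1\<close>, and \<open>3 - i\<close> exchanges the two halves \<open>1\<close> and \<open>2\<close> of a loop.\<close>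

fun end_act :: "btree \<Rightarrow> modgen \<Rightarrow> bool list \<times> nat \<Rightarrow> bool list \<times> nat" where
  "end_act t GX (p, i) = (p, if i = 2 then 0 else i + 1)"
| "end_act t GY (p, i) =
    (if i = 0 then
       if length p = 1 then ([\<not> hd p], 0) else (butlast p, if last p then 2 else 1)
     else if subtree t p = Some Leaf then (p, 3 - i)
     else (p @ [i = 2], 0))"

definition word_act :: "btree \<Rightarrow> modgen list \<Rightarrow> bool list \<times> nat \<Rightarrow> bool list \<times> nat" where
  "word_act t w e = foldl (\<lambda>e c. end_act t c e) e w"

lemma word_act_simps [simp]:
  "word_act t [] e = e"
  "word_act t (c # w) e = word_act t w (end_act t c e)"
  "word_act t (u @ v) e = word_act t v (word_act t u e)"
  by (simp_all add: word_act_def)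

lemma end_act_ends:
  assumes "t \<noteq> Leaf" "e \<in> ends t"
  shows "end_act t c e \<in> ends t"
proof (cases c)
  case GX
  then show ?thesis using assms by (cases e) (auto simp: ends_def)
next
  case GY
  obtain p i where e: "e = (p, i)" by fastforce
  have p: "p \<noteq> []" "subtree t p \<noteq> None" "i < 3" using assms(2) e by (auto simp: ends_def)
  have bl: "subtree t (butlast p) \<noteq> None"
    using p subtree_snoc[of t "butlast p" "last p"] by simp
  show ?thesis
  proof (cases "i = 0")
    case True
    show ?thesis
    proof (cases "length p = 1")
      case False
      then have "butlast p \<noteq> []" using p(1) by (cases p) auto
      then show ?thesis using True False bl GY e by (auto simp: ends_def)
    qed (use assms(1) True GY e in \<open>cases t; auto simp: ends_def\<close>)
  next
    case False
    then show ?thesis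
      using p GY e subtree_snoc[of t p] by (auto simp: ends_def)
  qed
qed

lemma word_act_ends: "t \<noteq> Leaf \<Longrightarrow> e \<in> ends t \<Longrightarrow> word_act t w e \<in> ends t"
  by (induction w arbitrary: e) (simp_all add: end_act_ends)

lemma word_act_XXX: "e \<in> ends t \<Longrightarrow> word_act t [GX, GX, GX] e = e"
  by (cases e) (auto simp: ends_def)

lemma word_act_YY:
  assumes "t \<noteq> Leaf" "e \<in> ends t"
  shows "word_act t [GY, GY] e = e"
proof -
  obtain p i where e: "e = (p, i)" by fastforce
  have p: "p \<noteq> []" "subtree t p \<noteq> None" "i < 3" using assms(2) e by (auto simp: ends_def)
  show ?thesis
  proof (cases "i = 0")
    case True
    show ?thesis
    proof (cases "length p = 1")
      case False
      have "subtree t (butlast p) \<noteq> Some Leaf"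
        using p subtree_snoc[of t "butlast p" "last p"] by simp
      then show ?thesis using True False p(1) e append_butlast_last_id[OF p(1)]
        by (cases "last p") auto
    qed (use True e in \<open>cases p; auto\<close>)
  next
    case False
    then have "i = 1 \<or> i = 2" using p(3) by auto
    then show ?thesis using e p(1) by auto
  qed
qed

lemma word_act_kernel:
  assumes "modmat w = mat 1 \<or> modmat w = - mat 1" "t \<noteq> Leaf"
  shows "\<forall>e\<in>ends t. word_act t w e = e"
  using assms(1)
proof (induction w rule: modmat_kernel_induct)
  case Nil
  then show ?case by simp
next
  case (XXX u v)
  then show ?case using word_act_XXX word_act_ends[OF assms(2)] by simp
next
  case (YY u v)
  then show ?case using word_act_YY[OF assms(2)] word_act_ends[OF assms(2)] by simp
qed

text \<open>Since \<open>XXX\<close> and \<open>YY\<close> act trivially, the action of words factors through the modular group.\<close>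

lemma word_act_cong:
  assumes "cls u = cls v" "t \<noteq> Leaf" "e \<in> ends t"
  shows "word_act t u e = word_act t v e"
proof -
  have "word_act t (u @ modinv v) e = e"
    using assms cls_eq_iff word_act_kernel by blast
  then have "word_act t v e = word_act t (modinv v @ v) (word_act t u e)" by simp
  also have "cls (modinv v @ v) = cls []"
    by (simp add: cls_append cls_Nil flip: cls_inv)
  then have "word_act t (modinv v @ v) (word_act t u e) = word_act t u e"
    using word_act_kernel[of "modinv v @ v"] cls_eq_iff[of "modinv v @ v" "[]"] assms word_act_ends by simp
  finally show ?thesis by simp
qed

subsection \<open>Paths\<close>

fun path_word :: "bool list \<Rightarrow> modgen list" where
  "path_word p = concat (map (\<lambda>b. if b then [GX, GX, GY] else [GX, GY]) p)"

declare path_word.simps [simp del]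

lemma path_word_simps [simp]:
  "path_word [] = []" "path_word (b # p) = (if b then [GX, GX, GY] else [GX, GY]) @ path_word p"
  "path_word (p @ q) = path_word p @ path_word q"
  by (simp_all add: path_word.simps)

definition end_word :: "bool list \<times> nat \<Rightarrow> modgen list" where
  "end_word e = (if hd (fst e) then [GY] else []) @ path_word (tl (fst e)) @ replicate (snd e) GX"

abbreviation base_end :: "bool list \<times> nat" where "base_end \<equiv> ([False], 0)"

lemma base_end_ends: "t \<noteq> Leaf \<Longrightarrow> base_end \<in> ends t"
  by (cases t) (auto simp: ends_def)

text \<open>The paths in the tree spell a transversal: each half-edge is reached from the base half-edge by its word.\<close>

lemma word_act_path:
  assumes "p \<noteq> []" "subtree t (p @ q) \<noteq> None"
  shows "word_act t (path_word q) (p, 0) = (p @ q, 0)"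
  using assms
proof (induction q arbitrary: p)
  case (Cons b q)
  have "subtree t (p @ [b]) \<noteq> None"
    using Cons.prems(2) subtree_append[of t "p @ [b]" q] by (auto split: option.splits)
  then have "subtree t p \<noteq> Some Leaf" using subtree_snoc by blast
  then have "word_act t (path_word (b # q)) (p, 0) = word_act t (path_word q) (p @ [b], 0)"
    by auto
  then show ?case using Cons.IH[of "p @ [b]"] Cons.prems by simp
qed simp

lemma word_act_end_word:
  assumes "e \<in> ends t" "t \<noteq> Leaf"
  shows "word_act t (end_word e) base_end = e"
proof -
  obtain b p i where e: "e = (b # p, i)"
    using assms(1) by (cases e; cases "fst e") (auto simp: ends_def)
  have *: "subtree t ([b] @ p) \<noteq> None" "i < 3" using assms(1) e by (auto simp: ends_def)
  have "word_act t (if b then [GY] else []) base_end = ([b], 0)" by simp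
  moreover have "word_act t (path_word p) ([b], 0) = (b # p, 0)"
    using word_act_path[OF _ *(1)] by simp
  moreover have "i = 0 \<or> i = 1 \<or> i = 2" using *(2) by auto
  then have "word_act t (replicate i GX) (b # p, 0) = (b # p, i)"
    by (auto simp: numeral_2_eq_2)
  ultimately show ?thesis by (simp add: end_word_def e)
qed

lemma set_branch: "set (branch t) = {path_word p @ [GX] | p. subtree t p = Some Leaf}"
proof (induction t)
  case Leaf
  have "subtree Leaf p = Some Leaf \<longleftrightarrow> p = []" for p by (cases p) auto
  then show ?case by auto
next
  case (Node l r)
  show ?case
  proof (intro equalityI subsetI)
    fix w assume "w \<in> set (branch (Node l r))"
    then consider p where "subtree l p = Some Leaf" "w = path_word (False # p) @ [GX]"
      | p where "subtree r p = Some Leaf" "w = path_word (True # p) @ [GX]"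
      using Node by auto
    then show "w \<in> {path_word p @ [GX] | p. subtree (Node l r) p = Some Leaf}"
    proof cases
      case (1 p)
      then show ?thesis by (intro CollectI exI[of _ "False # p"]) auto
    next
      case (2 p)
      then show ?thesis by (intro CollectI exI[of _ "True # p"]) auto
    qed
  next
    fix w assume "w \<in> {path_word p @ [GX] | p. subtree (Node l r) p = Some Leaf}"
    then obtain p where p: "subtree (Node l r) p = Some Leaf" "w = path_word p @ [GX]" by blast
    then show "w \<in> set (branch (Node l r))"
      using Node by (cases p) (auto split: if_splits)
  qed
qed

lemma set_skeleton:
  assumes "t \<noteq> Leaf"
  shows "set (skeleton t) = {end_word (p, 1) | p. p \<noteq> [] \<and> subtree t p = Some Leaf}"
proof -
  obtain l r where t: "t = Node l r" using assms by (cases t) auto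
  show ?thesis
  proof (intro equalityI subsetI)
    fix w assume "w \<in> set (skeleton t)"
    then consider p where "subtree l p = Some Leaf" "w = end_word (False # p, 1)"
      | p where "subtree r p = Some Leaf" "w = end_word (True # p, 1)"
      by (auto simp: t set_branch end_word_def)
    then show "w \<in> {end_word (p, 1) | p. p \<noteq> [] \<and> subtree t p = Some Leaf}"
    proof cases
      case (1 p)
      then show ?thesis by (intro CollectI exI[of _ "False # p"]) (auto simp: t)
    next
      case (2 p)
      then show ?thesis by (intro CollectI exI[of _ "True # p"]) (auto simp: t)
    qed
  next
    fix w assume "w \<in> {end_word (p, 1) | p. p \<noteq> [] \<and> subtree t p = Some Leaf}"
    then obtain p where p: "p \<noteq> []" "subtree t p = Some Leaf" "w = end_word (p, 1)" by blast
    then show "w \<in> set (skeleton t)"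
      by (cases p) (auto simp: t set_branch end_word_def split: if_splits)
  qed
qed

subsection \<open>The stabilizer is generated by the loops\<close>

definition stab :: "btree \<Rightarrow> bool list \<times> nat \<Rightarrow> (int^2^2) set set" where
  "stab t e = {cls w | w. word_act t w e = e}"

lemma cls_in_stab_iff:
  assumes "t \<noteq> Leaf" "e \<in> ends t"
  shows "cls w \<in> stab t e \<longleftrightarrow> word_act t w e = e"
proof
  assume "cls w \<in> stab t e"
  then obtain v where "cls w = cls v" "word_act t v e = e" unfolding stab_def by blast
  then show "word_act t w e = e" using word_act_cong[OF _ assms] by metis
qed (auto simp: stab_def)

lemma subgroup_stab:
  assumes "t \<noteq> Leaf" "e \<in> ends t"
  shows "subgroup (stab t e) PSL2Z"
proof (rule PSL2Z.subgroupI)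
  show "stab t e \<noteq> {}" using cls_in_stab_iff[OF assms, of "[]"] by auto
  fix a assume a: "a \<in> stab t e"
  then obtain u where u: "a = cls u" "word_act t u e = e" by (auto simp: stab_def)
  have "cls (u @ modinv u) = cls []"
    by (simp add: cls_append cls_Nil flip: cls_inv)
  then have "word_act t (u @ modinv u) e = word_act t [] e"
    using word_act_cong assms by blast
  then show "inv\<^bsub>PSL2Z\<^esub> a \<in> stab t e"
    using u cls_in_stab_iff[OF assms] by (simp add: cls_inv)
  fix b assume "b \<in> stab t e"
  then obtain v where "b = cls v" "word_act t v e = e" by (auto simp: stab_def)
  then show "a \<otimes>\<^bsub>PSL2Z\<^esub> b \<in> stab t e"
    using u cls_in_stab_iff[OF assms, of "u @ v"] by (simp add: cls_append)
qed (auto simp: stab_def)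

lemma cls_cancel: "cls (u @ [GX, GX, GX] @ v) = cls (u @ v)" "cls (u @ [GY, GY] @ v) = cls (u @ v)"
  unfolding cls_append cls_XXX cls_YY by simp_all

lemma cls_modinv_cancel: "cls (u @ w @ modinv w @ v) = cls (u @ v)" "cls (u @ modinv w @ w @ v) = cls (u @ v)"
proof -
  have "cls w \<otimes>\<^bsub>PSL2Z\<^esub> (inv\<^bsub>PSL2Z\<^esub> (cls w) \<otimes>\<^bsub>PSL2Z\<^esub> cls v) = cls v"
    by (simp flip: PSL2Z.m_assoc)
  then show "cls (u @ w @ modinv w @ v) = cls (u @ v)"
    by (simp only: cls_append cls_inv)
  show "cls (u @ modinv w @ w @ v) = cls (u @ v)"
    using PSL2Z_cancel[of "cls w" "cls v"] by (simp only: cls_append cls_inv cls_in)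
qed

text \<open>Schreier generators: with the transversal given by the paths in the tree, only the loops
  at the leaves contribute.\<close>

lemma schreier_step:
  assumes "t \<noteq> Leaf" "e \<in> ends t"
  shows "cls (end_word e @ [c] @ modinv (end_word (end_act t c e))) \<in> generate PSL2Z (set (factor (skeleton t)))"
    (is "_ \<in> ?H")
proof -
  interpret H: subgroup ?H PSL2Z
    by (rule PSL2Z.generate_is_subgroup) (rule factor_carrier)
  have one: "cls [] \<in> ?H" using H.one_closed by (simp add: cls_Nil)
  obtain p i where e: "e = (p, i)" by fastforce
  have p: "p \<noteq> []" "subtree t p \<noteq> None" "i < 3" using assms(2) e by (auto simp: ends_def)
  define g where "g = (if hd p then [GY] else []) @ path_word (tl p)"
  have ew: "end_word (p, j) = g @ replicate j GX" for j
    by (simp add: end_word_def g_def)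
  show ?thesis
  proof (cases c)
    case GX
    show ?thesis
    proof (cases "i = 2")
      case True
      then have "cls (end_word e @ [c] @ modinv (end_word (end_act t c e))) = cls (g @ [GX, GX, GX] @ modinv g)"
        by (simp add: e GX ew numeral_2_eq_2)
      also have "\<dots> = cls []" using cls_cancel(1) cls_modinv_cancel(1)[of "[]" g "[]"] by simp
      finally show ?thesis using one by simp
    next
      case False
      then have "cls (end_word e @ [c] @ modinv (end_word (end_act t c e))) =
          cls ((g @ replicate (i + 1) GX) @ modinv (g @ replicate (i + 1) GX))"
        by (simp add: e GX ew del: modinv_simps flip: replicate_append_same)
      also have "\<dots> = cls []"
        using cls_modinv_cancel(1)[of "[]" "g @ replicate (i + 1) GX" "[]"]
        by (simp only: append_Nil append_Nil2 append_assoc)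
      finally show ?thesis using one by simp
    qed
  next
    case GY
    have i: "i = 0 \<or> i = 1 \<or> i = 2" using p(3) by auto
    consider "i = 0" "length p = 1" | "i = 0" "length p \<noteq> 1"
      | "i \<noteq> 0" "subtree t p = Some Leaf" | "i \<noteq> 0" "subtree t p \<noteq> Some Leaf" by blast
    then show ?thesis
    proof cases
      case 1
      then have "cls (end_word e @ [c] @ modinv (end_word (end_act t c e))) \<in> {cls [], cls ([] @ [GY, GY] @ [])}"
        using p(1) by (cases p) (auto simp: e GY end_word_def)
      then show ?thesis using one unfolding cls_cancel by simp
    next
      case 2
      obtain b q where bq: "p = b # q" using p(1) by (cases p) auto
      then obtain q' d where q: "q = q' @ [d]" using 2 by (cases q rule: rev_cases) auto
      define h where "h = (if b then [GY] else []) @ path_word q' @ (if d then [GX, GX] else [GX])"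
      have "end_word e = h @ [GY]" "end_word (end_act t c e) = h"
        using 2 by (auto simp: e GY end_word_def bq q h_def numeral_2_eq_2)
      then have "cls (end_word e @ [c] @ modinv (end_word (end_act t c e))) = cls (h @ [GY, GY] @ modinv h)"
        by (simp add: GY)
      also have "\<dots> = cls []" using cls_cancel(2) cls_modinv_cancel(1)[of "[]" h "[]"] by simp
      finally show ?thesis using one by simp
    next
      case 3
      have "end_word (p, 1) \<in> set (skeleton t)"
        using set_skeleton[OF assms(1)] 3 p by blast
      then have "to_PSL2Z (twist (g @ [GX])) \<in> set (factor (skeleton t))"
        by (simp add: factor_def ew)
      then have loop: "cls (g @ [GX, GX, GY, GX, GX] @ modinv g) \<in> ?H"
        using generate.incl[of _ "set (factor (skeleton t))" PSL2Z] by (simp add: twist_cls)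
      show ?thesis
      proof (cases "i = 2")
        case True
        then show ?thesis using loop 3 by (simp add: e GY ew numeral_2_eq_2)
      next
        case False
        then have "i = 1" using i 3 by auto
        have "inv\<^bsub>PSL2Z\<^esub> (cls (g @ [GX, GX, GY, GX, GX] @ modinv g)) = cls (modinv (modinv g) @ [GX, GX, GX] @ [GX, GY] @ [GX, GX, GX] @ [GX] @ modinv g)"
          by (simp add: cls_inv)
        also have "\<dots> = cls (modinv (modinv g)) \<otimes>\<^bsub>PSL2Z\<^esub> cls ([GX, GY, GX] @ modinv g)"
          using cls_cancel(1)[of "modinv (modinv g)"] cls_cancel(1)[of "modinv (modinv g) @ [GX, GY]"]
          by (simp flip: cls_append)
        also have "cls (modinv (modinv g)) = cls g"
          by (simp flip: cls_inv)
        also have "cls g \<otimes>\<^bsub>PSL2Z\<^esub> cls ([GX, GY, GX] @ modinv g) = cls (g @ [GX, GY, GX] @ modinv g)"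
          by (simp add: cls_append)
        also have "\<dots> = cls (g @ [GX, GY] @ [GX, GX, GX] @ [GX] @ modinv g)"
          using cls_cancel(1)[of "g @ [GX, GY]"] by simp
        also have "\<dots> = cls (end_word e @ [c] @ modinv (end_word (end_act t c e)))"
          using \<open>i = 1\<close> 3 by (simp add: e GY ew numeral_2_eq_2)
        finally show ?thesis using H.m_inv_closed[OF loop] by simp
      qed
    next
      case 4
      then have "end_word (end_act t c e) = end_word e @ [GY]"
        using i p(1) by (cases p) (auto simp: e GY end_word_def numeral_2_eq_2)
      then have "cls (end_word e @ [c] @ modinv (end_word (end_act t c e))) =
          cls (end_word e @ [GY, GY] @ modinv (end_word e))"
        by (simp add: GY)
      also have "\<dots> = cls []" using cls_cancel(2) cls_modinv_cancel(1)[of "[]" "end_word e" "[]"] by simp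
      finally show ?thesis using one by simp
    qed
  qed
qed

text \<open>By induction on a word \<open>w\<close>, the element \<open>w\<close> followed by the inverse of the transversal element of the
  half-edge that \<open>w\<close> leads to is a product of Schreier generators.\<close>

lemma monodromy_group_skeleton:
  assumes "t \<noteq> Leaf"
  shows "monodromy_group PSL2Z (factor (skeleton t)) = stab t base_end"
proof
  let ?H = "generate PSL2Z (set (factor (skeleton t)))"
  interpret H: subgroup ?H PSL2Z
    by (rule PSL2Z.generate_is_subgroup) (rule factor_carrier)
  note be = base_end_ends[OF assms]
  have transversal: "cls (w @ modinv (end_word (word_act t w base_end))) \<in> ?H" for w
  proof (induction w rule: rev_induct)
    case Nil
    then show ?case using H.one_closed by (simp add: end_word_def cls_Nil)
  next
    case (snoc c w)
    let ?e = "word_act t w base_end"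
    have "cls (w @ modinv (end_word ?e)) \<otimes>\<^bsub>PSL2Z\<^esub>
        cls (end_word ?e @ [c] @ modinv (end_word (end_act t c ?e))) \<in> ?H"
      using snoc schreier_step[OF assms word_act_ends[OF assms be]] by (rule H.m_closed)
    also have "cls (w @ modinv (end_word ?e)) \<otimes>\<^bsub>PSL2Z\<^esub>
        cls (end_word ?e @ [c] @ modinv (end_word (end_act t c ?e))) =
        cls (w @ [c] @ modinv (end_word (end_act t c ?e)))"
      using cls_modinv_cancel(2)[of w "end_word ?e" "[c] @ modinv (end_word (end_act t c ?e))"]
      by (simp only: cls_append[symmetric] append_assoc)
    finally show ?case by simp
  qed
  have "end_word base_end = []" by (simp add: end_word_def)
  then have "cls w \<in> ?H" if "word_act t w base_end = base_end" for w
    using that transversal[of w] by simp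
  then show "stab t base_end \<subseteq> monodromy_group PSL2Z (factor (skeleton t))"
    unfolding stab_def monodromy_group_def by blast
  have "to_PSL2Z (twist w) \<in> stab t base_end" if sk: "w \<in> set (skeleton t)" for w
  proof -
    obtain p where p: "p \<noteq> []" "subtree t p = Some Leaf" "w = end_word (p, 1)"
      using sk set_skeleton[OF assms] by blast
    then have e: "(p, 1) \<in> ends t" by (auto simp: ends_def)
    have "word_act t w base_end = (p, 1)"
      unfolding p(3) by (rule word_act_end_word[OF e assms])
    then have "word_act t (w @ [GX, GY]) base_end = word_act t w base_end"
      using p(2) by simp
    then have "word_act t (w @ [GX, GY] @ modinv w) base_end = word_act t (w @ modinv w) base_end"
      by simp
    also have "\<dots> = word_act t [] base_end"
      using cls_modinv_cancel(1)[of "[]" w "[]"] by (intro word_act_cong[OF _ assms be]) simp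
    finally show ?thesis
      unfolding twist_cls cls_in_stab_iff[OF assms be] by simp
  qed
  then have "set (factor (skeleton t)) \<subseteq> stab t base_end" by (auto simp: factor_def)
  then show "monodromy_group PSL2Z (factor (skeleton t)) \<subseteq> stab t base_end"
    unfolding monodromy_group_def
    by (rule PSL2Z.generate_subgroup_incl[OF _ subgroup_stab[OF assms be]])
qed

lemma generate_conj:
  assumes "S \<subseteq> carrier PSL2Z" "g \<in> carrier PSL2Z"
  shows "generate PSL2Z ((\<lambda>x. g \<otimes>\<^bsub>PSL2Z\<^esub> x \<otimes>\<^bsub>PSL2Z\<^esub> inv\<^bsub>PSL2Z\<^esub> g) ` S) =
    (\<lambda>x. g \<otimes>\<^bsub>PSL2Z\<^esub> x \<otimes>\<^bsub>PSL2Z\<^esub> inv\<^bsub>PSL2Z\<^esub> g) ` generate PSL2Z S"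
proof (rule group_hom.generate_img[OF _ assms(1)])
  have "(\<lambda>x. g \<otimes>\<^bsub>PSL2Z\<^esub> x \<otimes>\<^bsub>PSL2Z\<^esub> inv\<^bsub>PSL2Z\<^esub> g) \<in> hom PSL2Z PSL2Z"
    using assms(2) by (intro homI) (simp_all add: PSL2Z.m_assoc PSL2Z_cancel)
  then show "group_hom PSL2Z PSL2Z (\<lambda>x. g \<otimes>\<^bsub>PSL2Z\<^esub> x \<otimes>\<^bsub>PSL2Z\<^esub> inv\<^bsub>PSL2Z\<^esub> g)"
    by (simp add: group_hom_def group_hom_axioms_def group_PSL2Z)
qed

lemma monodromy_group_conj:
  assumes "t \<noteq> Leaf"
  shows "monodromy_group PSL2Z (factor (map ((@) u) (skeleton t))) =
    stab t (word_act t (modinv u) base_end)"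
proof -
  note be = base_end_ends[OF assms]
  have "set (factor (map ((@) u) (skeleton t))) =
      (\<lambda>x. cls u \<otimes>\<^bsub>PSL2Z\<^esub> x \<otimes>\<^bsub>PSL2Z\<^esub> inv\<^bsub>PSL2Z\<^esub> (cls u)) ` set (factor (skeleton t))"
    by (simp add: factor_def twist_append image_image)
  then have "monodromy_group PSL2Z (factor (map ((@) u) (skeleton t))) =
      (\<lambda>x. cls u \<otimes>\<^bsub>PSL2Z\<^esub> x \<otimes>\<^bsub>PSL2Z\<^esub> inv\<^bsub>PSL2Z\<^esub> (cls u)) ` stab t base_end"
    using generate_conj[OF factor_carrier cls_in]
    unfolding monodromy_group_skeleton[OF assms, symmetric] monodromy_group_def by metis
  also have "\<dots> = stab t (word_act t (modinv u) base_end)"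
  proof (intro equalityI subsetI)
    fix x assume "x \<in> (\<lambda>x. cls u \<otimes>\<^bsub>PSL2Z\<^esub> x \<otimes>\<^bsub>PSL2Z\<^esub> inv\<^bsub>PSL2Z\<^esub> (cls u)) ` stab t base_end"
    then obtain w where w: "word_act t w base_end = base_end"
      and x: "x = cls u \<otimes>\<^bsub>PSL2Z\<^esub> cls w \<otimes>\<^bsub>PSL2Z\<^esub> inv\<^bsub>PSL2Z\<^esub> (cls u)"
      unfolding stab_def by blast
    have x: "x = cls (u @ w @ modinv u)"
      unfolding x cls_inv cls_append by (rule PSL2Z.m_assoc) simp_all
    have "word_act t (modinv u @ u) base_end = word_act t [] base_end"
      using cls_modinv_cancel(2)[of "[]" u "[]"] by (intro word_act_cong[OF _ assms be]) simp
    with w show "x \<in> stab t (word_act t (modinv u) base_end)"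
      unfolding stab_def x by (intro CollectI exI[of _ "u @ w @ modinv u"]) simp
  next
    fix x assume "x \<in> stab t (word_act t (modinv u) base_end)"
    then obtain w where x: "x = cls w" and
      w: "word_act t w (word_act t (modinv u) base_end) = word_act t (modinv u) base_end"
      unfolding stab_def by blast
    have "word_act t (modinv u @ u) base_end = word_act t [] base_end"
      using cls_modinv_cancel(2)[of "[]" u "[]"] by (intro word_act_cong[OF _ assms be]) simp
    then have "cls (modinv u @ w @ u) \<in> stab t base_end"
      using w by (auto simp: stab_def)
    moreover have "x = cls u \<otimes>\<^bsub>PSL2Z\<^esub> cls (modinv u @ w @ u) \<otimes>\<^bsub>PSL2Z\<^esub> inv\<^bsub>PSL2Z\<^esub> (cls u)"
      using cls_modinv_cancel(1)[of "[]" u "w @ u @ modinv u"] cls_modinv_cancel(1)[of w u "[]"]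
      unfolding x cls_inv cls_append[symmetric] by simp
    ultimately show "x \<in> (\<lambda>x. cls u \<otimes>\<^bsub>PSL2Z\<^esub> x \<otimes>\<^bsub>PSL2Z\<^esub> inv\<^bsub>PSL2Z\<^esub> (cls u)) ` stab t base_end"
      by blast
  qed
  finally show ?thesis .
qed

subsection \<open>Index and distinctness\<close>

lemma word_act_modinv:
  assumes "t \<noteq> Leaf" "e \<in> ends t"
  shows "word_act t (modinv w) (word_act t w e) = e" "word_act t w (word_act t (modinv w) e) = e"
proof -
  have "word_act t (w @ modinv w) e = word_act t [] e"
    using cls_modinv_cancel(1)[of "[]" w "[]"] by (intro word_act_cong[OF _ assms]) simp
  then show "word_act t (modinv w) (word_act t w e) = e" by simp
  have "word_act t (modinv w @ w) e = word_act t [] e"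
    using cls_modinv_cancel(2)[of "[]" w "[]"] by (intro word_act_cong[OF _ assms]) simp
  then show "word_act t w (word_act t (modinv w) e) = e" by simp
qed

lemma card_ends:
  assumes "t \<noteq> Leaf"
  shows "finite (ends t)" "card (ends t) = 6 * (leaves t - 1)"
proof -
  have pos: "finite {p. subtree t p \<noteq> None} \<and> card {p. subtree t p \<noteq> None} = 2 * leaves t - 1" for t
  proof (induction t)
    case Leaf
    have "subtree Leaf p \<noteq> None \<longleftrightarrow> p = []" for p by (cases p) auto
    then have "{p. subtree Leaf p \<noteq> None} = {[]}" by auto
    then show ?case by simp
  next
    case (Node l r)
    have mem: "p \<in> {p. subtree (Node l r) p \<noteq> None} \<longleftrightarrow> p \<in> insert [] ((#) False ` {p. subtree l p \<noteq> None} \<union> (#) True ` {p. subtree r p \<noteq> None})" for p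
      by (cases p) (auto simp: image_iff split: if_splits)
    have eq: "{p. subtree (Node l r) p \<noteq> None} =
        insert [] ((#) False ` {p. subtree l p \<noteq> None} \<union> (#) True ` {p. subtree r p \<noteq> None})"
      by (rule Set.set_eqI) (rule mem)
    have inj: "inj_on ((#) b) A" for b :: bool and A by (auto simp: inj_on_def)
    have "card {p. subtree (Node l r) p \<noteq> None} =
        Suc (card ((#) False ` {p. subtree l p \<noteq> None} \<union> (#) True ` {p. subtree r p \<noteq> None}))"
      unfolding eq using Node by (intro card_insert_disjoint) auto
    also have "\<dots> = Suc (card ((#) False ` {p. subtree l p \<noteq> None}) + card ((#) True ` {p. subtree r p \<noteq> None}))"
      using Node by (subst card_Un_disjoint) auto
    also have "\<dots> = Suc ((2 * leaves l - 1) + (2 * leaves r - 1))"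
      using Node by (simp add: card_image[OF inj])
    also have "\<dots> = 2 * leaves (Node l r) - 1"
      using leaves_pos[of l] leaves_pos[of r] by (simp del: leaves_pos)
    finally show ?case unfolding eq using Node by simp
  qed
  have eq: "{p. p \<noteq> [] \<and> subtree t p \<noteq> None} = {p. subtree t p \<noteq> None} - {[]}" by auto
  have c: "card {p. p \<noteq> [] \<and> subtree t p \<noteq> None} = 2 * leaves t - 2"
    unfolding eq using pos[of t] by (subst card_Diff_singleton) auto
  show "finite (ends t)" unfolding ends_def eq using pos[of t] by simp
  show "card (ends t) = 6 * (leaves t - 1)"
    unfolding ends_def card_cartesian_product c by simp
qed

lemma word_act_transitive:
  assumes "t \<noteq> Leaf" "e \<in> ends t" "e' \<in> ends t"
  shows "\<exists>w. word_act t w e = e'"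
proof -
  have "word_act t (modinv (end_word e)) e = base_end"
    using word_act_modinv(1)[OF assms(1) base_end_ends[OF assms(1)], of "end_word e"]
      word_act_end_word[OF assms(2,1)] by simp
  then have "word_act t (modinv (end_word e) @ end_word e') e = e'"
    using word_act_end_word[OF assms(3,1)] by simp
  then show ?thesis by blast
qed

text \<open>The cosets of a stabilizer correspond to the points of the orbit, here all half-edges.\<close>

lemma index_stab:
  assumes "t \<noteq> Leaf" "e \<in> ends t"
  shows "card (rcosets\<^bsub>PSL2Z\<^esub> (stab t e)) = 6 * (leaves t - 1)"
proof -
  define coset where "coset e' = {cls w | w. word_act t w e = e'}" for e'
  have rcos: "stab t e #>\<^bsub>PSL2Z\<^esub> cls v = coset (word_act t v e)" for v
  proof (intro equalityI subsetI)
    fix x assume "x \<in> stab t e #>\<^bsub>PSL2Z\<^esub> cls v"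
    then obtain w where w: "word_act t w e = e" "x = cls w \<otimes>\<^bsub>PSL2Z\<^esub> cls v"
      unfolding r_coset_def stab_def by blast
    then show "x \<in> coset (word_act t v e)"
      unfolding coset_def by (intro CollectI exI[of _ "w @ v"]) (simp add: cls_append)
  next
    fix x assume "x \<in> coset (word_act t v e)"
    then obtain w where w: "word_act t w e = word_act t v e" "x = cls w"
      unfolding coset_def by blast
    have "word_act t (w @ modinv v) e = e"
      using w(1) word_act_modinv(1)[OF assms] by simp
    then have "cls (w @ modinv v) \<in> stab t e" unfolding stab_def by blast
    moreover have "x = cls (w @ modinv v) \<otimes>\<^bsub>PSL2Z\<^esub> cls v"
      using cls_modinv_cancel(2)[of w v "[]"] w(2) by (simp flip: cls_append)
    ultimately show "x \<in> stab t e #>\<^bsub>PSL2Z\<^esub> cls v"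
      unfolding r_coset_def by blast
  qed
  have "rcosets\<^bsub>PSL2Z\<^esub> (stab t e) = coset ` ends t"
  proof (intro equalityI subsetI)
    fix C assume "C \<in> rcosets\<^bsub>PSL2Z\<^esub> (stab t e)"
    then obtain a where "a \<in> carrier PSL2Z" "C = stab t e #>\<^bsub>PSL2Z\<^esub> a"
      unfolding RCOSETS_def by blast
    then obtain v where "C = coset (word_act t v e)"
      using cls_surj rcos by blast
    then show "C \<in> coset ` ends t" using word_act_ends[OF assms] by blast
  next
    fix C assume "C \<in> coset ` ends t"
    then obtain v where "C = stab t e #>\<^bsub>PSL2Z\<^esub> cls v"
      using word_act_transitive[OF assms] rcos by blast
    then show "C \<in> rcosets\<^bsub>PSL2Z\<^esub> (stab t e)"
      unfolding RCOSETS_def using cls_in by blast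
  qed
  moreover have "inj_on coset (ends t)"
  proof (rule inj_onI)
    fix a b assume ab: "a \<in> ends t" "b \<in> ends t" "coset a = coset b"
    obtain w where w: "word_act t w e = a" using word_act_transitive[OF assms ab(1)] by blast
    then have "cls w \<in> coset b" using ab(3) unfolding coset_def by blast
    then obtain v where "cls w = cls v" "word_act t v e = b" unfolding coset_def by blast
    then show "a = b" using word_act_cong[OF _ assms] w by metis
  qed
  ultimately show ?thesis using card_ends(2)[OF assms(1)] by (simp add: card_image)
qed

lemma btree_eq_subtree:
  assumes "\<And>p. subtree t p \<noteq> None \<Longrightarrow> subtree t' p \<noteq> None \<Longrightarrow>
    subtree t p = Some Leaf \<longleftrightarrow> subtree t' p = Some Leaf"
  shows "t = t'"
  using assms
proof (induction t arbitrary: t')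
  case Leaf
  show ?case using Leaf[of "[]"] by simp
next
  case (Node l r)
  obtain l' r' where t': "t' = Node l' r'"
    using Node.prems[of "[]"] by (cases t') auto
  have "l = l'" using Node.prems[of "False # _"] t' by (intro Node.IH(1)) simp
  moreover have "r = r'" using Node.prems[of "True # _"] t' by (intro Node.IH(2)) simp
  ultimately show ?case using t' by simp
qed

text \<open>The tree can be read off from the stabilizer: follow a path, try to run round a loop at its end,
  and return.  This element belongs to the stabilizer iff the path leads to a leaf.\<close>

lemma stab_determines_tree:
  assumes t: "t \<noteq> Leaf" "t' \<noteq> Leaf" and e: "e \<in> ends t" "e \<in> ends t'"
    and u: "word_act t u e = base_end" "word_act t' u e = base_end"
    and eq: "stab t e = stab t' e"
  shows "t = t'"
proof (rule btree_eq_subtree)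
  fix p assume p: "subtree t p \<noteq> None" "subtree t' p \<noteq> None"
  have leaf: "cls ((u @ end_word (p, 0)) @ [GX, GX, GY, GX, GX] @ modinv (u @ end_word (p, 0))) \<in> stab s e \<longleftrightarrow>
      subtree s p = Some Leaf"
    if s: "s \<noteq> Leaf" "e \<in> ends s" "word_act s u e = base_end" "subtree s p \<noteq> None" "p \<noteq> []" for s
  proof -
    let ?g = "u @ end_word (p, 0)"
    have p0: "(p, 0) \<in> ends s" using s by (auto simp: ends_def)
    have g: "word_act s ?g e = (p, 0)"
      using s(3) word_act_end_word[OF p0 s(1)] by simp
    let ?z = "word_act s [GX, GX, GY, GX, GX] (p, 0)"
    have z: "?z \<in> ends s" using word_act_ends[OF s(1) p0] .
    have "word_act s (?g @ [GX, GX, GY, GX, GX] @ modinv ?g) e = word_act s (modinv ?g) ?z"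
      using g by (simp only: word_act_simps)
    moreover have "word_act s (modinv ?g) ?z = e \<longleftrightarrow> ?z = (p, 0)"
      using g word_act_modinv[OF s(1)] s(2) z by metis
    moreover have "?z = (p, 0) \<longleftrightarrow> subtree s p = Some Leaf" by simp
    ultimately show ?thesis unfolding cls_in_stab_iff[OF s(1,2)] by simp
  qed
  show "subtree t p = Some Leaf \<longleftrightarrow> subtree t' p = Some Leaf"
  proof (cases "p = []")
    case True
    then show ?thesis using t by simp
  next
    case False
    show ?thesis
      using leaf[OF t(1) e(1) u(1) p(1) False] leaf[OF t(2) e(2) u(2) p(2) False] eq by simp
  qed
qed

subsection \<open>Strong equivalence preserves the monodromy group\<close>

text \<open>A Hurwitz move read backwards may leave the carrier of the group: the product of the factor group is
  the product of sets, so that \<open>h\<close> in \<open>inv g \<otimes> h \<otimes> g\<close> need only be a nonempty part of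
  a coset.  Such a part still determines its coset, and the subgroup generated by the cosets is
  the invariant.\<close>

definition part_of :: "(int^2^2) set \<Rightarrow> int^2^2 \<Rightarrow> bool" where
  "part_of h B \<longleftrightarrow> B \<in> carrier SL2Z \<and> h \<noteq> {} \<and> h \<subseteq> {B, - B}"

definition saturate :: "(int^2^2) set \<Rightarrow> (int^2^2) set" where
  "saturate h = h \<union> uminus ` h"

lemma saturate_part:
  assumes "part_of h B"
  shows "saturate h = to_PSL2Z B"
proof -
  have h: "h \<subseteq> {B, - B}" and "h \<noteq> {}" using assms by (simp_all add: part_of_def)
  then obtain X where X: "X \<in> h" "X = B \<or> X = - B" by blast
  then have "- X \<in> saturate h" "X \<in> saturate h" by (auto simp: saturate_def)
  then have "B \<in> saturate h" "- B \<in> saturate h" using X(2) by auto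
  moreover have "saturate h \<subseteq> {B, - B}" using h by (auto simp: saturate_def)
  ultimately show ?thesis unfolding to_PSL2Z_eq by blast
qed

lemma PSL2Z_mult_set: "g \<otimes>\<^bsub>PSL2Z\<^esub> h = {A ** B | A B. A \<in> g \<and> B \<in> h}"
  by (auto simp: PSL2Z_def FactGroup_def set_mult_def)

lemma part_mult:
  assumes "part_of g A" "part_of h B"
  shows "part_of (g \<otimes>\<^bsub>PSL2Z\<^esub> h) (A ** B)"
proof -
  have "X ** Y \<in> {A ** B, - (A ** B)}" if "X \<in> g" "Y \<in> h" for X Y
  proof -
    have "X = A \<or> X = - A" "Y = B \<or> Y = - B" using assms that by (auto simp: part_of_def)
    then show ?thesis by auto
  qed
  then show ?thesis using assms unfolding part_of_def PSL2Z_mult_set by auto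
qed

lemma part_inv:
  assumes "part_of g A"
  shows "inv\<^bsub>PSL2Z\<^esub> g = to_PSL2Z (inv\<^bsub>SL2Z\<^esub> A)"
proof -
  have A: "A \<in> carrier SL2Z" using assms by (simp add: part_of_def)
  have gA: "g \<otimes>\<^bsub>PSL2Z\<^esub> to_PSL2Z C = to_PSL2Z (A ** C)" "to_PSL2Z C \<otimes>\<^bsub>PSL2Z\<^esub> g = to_PSL2Z (C ** A)"
    if C: "C \<in> carrier SL2Z" for C
  proof -
    obtain X where X: "X \<in> g" "X = A \<or> X = - A" using assms by (auto simp: part_of_def)
    have pC: "part_of (to_PSL2Z C) C" using C by (simp add: part_of_def to_PSL2Z_eq)
    have "C \<in> to_PSL2Z C" "- C \<in> to_PSL2Z C" by (simp_all add: to_PSL2Z_eq)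
    then have "X ** C \<in> g \<otimes>\<^bsub>PSL2Z\<^esub> to_PSL2Z C" "X ** (- C) \<in> g \<otimes>\<^bsub>PSL2Z\<^esub> to_PSL2Z C"
      "C ** X \<in> to_PSL2Z C \<otimes>\<^bsub>PSL2Z\<^esub> g" "(- C) ** X \<in> to_PSL2Z C \<otimes>\<^bsub>PSL2Z\<^esub> g"
      using X(1) unfolding PSL2Z_mult_set by blast+
    then have "{A ** C, - (A ** C)} \<subseteq> g \<otimes>\<^bsub>PSL2Z\<^esub> to_PSL2Z C"
      "{C ** A, - (C ** A)} \<subseteq> to_PSL2Z C \<otimes>\<^bsub>PSL2Z\<^esub> g"
      using X(2) by auto
    moreover have "g \<otimes>\<^bsub>PSL2Z\<^esub> to_PSL2Z C \<subseteq> {A ** C, - (A ** C)}"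
      "to_PSL2Z C \<otimes>\<^bsub>PSL2Z\<^esub> g \<subseteq> {C ** A, - (C ** A)}"
      using part_mult[OF assms pC] part_mult[OF pC assms] unfolding part_of_def by blast+
    ultimately show "g \<otimes>\<^bsub>PSL2Z\<^esub> to_PSL2Z C = to_PSL2Z (A ** C)" "to_PSL2Z C \<otimes>\<^bsub>PSL2Z\<^esub> g = to_PSL2Z (C ** A)"
      unfolding to_PSL2Z_eq by blast+
  qed
  show ?thesis
    unfolding m_inv_def[of PSL2Z]
  proof (rule the_equality)
    show "to_PSL2Z (inv\<^bsub>SL2Z\<^esub> A) \<in> carrier PSL2Z \<and>
        g \<otimes>\<^bsub>PSL2Z\<^esub> to_PSL2Z (inv\<^bsub>SL2Z\<^esub> A) = \<one>\<^bsub>PSL2Z\<^esub> \<and> to_PSL2Z (inv\<^bsub>SL2Z\<^esub> A) \<otimes>\<^bsub>PSL2Z\<^esub> g = \<one>\<^bsub>PSL2Z\<^esub>"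
      using A SL2Z.r_inv[OF A] SL2Z.l_inv[OF A] by (simp add: gA to_PSL2Z_one)
  next
    fix y assume y: "y \<in> carrier PSL2Z \<and> g \<otimes>\<^bsub>PSL2Z\<^esub> y = \<one>\<^bsub>PSL2Z\<^esub> \<and> y \<otimes>\<^bsub>PSL2Z\<^esub> g = \<one>\<^bsub>PSL2Z\<^esub>"
    then obtain C where C: "C \<in> carrier SL2Z" "y = to_PSL2Z C" by (auto simp: carrier_PSL2Z)
    then have "to_PSL2Z (C ** A) = \<one>\<^bsub>PSL2Z\<^esub>" using y gA by simp
    then have "to_PSL2Z C \<otimes>\<^bsub>PSL2Z\<^esub> to_PSL2Z A = \<one>\<^bsub>PSL2Z\<^esub>" using C A by (simp add: to_PSL2Z_mult)
    then show "y = to_PSL2Z (inv\<^bsub>SL2Z\<^esub> A)"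
      using PSL2Z.inv_equality[of "to_PSL2Z C" "to_PSL2Z A"] C A by (simp add: to_PSL2Z_inv)
  qed
qed

lemma part_of_conj_iff:
  assumes "part_of g A"
  shows "part_of h B \<longleftrightarrow> part_of (inv\<^bsub>PSL2Z\<^esub> g \<otimes>\<^bsub>PSL2Z\<^esub> h \<otimes>\<^bsub>PSL2Z\<^esub> g) (inv\<^bsub>SL2Z\<^esub> A ** B ** A)"
proof -
  have A: "A \<in> carrier SL2Z" using assms by (simp add: part_of_def)
  let ?A' = "inv\<^bsub>SL2Z\<^esub> A"
  have AA: "A ** ?A' = mat 1" "?A' ** A = mat 1" using SL2Z.r_inv[OF A] SL2Z.l_inv[OF A] by simp_all
  have inv: "inv\<^bsub>PSL2Z\<^esub> g = {?A', - ?A'}" using part_inv[OF assms] by (simp add: to_PSL2Z_eq)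
  show ?thesis
  proof
    assume "part_of h B"
    moreover have "part_of (inv\<^bsub>PSL2Z\<^esub> g) ?A'" using A by (simp add: inv part_of_def)
    ultimately show "part_of (inv\<^bsub>PSL2Z\<^esub> g \<otimes>\<^bsub>PSL2Z\<^esub> h \<otimes>\<^bsub>PSL2Z\<^esub> g) (?A' ** B ** A)"
      using part_mult assms by blast
  next
    assume r: "part_of (inv\<^bsub>PSL2Z\<^esub> g \<otimes>\<^bsub>PSL2Z\<^esub> h \<otimes>\<^bsub>PSL2Z\<^esub> g) (?A' ** B ** A)"
    then have "det (?A' ** B ** A) = 1" by (simp add: part_of_def SL2Z_carrier)
    moreover have "det ?A' = 1" "det A = 1" using A SL2Z.inv_closed[OF A] by (simp_all add: SL2Z_carrier)
    ultimately have B: "B \<in> carrier SL2Z" by (simp add: SL2Z_carrier det_mul)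
    have ne: "h \<noteq> {}" using r by (auto simp: part_of_def PSL2Z_mult_set)
    have "Y = B \<or> Y = - B" if Y: "Y \<in> h" for Y
    proof -
      obtain X where X: "X \<in> g" "X = A \<or> X = - A" using assms by (auto simp: part_of_def)
      have "?A' ** Y ** X \<in> inv\<^bsub>PSL2Z\<^esub> g \<otimes>\<^bsub>PSL2Z\<^esub> h \<otimes>\<^bsub>PSL2Z\<^esub> g"
        using X(1) Y unfolding PSL2Z_mult_set inv by blast
      then have "?A' ** Y ** X \<in> {?A' ** B ** A, - (?A' ** B ** A)}"
        using r unfolding part_of_def by blast
      then have "?A' ** Y ** A = ?A' ** B ** A \<or> ?A' ** Y ** A = - (?A' ** B ** A)"
        using X(2) by (auto simp: minus_equation_iff equation_minus_iff)
      then have "A ** (?A' ** Y ** A) ** ?A' = A ** (?A' ** B ** A) ** ?A' \<or>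
          A ** (?A' ** Y ** A) ** ?A' = - (A ** (?A' ** B ** A) ** ?A')"
        by (metis minus_mult_mat)
      moreover have "A ** (?A' ** C ** A) ** ?A' = C" for C
        by (metis AA(1) matrix_mul_assoc matrix_mul_lid matrix_mul_rid)
      ultimately show ?thesis by simp
    qed
    then show "part_of h B" using B ne by (auto simp: part_of_def)
  qed
qed

definition coset_parts :: "(int^2^2) set list \<Rightarrow> bool" where
  "coset_parts ms \<longleftrightarrow> (\<forall>h\<in>set ms. \<exists>B. part_of h B)"

definition generated_cosets :: "(int^2^2) set list \<Rightarrow> (int^2^2) set set" where
  "generated_cosets ms = generate PSL2Z (saturate ` set ms)"

lemma generate_eqI:
  assumes "S \<subseteq> carrier PSL2Z" "T \<subseteq> carrier PSL2Z"
    and "S \<subseteq> generate PSL2Z T" "T \<subseteq> generate PSL2Z S"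
  shows "generate PSL2Z S = generate PSL2Z T"
  using assms PSL2Z.generate_subgroup_incl PSL2Z.generate_is_subgroup by (intro equalityI) auto

lemma hurwitz_move_invariant:
  assumes "hurwitz_move PSL2Z ms ms'"
  shows "coset_parts ms \<longleftrightarrow> coset_parts ms'"
    and "coset_parts ms \<Longrightarrow> generated_cosets ms = generated_cosets ms'"
proof -
  obtain xs g h ys where ms: "ms = xs @ [g, h] @ ys"
    and ms': "ms' = xs @ [inv\<^bsub>PSL2Z\<^esub> g \<otimes>\<^bsub>PSL2Z\<^esub> h \<otimes>\<^bsub>PSL2Z\<^esub> g, g] @ ys"
    using assms unfolding hurwitz_move_def by blast
  let ?c = "inv\<^bsub>PSL2Z\<^esub> g \<otimes>\<^bsub>PSL2Z\<^esub> h \<otimes>\<^bsub>PSL2Z\<^esub> g"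
  have iff: "(\<exists>B. part_of h B) \<longleftrightarrow> (\<exists>B. part_of ?c B)" if g: "part_of g A" for A
  proof
    assume "\<exists>B. part_of ?c B"
    then obtain C where C: "part_of ?c C" by blast
    have A: "A \<in> carrier SL2Z" using g by (simp add: part_of_def)
    have "inv\<^bsub>SL2Z\<^esub> A ** (A ** C ** inv\<^bsub>SL2Z\<^esub> A) ** A = C"
      using SL2Z.l_inv[OF A] by (metis SL2Z_mult SL2Z_one matrix_mul_assoc matrix_mul_lid matrix_mul_rid)
    then have "part_of h (A ** C ** inv\<^bsub>SL2Z\<^esub> A)"
      using part_of_conj_iff[OF g, of h "A ** C ** inv\<^bsub>SL2Z\<^esub> A"] C by simp
    then show "\<exists>B. part_of h B" by blast
  qed (use part_of_conj_iff[OF g] in blast)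
  then show "coset_parts ms \<longleftrightarrow> coset_parts ms'"
    by (auto simp: coset_parts_def ms ms')
  assume cp: "coset_parts ms"
  then obtain A B where g: "part_of g A" and h: "part_of h B"
    by (auto simp: coset_parts_def ms)
  have A: "A \<in> carrier SL2Z" and B: "B \<in> carrier SL2Z" using g h by (simp_all add: part_of_def)
  let ?S = "saturate ` set xs \<union> saturate ` set ys"
  let ?a = "to_PSL2Z A" and ?b = "to_PSL2Z B"
  let ?b' = "inv\<^bsub>PSL2Z\<^esub> ?a \<otimes>\<^bsub>PSL2Z\<^esub> ?b \<otimes>\<^bsub>PSL2Z\<^esub> ?a"
  have S: "?S \<subseteq> carrier PSL2Z"
  proof -
    have "saturate x \<in> carrier PSL2Z" if x: "x \<in> set ms" for x
    proof -
      obtain B where "part_of x B" using cp x unfolding coset_parts_def by blast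
      then show ?thesis by (simp add: saturate_part) (simp add: part_of_def)
    qed
    then show ?thesis by (auto simp: ms)
  qed
  have sc: "saturate ?c = ?b'"
    using saturate_part[OF part_of_conj_iff[OF g, THEN iffD1, OF h]] A B
    by (simp add: to_PSL2Z_inv to_PSL2Z_mult)
  have "generated_cosets ms = generate PSL2Z (insert ?a (insert ?b ?S))"
    unfolding generated_cosets_def ms using saturate_part[OF g] saturate_part[OF h]
    by (simp add: image_Un Un_ac insert_commute)
  also have "\<dots> = generate PSL2Z (insert ?a (insert ?b' ?S))"
  proof (rule generate_eqI)
    let ?T = "insert ?a (insert ?b ?S)" and ?T' = "insert ?a (insert ?b' ?S)"
    show T: "?T \<subseteq> carrier PSL2Z" and T': "?T' \<subseteq> carrier PSL2Z" using S A B by auto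
    interpret G: subgroup "generate PSL2Z ?T" PSL2Z by (rule PSL2Z.generate_is_subgroup[OF T])
    interpret G': subgroup "generate PSL2Z ?T'" PSL2Z by (rule PSL2Z.generate_is_subgroup[OF T'])
    have i: "x \<in> generate PSL2Z ?T" if "x \<in> ?T" for x using that by (rule generate.incl)
    have i': "x \<in> generate PSL2Z ?T'" if "x \<in> ?T'" for x using that by (rule generate.incl)
    have "?b = ?a \<otimes>\<^bsub>PSL2Z\<^esub> ?b' \<otimes>\<^bsub>PSL2Z\<^esub> inv\<^bsub>PSL2Z\<^esub> ?a"
    proof -
      have "?a \<otimes>\<^bsub>PSL2Z\<^esub> ?b' \<otimes>\<^bsub>PSL2Z\<^esub> inv\<^bsub>PSL2Z\<^esub> ?a =
          (?a \<otimes>\<^bsub>PSL2Z\<^esub> inv\<^bsub>PSL2Z\<^esub> ?a) \<otimes>\<^bsub>PSL2Z\<^esub> ?b \<otimes>\<^bsub>PSL2Z\<^esub> (?a \<otimes>\<^bsub>PSL2Z\<^esub> inv\<^bsub>PSL2Z\<^esub> ?a)"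
        using A B by (simp only: PSL2Z.m_assoc to_PSL2Z_in PSL2Z.inv_closed PSL2Z.m_closed)
      then show ?thesis using A B by simp
    qed
    moreover have "?a \<otimes>\<^bsub>PSL2Z\<^esub> ?b' \<otimes>\<^bsub>PSL2Z\<^esub> inv\<^bsub>PSL2Z\<^esub> ?a \<in> generate PSL2Z ?T'"
      by (intro G'.m_closed G'.m_inv_closed i') simp_all
    ultimately have "?b \<in> generate PSL2Z ?T'" by simp
    moreover have "?a \<in> generate PSL2Z ?T'" "?S \<subseteq> generate PSL2Z ?T'"
      by (rule i', simp) (rule subsetI, rule i', simp)
    ultimately show "?T \<subseteq> generate PSL2Z ?T'" by (simp only: insert_subset)
    have "?b' \<in> generate PSL2Z ?T"
      by (intro G.m_closed G.m_inv_closed i) simp_all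
    moreover have "?a \<in> generate PSL2Z ?T" "?S \<subseteq> generate PSL2Z ?T"
      by (rule i, simp) (rule subsetI, rule i, simp)
    ultimately show "?T' \<subseteq> generate PSL2Z ?T" by (simp only: insert_subset)
  qed
  also have "\<dots> = generated_cosets ms'"
    unfolding generated_cosets_def ms' using saturate_part[OF g] sc
    by (simp add: image_Un Un_ac insert_commute)
  finally show "generated_cosets ms = generated_cosets ms'" .
qed

lemma strongly_equivalent_monodromy_group:
  assumes "strongly_equivalent PSL2Z ms ms'" "set ms \<subseteq> carrier PSL2Z" "set ms' \<subseteq> carrier PSL2Z"
  shows "monodromy_group PSL2Z ms = monodromy_group PSL2Z ms'"
proof -
  have carrier: "coset_parts ns" "generated_cosets ns = monodromy_group PSL2Z ns"
    if "set ns \<subseteq> carrier PSL2Z" for ns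
  proof -
    have p: "\<exists>B. part_of x B \<and> x = to_PSL2Z B" if x: "x \<in> set ns" for x
    proof -
      obtain B where "B \<in> carrier SL2Z" "x = to_PSL2Z B"
        using x \<open>set ns \<subseteq> _\<close> by (auto simp: carrier_PSL2Z)
      then show ?thesis by (intro exI[of _ B]) (simp add: part_of_def to_PSL2Z_eq)
    qed
    then show "coset_parts ns" unfolding coset_parts_def by blast
    have "saturate x = x" if "x \<in> set ns" for x
      using p[OF that] saturate_part by metis
    then show "generated_cosets ns = monodromy_group PSL2Z ns"
      by (simp add: generated_cosets_def monodromy_group_def)
  qed
  have "coset_parts ms \<longrightarrow> coset_parts ms' \<and> generated_cosets ms = generated_cosets ms'"
    using assms(1) unfolding strongly_equivalent_def
  proof (induction rule: equivclp_induct)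
    case (step y z)
    then show ?case using hurwitz_move_invariant by metis
  qed simp
  then show ?thesis using carrier assms(2,3) by metis
qed

section \<open>Signed sequences of vectors\<close>

lemma skew_vec2 [simp]: "skew (vec2 a b) (vec2 c d) = a * d - b * c"
  by (simp add: skew_def)

lemma skew_simps [simp]:
  "skew (x + y) z = skew x z + skew y z" "skew z (x + y) = skew z x + skew z y"
  "skew (- x) z = - skew x z" "skew z (- x) = - skew z x"
  "skew (k *s x) z = k * skew x z" "skew z (k *s x) = k * skew z x"
  "skew 0 z = 0" "skew z 0 = 0" "skew x x = 0"
  by (simp_all add: skew_def algebra_simps)

lemma skew_SL2Z:
  assumes "A \<in> carrier SL2Z"
  shows "skew (A *v x) (A *v y) = skew x y"
proof -
  obtain a b c d where A: "A = mat2 a b c d" by (rule mat2_cases)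
  obtain x1 x2 where x: "x = vec2 x1 x2" by (rule vec2_cases)
  obtain y1 y2 where y: "y = vec2 y1 y2" by (rule vec2_cases)
  have det: "a * d - b * c = 1" using assms A by (simp add: SL2Z_carrier)
  have "skew (A *v x) (A *v y) = (a * d - b * c) * skew x y"
    by (simp add: A x y algebra_simps)
  then show ?thesis using det by simp
qed

text \<open>A pair \<open>(\<epsilon>, v)\<close> stands for a basis element of square \<open>\<epsilon>\<close> with boundary \<open>v\<close>.  The factorizations have
  \<open>\<epsilon> = 1\<close> throughout; terms with \<open>\<epsilon> = - 1\<close> arise in the normal forms.\<close>

type_synonym signed_seq = "(int \<times> (int^2)) list"

fun chi_seq :: "signed_seq \<Rightarrow> int list \<Rightarrow> int^2" where
  "chi_seq (x # s) (c # cs) = c *s snd x + chi_seq s cs"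
| "chi_seq _ _ = 0"

text \<open>The quadratic form \<open>\<Sum> \<epsilon>\<^sub>i c\<^sub>i\<^sup>2 + \<Sum>\<^sub>i\<^sub><\<^sub>j c\<^sub>i c\<^sub>j v\<^sub>i \<cdot> v\<^sub>j\<close>.  For lists of different lengths the value is a dummy.\<close>

fun q_seq :: "signed_seq \<Rightarrow> int list \<Rightarrow> int" where
  "q_seq (x # s) (c # cs) = fst x * c * c + c * skew (snd x) (chi_seq s cs) + q_seq s cs"
| "q_seq _ _ = 0"

abbreviation add_list :: "int list \<Rightarrow> int list \<Rightarrow> int list" where
  "add_list \<equiv> map2 (+)"

lemma chi_seq_append:
  "length cs = length s \<Longrightarrow> chi_seq (s @ t) (cs @ ds) = chi_seq s cs + chi_seq t ds"
  by (induction cs s rule: list_induct2) (simp_all add: add.assoc)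

lemma q_seq_append:
  "length cs = length s \<Longrightarrow>
   q_seq (s @ t) (cs @ ds) = q_seq s cs + q_seq t ds + skew (chi_seq s cs) (chi_seq t ds)"
  by (induction cs s rule: list_induct2) (simp_all add: chi_seq_append algebra_simps)

lemma chi_seq_add:
  "length cs = length s \<Longrightarrow> length ds = length s \<Longrightarrow>
   chi_seq s (add_list cs ds) = chi_seq s cs + chi_seq s ds"
proof (induction cs s arbitrary: ds rule: list_induct2)
  case (Cons c cs x s)
  then show ?case by (cases ds) (simp_all add: vector_sadd_rdistrib algebra_simps)
qed simp

text \<open>Isometries that respect the boundary, not only on its kernel: this makes the relation compatible with
  concatenation, because the form of a concatenation couples the two parts through their boundaries only.\<close>

definition seq_iso :: "(int list \<Rightarrow> int list) \<Rightarrow> signed_seq \<Rightarrow> signed_seq \<Rightarrow> bool" where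
  "seq_iso \<theta> s t \<longleftrightarrow> bij_betw \<theta> {cs. length cs = length s} {cs. length cs = length t} \<and>
     (\<forall>cs ds. length cs = length s \<longrightarrow> length ds = length s \<longrightarrow>
        \<theta> (add_list cs ds) = add_list (\<theta> cs) (\<theta> ds)) \<and>
     (\<forall>cs. length cs = length s \<longrightarrow> chi_seq t (\<theta> cs) = chi_seq s cs \<and> q_seq t (\<theta> cs) = q_seq s cs)"

definition seq_equiv :: "signed_seq \<Rightarrow> signed_seq \<Rightarrow> bool" where
  "seq_equiv s t \<longleftrightarrow> (\<exists>\<theta>. seq_iso \<theta> s t)"

lemma seq_isoD:
  assumes "seq_iso \<theta> s t"
  shows "bij_betw \<theta> {cs. length cs = length s} {cs. length cs = length t}"
    and "\<And>cs ds. length cs = length s \<Longrightarrow> length ds = length s \<Longrightarrow> \<theta> (add_list cs ds) = add_list (\<theta> cs) (\<theta> ds)"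
    and "\<And>cs. length cs = length s \<Longrightarrow> chi_seq t (\<theta> cs) = chi_seq s cs \<and> q_seq t (\<theta> cs) = q_seq s cs"
  using assms by (simp_all add: seq_iso_def)

lemma seq_equiv_refl: "seq_equiv s s"
  unfolding seq_equiv_def seq_iso_def by (intro exI[of _ id]) simp

lemma seq_equiv_trans:
  assumes "seq_equiv s t" "seq_equiv t u"
  shows "seq_equiv s u"
proof -
  obtain f where "seq_iso f s t" using assms(1) unfolding seq_equiv_def by blast
  note f = seq_isoD[OF this]
  obtain g where "seq_iso g t u" using assms(2) unfolding seq_equiv_def by blast
  note g = seq_isoD[OF this]
  have len: "length (f cs) = length t" if "length cs = length s" for cs
    using bij_betwE[OF f(1)] that by simp
  show ?thesis
    unfolding seq_equiv_def seq_iso_def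
  proof (intro exI[of _ "g \<circ> f"] conjI allI impI)
    show "bij_betw (g \<circ> f) {cs. length cs = length s} {cs. length cs = length u}"
      using f(1) g(1) by (rule bij_betw_trans)
  qed (simp_all add: f(2,3) g(2,3) len)
qed

lemma seq_equiv_append:
  assumes "seq_equiv s s'" "seq_equiv t t'"
  shows "seq_equiv (s @ t) (s' @ t')"
proof -
  obtain f where "seq_iso f s s'" using assms(1) unfolding seq_equiv_def by blast
  note f = seq_isoD[OF this]
  obtain g where "seq_iso g t t'" using assms(2) unfolding seq_equiv_def by blast
  note g = seq_isoD[OF this]
  have flen: "length (f cs) = length s'" if "length cs = length s" for cs
    using bij_betwE[OF f(1)] that by simp
  have glen: "length (g cs) = length t'" if "length cs = length t" for cs
    using bij_betwE[OF g(1)] that by simp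
  define h where "h cs = f (take (length s) cs) @ g (drop (length s) cs)" for cs
  define f' where "f' = inv_into {cs. length cs = length s} f"
  define g' where "g' = inv_into {cs. length cs = length t} g"
  define h' where "h' cs = f' (take (length s') cs) @ g' (drop (length s') cs)" for cs
  have f': "length (f' cs) = length s" "f (f' cs) = cs" if "length cs = length s'" for cs
    using that bij_betw_inv_into_right[OF f(1)] bij_betwE[OF bij_betw_inv_into[OF f(1)]]
    by (auto simp: f'_def)
  have g': "length (g' cs) = length t" "g (g' cs) = cs" if "length cs = length t'" for cs
    using that bij_betw_inv_into_right[OF g(1)] bij_betwE[OF bij_betw_inv_into[OF g(1)]]
    by (auto simp: g'_def)
  have f'f: "f' (f cs) = cs" if "length cs = length s" for cs
    using that bij_betw_inv_into_left[OF f(1)] by (simp add: f'_def)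
  have g'g: "g' (g cs) = cs" if "length cs = length t" for cs
    using that bij_betw_inv_into_left[OF g(1)] by (simp add: g'_def)
  show ?thesis
    unfolding seq_equiv_def seq_iso_def
  proof (intro exI[of _ h] conjI allI impI)
    show "bij_betw h {cs. length cs = length (s @ t)} {cs. length cs = length (s' @ t')}"
      by (rule bij_betw_byWitness[where f' = h'])
         (auto simp: h_def h'_def f' g' f'f g'g flen glen)
  next
    fix cs ds :: "int list" assume l: "length cs = length (s @ t)" "length ds = length (s @ t)"
    then show "h (add_list cs ds) = add_list (h cs) (h ds)"
      by (simp add: h_def take_map drop_map take_zip drop_zip f(2) g(2) flen zip_append)
  next
    fix cs :: "int list" assume l: "length cs = length (s @ t)"
    then have "cs = take (length s) cs @ drop (length s) cs" "length (take (length s) cs) = length s"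
      "length (drop (length s) cs) = length t" by simp_all
    then obtain as bs where cs: "cs = as @ bs" "length as = length s" "length bs = length t" by metis
    show "chi_seq (s' @ t') (h cs) = chi_seq (s @ t) cs"
      using cs by (simp add: h_def chi_seq_append flen f(3) g(3))
    show "q_seq (s' @ t') (h cs) = q_seq (s @ t) cs"
      using cs by (simp add: h_def q_seq_append flen f(3) g(3))
  qed
qed

lemma seq_equiv_Cons: "seq_equiv s t \<Longrightarrow> seq_equiv (x # s) (x # t)"
  using seq_equiv_append[OF seq_equiv_refl[of "[x]"]] by simp

abbreviation act_seq :: "int^2^2 \<Rightarrow> signed_seq \<Rightarrow> signed_seq" where
  "act_seq A \<equiv> map (apsnd ((*v) A))"

lemma mat_scale: "(A :: int^2^2) *v (c *s x) = c *s (A *v x)"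
  by (cases A rule: mat2_cases; cases x rule: vec2_cases; simp add: algebra_simps)

lemma chi_seq_act: "chi_seq (act_seq A s) cs = A *v chi_seq s cs"
  by (induction s cs rule: chi_seq.induct)
     (simp_all add: matrix_vector_right_distrib mat_scale)

lemma q_seq_act:
  assumes "A \<in> carrier SL2Z"
  shows "q_seq (act_seq A s) cs = q_seq s cs"
  by (induction s cs rule: q_seq.induct) (simp_all add: chi_seq_act skew_SL2Z[OF assms])

lemma seq_equiv_act:
  assumes "A \<in> carrier SL2Z" "seq_equiv s t"
  shows "seq_equiv (act_seq A s) (act_seq A t)"
proof -
  obtain f where "seq_iso f s t" using assms(2) unfolding seq_equiv_def by blast
  note f = seq_isoD[OF this]
  show ?thesis
    unfolding seq_equiv_def seq_iso_def
    by (intro exI[of _ f]) (simp add: f chi_seq_act q_seq_act[OF assms(1)])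
qed

lemma chi_seq_neg: "chi_seq (map (apsnd uminus) s) (map uminus cs) = chi_seq s cs"
  by (induction s cs rule: chi_seq.induct) (simp_all add: vec_eq_iff)

lemma q_seq_neg: "q_seq (map (apsnd uminus) s) (map uminus cs) = q_seq s cs"
  by (induction s cs rule: q_seq.induct) (simp_all add: chi_seq_neg)

lemma seq_equiv_neg: "seq_equiv s (map (apsnd uminus) s)"
  unfolding seq_equiv_def seq_iso_def
proof (intro exI[of _ "map uminus"] conjI allI impI)
  show "bij_betw (map uminus) {cs :: int list. length cs = length s}
      {cs. length cs = length (map (apsnd uminus) s)}"
    by (rule bij_betw_byWitness[where f' = "map uminus"]) (auto simp: comp_def)
next
  fix cs ds :: "int list" assume "length cs = length s" "length ds = length s"
  then show "map uminus (add_list cs ds) = add_list (map uminus cs) (map uminus ds)"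
    by (intro nth_equalityI) simp_all
qed (simp_all add: chi_seq_neg q_seq_neg)

lemma act_seq_minus: "act_seq (- A) s = map (apsnd uminus) (act_seq A s)"
  by (simp add: comp_def prod_eq_iff)

lemma seq_equiv_minus: "seq_equiv (act_seq (- A) s) (act_seq A s)"
  using seq_equiv_neg[of "act_seq (- A) s"] unfolding act_seq_minus[of "- A", symmetric] by simp

text \<open>All elementary moves are changes of basis of a two-term sequence; the last three hypotheses say that
  the old form agrees with the new one.\<close>

lemma seq_equiv_pair:
  fixes a b c d :: int
  assumes det: "\<bar>a * d - b * c\<bar> = 1"
    and v: "v1 = a *s w1 + c *s w2" "v2 = b *s w1 + d *s w2"
    and e: "e1 = f1 * a * a + f2 * c * c + a * c * skew w1 w2"
      "e2 = f1 * b * b + f2 * d * d + b * d * skew w1 w2"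
      "skew v1 v2 = 2 * f1 * a * b + 2 * f2 * c * d + (a * d + b * c) * skew w1 w2"
  shows "seq_equiv [(e1, v1), (e2, v2)] [(f1, w1), (f2, w2)]"
proof -
  define \<delta> where "\<delta> = a * d - b * c"
  have \<delta>: "\<delta> * \<delta> = 1" using det unfolding \<delta>_def by (metis abs_mult_self_eq mult_1)
  define \<theta> where "\<theta> cs = [a * cs ! 0 + b * cs ! 1, c * cs ! 0 + d * cs ! 1]" for cs :: "int list"
  define \<theta>' where "\<theta>' cs = [\<delta> * (d * cs ! 0 - b * cs ! 1), \<delta> * (a * cs ! 1 - c * cs ! 0)]" for cs :: "int list"
  have two: "\<exists>x y. cs = [x, y]" if "length cs = 2" for cs :: "int list"
    using that by (auto simp: length_Suc_conv numeral_2_eq_2)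
  have inv: "\<delta> * (d * (a * x + b * y) - b * (c * x + d * y)) = x"
    "\<delta> * (a * (c * x + d * y) - c * (a * x + b * y)) = y"
    "a * (\<delta> * (d * x - b * y)) + b * (\<delta> * (a * y - c * x)) = x"
    "c * (\<delta> * (d * x - b * y)) + d * (\<delta> * (a * y - c * x)) = y" for x y
  proof -
    have "\<delta> * (d * (a * x + b * y) - b * (c * x + d * y)) = (\<delta> * \<delta>) * x"
      "\<delta> * (a * (c * x + d * y) - c * (a * x + b * y)) = (\<delta> * \<delta>) * y"
      "a * (\<delta> * (d * x - b * y)) + b * (\<delta> * (a * y - c * x)) = (\<delta> * \<delta>) * x"
      "c * (\<delta> * (d * x - b * y)) + d * (\<delta> * (a * y - c * x)) = (\<delta> * \<delta>) * y"
      unfolding \<delta>_def by algebra+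
    then show "\<delta> * (d * (a * x + b * y) - b * (c * x + d * y)) = x"
      "\<delta> * (a * (c * x + d * y) - c * (a * x + b * y)) = y"
      "a * (\<delta> * (d * x - b * y)) + b * (\<delta> * (a * y - c * x)) = x"
      "c * (\<delta> * (d * x - b * y)) + d * (\<delta> * (a * y - c * x)) = y"
      using \<delta> by simp_all
  qed
  show ?thesis
    unfolding seq_equiv_def seq_iso_def
  proof (intro exI[of _ \<theta>] conjI allI impI)
    show "bij_betw \<theta> {cs. length cs = length [(e1, v1), (e2, v2)]} {cs. length cs = length [(f1, w1), (f2, w2)]}"
    proof (rule bij_betw_byWitness[where f' = \<theta>'])
      show "\<forall>cs\<in>{cs. length cs = length [(e1, v1), (e2, v2)]}. \<theta>' (\<theta> cs) = cs"
      proof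
        fix cs :: "int list" assume "cs \<in> {cs. length cs = length [(e1, v1), (e2, v2)]}"
        then obtain x y where "cs = [x, y]" using two[of cs] by auto
        then show "\<theta>' (\<theta> cs) = cs" by (simp add: \<theta>_def \<theta>'_def inv)
      qed
      show "\<forall>cs\<in>{cs. length cs = length [(f1, w1), (f2, w2)]}. \<theta> (\<theta>' cs) = cs"
      proof
        fix cs :: "int list" assume "cs \<in> {cs. length cs = length [(f1, w1), (f2, w2)]}"
        then obtain x y where "cs = [x, y]" using two[of cs] by auto
        then show "\<theta> (\<theta>' cs) = cs" by (simp add: \<theta>_def \<theta>'_def inv)
      qed
    qed (auto simp: \<theta>_def \<theta>'_def)
  next
    fix cs ds :: "int list"
    assume "length cs = length [(e1, v1), (e2, v2)]" "length ds = length [(e1, v1), (e2, v2)]"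
    then obtain x y x' y' where "cs = [x, y]" "ds = [x', y']" using two by (metis length_Cons list.size(3) numeral_2_eq_2)
    then show "\<theta> (add_list cs ds) = add_list (\<theta> cs) (\<theta> ds)"
      by (simp add: \<theta>_def algebra_simps)
  next
    fix cs :: "int list"
    assume "length cs = length [(e1, v1), (e2, v2)]"
    then obtain x y where cs: "cs = [x, y]" using two by (metis length_Cons list.size(3) numeral_2_eq_2)
    show "chi_seq [(f1, w1), (f2, w2)] (\<theta> cs) = chi_seq [(e1, v1), (e2, v2)] cs"
      by (simp add: cs \<theta>_def v vec_eq_iff algebra_simps)
    have "q_seq [(f1, w1), (f2, w2)] (\<theta> cs) =
        (f1 * a * a + f2 * c * c + a * c * skew w1 w2) * x * x +
        (f1 * b * b + f2 * d * d + b * d * skew w1 w2) * y * y +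
        x * y * (2 * f1 * a * b + 2 * f2 * c * d + (a * d + b * c) * skew w1 w2)"
      by (simp add: cs \<theta>_def) algebra
    also have "\<dots> = q_seq [(e1, v1), (e2, v2)] cs"
      unfolding e[symmetric] by (simp add: cs)
    finally show "q_seq [(f1, w1), (f2, w2)] (\<theta> cs) = q_seq [(e1, v1), (e2, v2)] cs" .
  qed
qed

text \<open>A Hurwitz move: the first term passes to the right of the second one and is reflected by it.\<close>

lemma seq_equiv_mutation:
  assumes "f * f = 1"
  shows "seq_equiv [(e, v), (f, w)] [(f, w), (e, v - (f * skew v w) *s w)]"
proof (rule seq_equiv_pair[where a = "f * skew v w" and b = 1 and c = 1 and d = 0])
  show "v = (f * skew v w) *s w + 1 *s (v - (f * skew v w) *s w)" by simp
  have s: "skew w (v - k *s w) = - skew v w" for k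
    by (simp add: skew_def algebra_simps)
  show "e = f * (f * skew v w) * (f * skew v w) + e * 1 * 1 + (f * skew v w) * 1 * skew w (v - (f * skew v w) *s w)"
    unfolding s using assms by algebra
  show "skew v w = 2 * f * (f * skew v w) * 1 + 2 * e * 1 * 0 + ((f * skew v w) * 0 + 1 * 1) * skew w (v - (f * skew v w) *s w)"
    unfolding s using assms by algebra
qed simp_all

text \<open>Terms with parallel vectors are orthogonal, so their order does not matter.\<close>

definition multiples :: "int^2 \<Rightarrow> int list \<Rightarrow> signed_seq" where
  "multiples d ks = map (\<lambda>\<kappa>. (- 1, \<kappa> *s d)) ks"

lemma multiples_simps [simp]:
  "multiples d [] = []" "multiples d (\<kappa> # ks) = (- 1, \<kappa> *s d) # multiples d ks"
  "multiples d (ks @ ls) = multiples d ks @ multiples d ls"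
  by (simp_all add: multiples_def)

lemma seq_equiv_multiples_move:
  assumes "f * f = 1"
  shows "seq_equiv (multiples d ks @ [(f, w)]) ((f, w) # multiples (d - (f * skew d w) *s w) ks)"
proof (induction ks)
  case (Cons \<kappa> ks)
  let ?d = "d - (f * skew d w) *s w"
  have k: "\<kappa> *s d - (f * skew (\<kappa> *s d) w) *s w = \<kappa> *s ?d"
    by (simp add: vec_eq_iff algebra_simps)
  have 1: "seq_equiv (multiples d (\<kappa> # ks) @ [(f, w)]) ([(- 1, \<kappa> *s d), (f, w)] @ multiples ?d ks)"
    using seq_equiv_Cons[OF Cons] by simp
  have 2: "seq_equiv ([(- 1, \<kappa> *s d), (f, w)] @ multiples ?d ks) ([(f, w), (- 1, \<kappa> *s ?d)] @ multiples ?d ks)"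
    using seq_equiv_mutation[OF assms, of "- 1" "\<kappa> *s d" w] unfolding k
    by (rule seq_equiv_append) (rule seq_equiv_refl)
  show ?case using seq_equiv_trans[OF 1 2] by simp
qed (simp add: seq_equiv_refl)

lemma seq_equiv_multiples_perm:
  assumes "mset ks = mset ls"
  shows "seq_equiv (multiples d ks) (multiples d ls)"
  using assms
proof (induction ks arbitrary: ls)
  case Nil
  then show ?case by (simp add: seq_equiv_refl)
next
  case (Cons \<kappa> ks)
  then have "\<kappa> \<in> set ls" by (metis list.set_intros(1) mset_eq_setD)
  then obtain as bs where ls: "ls = as @ \<kappa> # bs" by (meson split_list)
  have "mset ks = mset (as @ bs)" using Cons.prems ls by simp
  then have "seq_equiv (multiples d ks) (multiples d (as @ bs))" by (rule Cons.IH)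
  then have "seq_equiv (multiples d (\<kappa> # ks)) ((- 1, \<kappa> *s d) # multiples d (as @ bs))"
    using seq_equiv_Cons[of "multiples d ks"] by simp
  moreover have "seq_equiv ((- 1, \<kappa> *s d) # multiples d as) (multiples d as @ [(- 1, \<kappa> *s d)])"
  proof (induction as)
    case (Cons x as)
    have 1: "seq_equiv ([(- 1, \<kappa> *s d), (- 1, x *s d)] @ multiples d as) ([(- 1, x *s d), (- 1, \<kappa> *s d)] @ multiples d as)"
      using seq_equiv_mutation[of "- 1" "- 1" "\<kappa> *s d" "x *s d"]
      by (intro seq_equiv_append seq_equiv_refl) simp
    have 2: "seq_equiv ([(- 1, x *s d), (- 1, \<kappa> *s d)] @ multiples d as) (multiples d (x # as) @ [(- 1, \<kappa> *s d)])"
      using seq_equiv_Cons[OF Cons] by simp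
    show ?case using seq_equiv_trans[OF 1 2] by simp
  qed (simp add: seq_equiv_refl)
  then have "seq_equiv ((- 1, \<kappa> *s d) # multiples d (as @ bs)) (multiples d ls)"
    using seq_equiv_append[OF _ seq_equiv_refl[of "multiples d bs"]] ls by fastforce
  ultimately show ?case using seq_equiv_trans by blast
qed

subsection \<open>The normal form of a branch\<close>

text \<open>The vector of the transvection attached to a word, the image of \<open>a = (1, 0)\<close>, which spans the vectors
  fixed by \<open>XY\<close>.\<close>

definition cusp_vec :: "modgen list \<Rightarrow> int^2" where
  "cusp_vec w = modmat w *v vec2 1 0"

definition vec_seq :: "modgen list list \<Rightarrow> signed_seq" where
  "vec_seq ws = map (\<lambda>w. (1, cusp_vec w)) ws"

lemma vec_seq_append: "vec_seq (us @ vs) = vec_seq us @ vec_seq vs"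
  by (simp add: vec_seq_def)

lemma vec_seq_prefix: "vec_seq (map ((@) u) ws) = act_seq (modmat u) (vec_seq ws)"
  by (simp add: vec_seq_def cusp_vec_def modmat_append matrix_vector_mul_assoc)

lemma modmat_mat2:
  "modmat [GX] = mat2 (-1) 1 (-1) 0" "modmat [GY] = mat2 0 (-1) 1 0"
  "modmat [GX, GY] = mat2 1 1 0 1" "modmat [GX, GX, GY] = - mat2 1 0 1 1"
  by (simp_all add: modmat_Cons matX_mat2 matY_mat2 mat_1_mat2)

text \<open>The normal form of a branch with \<open>n\<close> leaves.  Its shape comes from the cherry, where the vectors
  \<open>p = (2, 1)\<close> and \<open>q = (1, 2)\<close> of square \<open>1\<close> are replaced by \<open>p - q\<close> and \<open>2 q - p\<close> of square \<open>- 1\<close>: the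
  multiple of \<open>(0, 1)\<close> obtained is \<open>3\<close>.  Each further leaf adds
  a multiple, \<open>1\<close> and \<open>3\<close> in turn.\<close>

definition branch_sign :: "nat \<Rightarrow> int" where
  "branch_sign n = (if even n then - 1 else 1)"

definition branch_mults :: "nat \<Rightarrow> int list" where
  "branch_mults n = replicate (n div 2) 3 @ replicate ((n - 1) div 2) 1"

definition branch_normal :: "nat \<Rightarrow> signed_seq" where
  "branch_normal n = (branch_sign n, vec2 1 (branch_sign n)) # multiples (vec2 0 1) (branch_mults n)"

lemma branch_mults_add:
  assumes "l > 0" "r > 0"
  shows "mset (branch_mults (l + r)) =
    mset ((if odd l \<and> odd r then 3 else 1) # branch_mults l @ branch_mults r)"
proof -
  obtain a i where l: "l = 2 * a + i" "i = 0 \<or> i = 1"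
    using mult_div_mod_eq[of 2 l] by (metis mod2_eq_if)
  obtain b j where r: "r = 2 * b + j" "j = 0 \<or> j = 1"
    using mult_div_mod_eq[of 2 r] by (metis mod2_eq_if)
  have "(l + r) div 2 = l div 2 + r div 2 + (if odd l \<and> odd r then 1 else 0)"
    using l r by auto
  moreover have "(l + r - 1) div 2 = (l - 1) div 2 + (r - 1) div 2 + (if odd l \<and> odd r then 0 else 1)"
    using l r assms by (cases a; cases b) auto
  moreover have "mset (replicate (p + p' + (if P then 1 else 0)) (3 :: int) @ replicate (q + q' + (if P then 0 else 1)) 1) =
      mset ((if P then 3 else 1) # (replicate p 3 @ replicate q 1) @ replicate p' 3 @ replicate q' 1)" for p p' q q' P
    by (cases P) (simp_all add: replicate_add)
  ultimately show ?thesis unfolding branch_mults_def by metis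
qed

lemma act_multiples: "act_seq A (multiples d ks) = multiples (A *v d) ks"
  by (simp add: multiples_def mat_scale)

text \<open>The leading terms \<open>p\<close> and \<open>q\<close> of two branches, seen from their common root, become the leading term of
  the joint branch and the additional multiple of \<open>(0, 1)\<close>.  The new basis is \<open>p - q, 2 q - p\<close> up to sign if
  \<open>p\<close> has square \<open>1\<close>, and \<open>p + q, - p\<close> if \<open>p\<close> has square \<open>- 1\<close>.  The case of two squares \<open>1\<close> trades them for
  two squares \<open>- 1\<close>; no Hurwitz move does that.\<close>

lemma branch_pair:
  assumes "c \<in> {1, -1}" "c' \<in> {1, -1 :: int}"
  shows "seq_equiv [(c, vec2 (1 + c) c), (c', vec2 1 (1 + c'))]
    [(- c * c', vec2 1 (- c * c')), (- 1, (if c = 1 \<and> c' = 1 then 3 else 1) *s vec2 0 1)]"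
proof -
  have "seq_equiv [(1, vec2 2 1), (1, vec2 1 2)] [(- 1, vec2 1 (- 1)), (- 1, vec2 0 3)]"
    by (rule seq_equiv_pair[where a = 2 and c = 1 and b = 1 and d = 1]) simp_all
  moreover have "seq_equiv [(1, vec2 2 1), (- 1, vec2 1 0)] [(1, vec2 1 1), (- 1, vec2 0 1)]"
    by (rule seq_equiv_pair[where a = 2 and c = "- 1" and b = 1 and d = "- 1"]) simp_all
  moreover have "seq_equiv [(- 1, vec2 0 (- 1)), (1, vec2 1 2)] [(1, vec2 1 1), (- 1, vec2 0 1)]"
    by (rule seq_equiv_pair[where a = 0 and c = "- 1" and b = 1 and d = 1]) simp_all
  moreover have "seq_equiv [(- 1, vec2 0 (- 1)), (- 1, vec2 1 0)] [(- 1, vec2 1 (- 1)), (- 1, vec2 0 1)]"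
    by (rule seq_equiv_pair[where a = 0 and c = "- 1" and b = 1 and d = 1]) simp_all
  ultimately show ?thesis using assms by auto
qed

text \<open>At a node, the normal forms of the two subtrees are acted on by \<open>XY\<close> and \<open>X\<^sup>2Y\<close>.  Moving the multiples of
  the left subtree, then multiples of \<open>(1, 1)\<close>, past the leading term of the right subtree makes them
  multiples of \<open>(0, 1)\<close>, parallel to those of the right subtree.  It remains to combine the two leading terms.\<close>

lemma seq_equiv_branch: "seq_equiv (vec_seq (branch t)) (branch_normal (leaves t))"
proof (induction t)
  case Leaf
  have "vec_seq (branch Leaf) = [(1, - vec2 1 1)]"
    by (simp add: vec_seq_def cusp_vec_def modmat_mat2)
  moreover have "branch_normal (leaves Leaf) = [(1, vec2 1 1)]"
    by (simp add: branch_normal_def branch_sign_def branch_mults_def)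
  ultimately show ?case using seq_equiv_neg[of "[(1, - vec2 1 1)]"] by simp
next
  case (Node l r)
  define c c' n n' where "c = branch_sign (leaves l)" and "c' = branch_sign (leaves r)"
    and "n = leaves l" and "n' = leaves r"
  have cc: "c \<in> {1, -1}" "c' \<in> {1, -1}" by (simp_all add: c_def c'_def branch_sign_def)
  define \<kappa> where "\<kappa> = (if c = 1 \<and> c' = 1 then 3 else 1 :: int)"
  let ?U = "mat2 1 1 0 1" and ?W = "mat2 1 0 1 1"
  have U: "?U \<in> carrier SL2Z" and W: "?W \<in> carrier SL2Z" by (simp_all add: mat2_in)
  have "seq_equiv (act_seq (- ?W) (branch_normal n')) (act_seq ?W (branch_normal n'))"
    by (rule seq_equiv_minus)
  moreover have "seq_equiv (act_seq (- ?W) (vec_seq (branch r))) (act_seq (- ?W) (branch_normal n'))"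
    using W Node(2) unfolding n'_def by (intro seq_equiv_act minus_in_SL2Z)
  ultimately have r: "seq_equiv (act_seq (- ?W) (vec_seq (branch r))) (act_seq ?W (branch_normal n'))"
    using seq_equiv_trans by blast
  have l: "seq_equiv (act_seq ?U (vec_seq (branch l))) (act_seq ?U (branch_normal n))"
    using U Node(1) unfolding n_def by (rule seq_equiv_act)
  let ?K = "branch_mults n" and ?K' = "branch_mults n'"
  have "seq_equiv (vec_seq (branch (Node l r))) (act_seq ?U (branch_normal n) @ act_seq ?W (branch_normal n'))"
    unfolding branch.simps vec_seq_append vec_seq_prefix modmat_mat2
    using l r by (rule seq_equiv_append)
  also have "act_seq ?U (branch_normal n) @ act_seq ?W (branch_normal n') =
      [(c, vec2 (1 + c) c)] @ (multiples (vec2 1 1) ?K @ [(c', vec2 1 (1 + c'))]) @ multiples (vec2 0 1) ?K'"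
    by (simp add: branch_normal_def act_multiples c_def c'_def n_def n'_def)
  finally have 1: "seq_equiv (vec_seq (branch (Node l r)))
      ([(c, vec2 (1 + c) c)] @ (multiples (vec2 1 1) ?K @ [(c', vec2 1 (1 + c'))]) @ multiples (vec2 0 1) ?K')" .
  have "seq_equiv (multiples (vec2 1 1) ?K @ [(c', vec2 1 (1 + c'))])
      ((c', vec2 1 (1 + c')) # multiples (vec2 0 (- c')) ?K)"
    using seq_equiv_multiples_move[of c' "vec2 1 1" ?K "vec2 1 (1 + c')"] cc by auto
  moreover have "seq_equiv (multiples (vec2 0 (- c')) ?K) (multiples (vec2 0 1) ?K)"
  proof (cases "c' = 1")
    case True
    have "multiples (vec2 0 1) ?K = map (apsnd uminus) (multiples (vec2 0 (- 1)) ?K)"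
      by (simp add: multiples_def)
    then show ?thesis using True seq_equiv_neg by metis
  qed (use cc in \<open>simp add: seq_equiv_refl\<close>)
  ultimately have "seq_equiv (multiples (vec2 1 1) ?K @ [(c', vec2 1 (1 + c'))])
      ((c', vec2 1 (1 + c')) # multiples (vec2 0 1) ?K)"
    using seq_equiv_trans seq_equiv_Cons by blast
  then have "seq_equiv ([(c, vec2 (1 + c) c)] @ (multiples (vec2 1 1) ?K @ [(c', vec2 1 (1 + c'))]) @ multiples (vec2 0 1) ?K')
      ([(c, vec2 (1 + c) c)] @ ((c', vec2 1 (1 + c')) # multiples (vec2 0 1) ?K) @ multiples (vec2 0 1) ?K')"
    by (intro seq_equiv_append seq_equiv_refl)
  then have 2: "seq_equiv ([(c, vec2 (1 + c) c)] @ (multiples (vec2 1 1) ?K @ [(c', vec2 1 (1 + c'))]) @ multiples (vec2 0 1) ?K')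
      ([(c, vec2 (1 + c) c), (c', vec2 1 (1 + c'))] @ multiples (vec2 0 1) (?K @ ?K'))"
    by simp
  have "seq_equiv ([(c, vec2 (1 + c) c), (c', vec2 1 (1 + c'))] @ multiples (vec2 0 1) (?K @ ?K'))
      ([(- c * c', vec2 1 (- c * c')), (- 1, \<kappa> *s vec2 0 1)] @ multiples (vec2 0 1) (?K @ ?K'))"
    using branch_pair[OF cc] unfolding \<kappa>_def by (rule seq_equiv_append) (rule seq_equiv_refl)
  then have 3: "seq_equiv ([(c, vec2 (1 + c) c), (c', vec2 1 (1 + c'))] @ multiples (vec2 0 1) (?K @ ?K'))
      ((- c * c', vec2 1 (- c * c')) # multiples (vec2 0 1) (\<kappa> # ?K @ ?K'))"
    by simp
  have sign: "- c * c' = branch_sign (n + n')"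
    by (simp add: c_def c'_def n_def n'_def branch_sign_def)
  have \<kappa>: "\<kappa> = (if odd n \<and> odd n' then 3 else 1)"
    by (simp add: \<kappa>_def c_def c'_def n_def n'_def branch_sign_def)
  have "seq_equiv (multiples (vec2 0 1) (\<kappa> # ?K @ ?K')) (multiples (vec2 0 1) (branch_mults (n + n')))"
    using branch_mults_add[of n n'] unfolding \<kappa> n_def n'_def
    by (intro seq_equiv_multiples_perm) simp
  then have 4: "seq_equiv ((- c * c', vec2 1 (- c * c')) # multiples (vec2 0 1) (\<kappa> # ?K @ ?K')) (branch_normal (n + n'))"
    unfolding branch_normal_def sign by (rule seq_equiv_Cons)
  show ?case
    using seq_equiv_trans[OF 1 seq_equiv_trans[OF 2 seq_equiv_trans[OF 3 4]]]
    by (simp add: n_def n'_def)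
qed

subsection \<open>Lattices of closed sequences\<close>

text \<open>The relations between the vectors, that is, the kernel of the boundary map.\<close>

definition cycles :: "signed_seq \<Rightarrow> int list set" where
  "cycles s = {cs. length cs = length s \<and> chi_seq s cs = 0}"

definition lat_iso :: "(int list \<Rightarrow> int list) \<Rightarrow> signed_seq \<Rightarrow> signed_seq \<Rightarrow> bool" where
  "lat_iso \<theta> s t \<longleftrightarrow> bij_betw \<theta> (cycles s) (cycles t) \<and>
     (\<forall>cs\<in>cycles s. \<forall>ds\<in>cycles s. \<theta> (add_list cs ds) = add_list (\<theta> cs) (\<theta> ds)) \<and>
     (\<forall>cs\<in>cycles s. q_seq t (\<theta> cs) = q_seq s cs)"

definition lat_equiv :: "signed_seq \<Rightarrow> signed_seq \<Rightarrow> bool" where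
  "lat_equiv s t \<longleftrightarrow> (\<exists>\<theta>. lat_iso \<theta> s t)"

lemma lat_isoD:
  assumes "lat_iso \<theta> s t"
  shows "bij_betw \<theta> (cycles s) (cycles t)"
    and "\<And>cs ds. cs \<in> cycles s \<Longrightarrow> ds \<in> cycles s \<Longrightarrow> \<theta> (add_list cs ds) = add_list (\<theta> cs) (\<theta> ds)"
    and "\<And>cs. cs \<in> cycles s \<Longrightarrow> q_seq t (\<theta> cs) = q_seq s cs"
  using assms by (simp_all add: lat_iso_def)

lemma lat_equiv_trans:
  assumes "lat_equiv s t" "lat_equiv t u"
  shows "lat_equiv s u"
proof -
  obtain f where "lat_iso f s t" using assms(1) unfolding lat_equiv_def by blast
  note f = lat_isoD[OF this]
  obtain g where "lat_iso g t u" using assms(2) unfolding lat_equiv_def by blast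
  note g = lat_isoD[OF this]
  show ?thesis
    unfolding lat_equiv_def lat_iso_def
    using bij_betw_trans[OF f(1) g(1)] bij_betwE[OF f(1)]
    by (intro exI[of _ "g \<circ> f"]) (simp add: f(2,3) g(2,3))
qed

lemma seq_equiv_lat_equiv:
  assumes "seq_equiv s t"
  shows "lat_equiv s t"
proof -
  obtain f where "seq_iso f s t" using assms unfolding seq_equiv_def by blast
  note f = seq_isoD[OF this]
  have "bij_betw f (cycles s) (cycles t)"
  proof (rule bij_betwI')
    fix x y assume "x \<in> cycles s" "y \<in> cycles s"
    then show "f x = f y \<longleftrightarrow> x = y"
      using bij_betw_imp_inj_on[OF f(1)] by (auto simp: cycles_def inj_on_def)
  next
    fix x assume "x \<in> cycles s"
    then show "f x \<in> cycles t"
      using f(3) bij_betwE[OF f(1)] by (auto simp: cycles_def)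
  next
    fix y assume y: "y \<in> cycles t"
    then obtain x where "length x = length s" "y = f x"
      using bij_betw_imp_surj_on[OF f(1)] by (auto simp: cycles_def)
    then show "\<exists>x\<in>cycles s. y = f x" using y f(3) by (auto simp: cycles_def)
  qed
  then show ?thesis
    unfolding lat_equiv_def lat_iso_def by (intro exI[of _ f]) (auto simp: cycles_def f(2,3))
qed

lemma lat_equiv_act:
  assumes "A \<in> carrier SL2Z"
  shows "lat_equiv s (act_seq A s)" "lat_equiv (act_seq A s) s"
proof -
  have "A *v x = 0 \<longleftrightarrow> x = 0" for x
  proof
    assume "A *v x = 0"
    then have "(inv\<^bsub>SL2Z\<^esub> A ** A) *v x = 0"
      by (simp flip: matrix_vector_mul_assoc)
    then show "x = 0" using SL2Z.l_inv[OF assms] by simp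
  qed simp
  then have "cycles (act_seq A s) = cycles s"
    by (simp add: cycles_def chi_seq_act)
  then show "lat_equiv s (act_seq A s)" "lat_equiv (act_seq A s) s"
    unfolding lat_equiv_def lat_iso_def by (intro exI[of _ id]; simp add: q_seq_act[OF assms])+
qed

text \<open>On cycles the quadratic form only depends on the cyclic order, since the boundaries of the
  two pieces are opposite and hence have zero product.\<close>

lemma lat_equiv_rotate: "lat_equiv (s @ t) (t @ s)"
proof -
  define f where "f cs = drop (length s) cs @ take (length s) cs" for cs :: "int list"
  define g where "g cs = drop (length t) cs @ take (length t) cs" for cs :: "int list"
  have split: "\<exists>as bs. cs = as @ bs \<and> length as = length s \<and> length bs = length t \<and>
      chi_seq s as + chi_seq t bs = 0" if "cs \<in> cycles (s @ t)" for s t :: signed_seq and cs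
  proof -
    have l: "cs = take (length s) cs @ drop (length s) cs" "length (take (length s) cs) = length s"
      "length (drop (length s) cs) = length t" using that by (simp_all add: cycles_def)
    have "chi_seq (s @ t) (take (length s) cs @ drop (length s) cs) = 0"
      using that by (simp add: cycles_def)
    then show ?thesis using l unfolding chi_seq_append[OF l(2)] by blast
  qed
  have f: "f cs \<in> cycles (t @ s) \<and> g (f cs) = cs \<and> q_seq (t @ s) (f cs) = q_seq (s @ t) cs"
    if "cs \<in> cycles (s @ t)" for cs
  proof -
    obtain as bs where ab: "cs = as @ bs" "length as = length s" "length bs = length t"
      "chi_seq s as + chi_seq t bs = 0" using split[OF \<open>cs \<in> _\<close>] by blast
    then have "chi_seq t bs = - chi_seq s as" by (simp add: eq_neg_iff_add_eq_0 add.commute)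
    with ab show ?thesis
      by (simp add: f_def g_def cycles_def chi_seq_append q_seq_append)
  qed
  have g: "g cs \<in> cycles (s @ t) \<and> f (g cs) = cs" if "cs \<in> cycles (t @ s)" for cs
  proof -
    obtain as bs where ab: "cs = as @ bs" "length as = length t" "length bs = length s"
      "chi_seq t as + chi_seq s bs = 0" using split[OF \<open>cs \<in> _\<close>] by blast
    then show ?thesis
      by (simp add: f_def g_def cycles_def chi_seq_append add.commute)
  qed
  have "bij_betw f (cycles (s @ t)) (cycles (t @ s))"
    by (rule bij_betw_byWitness[where f' = g]) (use f g in blast)+
  moreover have "f (add_list cs ds) = add_list (f cs) (f ds)"
    if "cs \<in> cycles (s @ t)" "ds \<in> cycles (s @ t)" for cs ds
    using that by (simp add: f_def cycles_def take_map drop_map take_zip drop_zip zip_append)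
  ultimately show ?thesis unfolding lat_equiv_def lat_iso_def using f by blast
qed

lemma act_seq_mult: "act_seq A (act_seq B s) = act_seq (A ** B) s"
  by (induction s) (simp_all add: prod_eq_iff matrix_vector_mul_assoc)

text \<open>Moving the base edge across a vertex turns the skeleton of \<open>Node (Node a b) c\<close> into that of
  \<open>Node b (Node c a)\<close>.  Repeating this one reaches a tree with a leaf next to the base edge, for
  which the normal form of the other branch determines everything.\<close>

lemma lat_equiv_skeleton_step:
  "lat_equiv (vec_seq (skeleton (Node (Node a b) c))) (vec_seq (skeleton (Node b (Node c a))))"
proof -
  let ?U = "modmat [GX, GY]" and ?W = "modmat [GX, GX, GY]" and ?Y = "modmat [GY]"
  have c: "modmat ([GX, GX, GY] @ [GY] @ [GX, GY]) = - ?Y"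
    "modmat ([GX, GX, GY] @ [GY] @ [GX, GX, GY]) = - ?U"
    by (simp_all add: modmat_append modmat_Cons matX_mat2 matY_mat2 mat_1_mat2)
  let ?a = "vec_seq (branch a)" and ?b = "vec_seq (branch b)" and ?c = "vec_seq (branch c)"
  have l: "vec_seq (skeleton (Node (Node a b) c)) = act_seq ?U ?a @ act_seq ?W ?b @ act_seq ?Y ?c"
    by (simp add: vec_seq_append vec_seq_prefix[symmetric])
  have "act_seq ?W (vec_seq (skeleton (Node b (Node c a)))) =
      act_seq ?W ?b @ act_seq (modmat ([GX, GX, GY] @ [GY] @ [GX, GY])) ?c @
      act_seq (modmat ([GX, GX, GY] @ [GY] @ [GX, GX, GY])) ?a"
    by (simp only: skeleton.simps branch.simps vec_seq_append vec_seq_prefix map_append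
        act_seq_mult modmat_append matrix_mul_assoc)
  also have "\<dots> = act_seq ?W ?b @ act_seq (- ?Y) ?c @ act_seq (- ?U) ?a"
    unfolding c ..
  finally have r: "act_seq ?W (vec_seq (skeleton (Node b (Node c a)))) =
    act_seq ?W ?b @ act_seq (- ?Y) ?c @ act_seq (- ?U) ?a" .
  have neg: "seq_equiv (act_seq A s) (act_seq (- A) s)" for A s
    using seq_equiv_minus[of "- A" s] by simp
  have "lat_equiv (vec_seq (skeleton (Node (Node a b) c))) ((act_seq ?W ?b @ act_seq ?Y ?c) @ act_seq ?U ?a)"
    unfolding l by (rule lat_equiv_rotate)
  moreover have "lat_equiv ((act_seq ?W ?b @ act_seq ?Y ?c) @ act_seq ?U ?a)
      (act_seq ?W (vec_seq (skeleton (Node b (Node c a)))))"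
    unfolding r append_assoc
    by (intro seq_equiv_lat_equiv seq_equiv_append seq_equiv_refl neg)
  moreover have "lat_equiv (act_seq ?W (vec_seq (skeleton (Node b (Node c a)))))
      (vec_seq (skeleton (Node b (Node c a))))"
    by (rule lat_equiv_act) simp
  ultimately show ?thesis using lat_equiv_trans by blast
qed

definition skeleton_normal :: "nat \<Rightarrow> signed_seq" where
  "skeleton_normal n = branch_normal 1 @ act_seq matY (branch_normal (n - 1))"

lemma lat_equiv_skeleton:
  assumes "t \<noteq> Leaf"
  shows "lat_equiv (vec_seq (skeleton t)) (skeleton_normal (leaves t))"
proof -
  have "lat_equiv (vec_seq (skeleton (Node l r))) (skeleton_normal (leaves l + leaves r))" for l r
  proof (induction l arbitrary: r)
    case Leaf
    have "vec_seq (skeleton (Node Leaf r)) = vec_seq (branch Leaf) @ act_seq matY (vec_seq (branch r))"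
      by (simp add: vec_seq_append vec_seq_prefix[of "[GY]", simplified] modmat_Cons del: branch.simps)
    moreover have "seq_equiv (vec_seq (branch Leaf) @ act_seq matY (vec_seq (branch r)))
        (branch_normal 1 @ act_seq matY (branch_normal (leaves r)))"
      using seq_equiv_branch[of Leaf] seq_equiv_branch[of r]
      by (intro seq_equiv_append seq_equiv_act) simp_all
    ultimately show ?case by (simp add: skeleton_normal_def seq_equiv_lat_equiv)
  next
    case (Node a b)
    have "leaves b + leaves (Node r a) = leaves (Node a b) + leaves r" by simp
    with lat_equiv_trans[OF lat_equiv_skeleton_step Node.IH(2)[of "Node r a"]]
    show ?case by (simp only:)
  qed
  with assms show ?thesis by (cases t) auto
qed

subsection \<open>The transcendental lattice\<close>

definition form_radical :: "('g, 'm) monoid_scheme \<Rightarrow> ('g \<Rightarrow> int) \<Rightarrow> 'g set" where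
  "form_radical G q = {x \<in> carrier G. \<forall>y\<in>carrier G. q (y \<otimes>\<^bsub>G\<^esub> x) = q y}"

lemma (in comm_group) form_radical_normal: "form_radical G q \<lhd> G"
proof -
  have "subgroup (form_radical G q) G"
  proof (rule subgroupI)
    show "form_radical G q \<noteq> {}" by (auto simp: form_radical_def intro!: exI[of _ \<one>])
    fix a assume a: "a \<in> form_radical G q"
    then have "q (y \<otimes> inv a) = q y" if "y \<in> carrier G" for y
    proof -
      have "q ((y \<otimes> inv a) \<otimes> a) = q (y \<otimes> inv a)"
        using a that by (auto simp: form_radical_def)
      then show ?thesis using a that by (simp add: form_radical_def m_assoc)
    qed
    then show "inv a \<in> form_radical G q" using a by (simp add: form_radical_def)
    fix b assume b: "b \<in> form_radical G q"
    show "a \<otimes> b \<in> form_radical G q"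
      using a b by (simp add: form_radical_def flip: m_assoc)
  qed (auto simp: form_radical_def)
  then show ?thesis by (simp add: normal_iff_subgroup)
qed

lemma (in comm_group) form_on_coset:
  assumes "g \<in> carrier G"
  shows "the_elem (q ` (form_radical G q #> g)) = q g"
proof -
  have invariant: "q (h \<otimes> g) = q g" if h: "h \<in> form_radical G q" for h
  proof -
    have "h \<in> carrier G" "q (g \<otimes> h) = q g" using h assms by (auto simp: form_radical_def)
    then show ?thesis using m_comm[of h g] assms by simp
  qed
  have "q ` (form_radical G q #> g) = (\<lambda>h. q (h \<otimes> g)) ` form_radical G q"
    by (auto simp: r_coset_def)
  also have "\<dots> = (\<lambda>h. q g) ` form_radical G q"
    by (rule image_cong[OF refl]) (rule invariant)
  also have "\<dots> = {q g}"
    by (rule image_constant[of \<one>]) (simp add: form_radical_def)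
  finally show ?thesis by simp
qed

text \<open>The quotient by the radical does not notice a surjection that preserves the form.\<close>

lemma isometric_quotient:
  assumes G: "comm_group G" and C: "comm_group C" and \<Phi>: "\<Phi> \<in> hom G C"
    and surj: "\<Phi> ` carrier G = carrier C" and q: "\<And>x. x \<in> carrier G \<Longrightarrow> Q (\<Phi> x) = q x"
  shows "isometric (G Mod form_radical G q) (\<lambda>c. the_elem (q ` c))
    (C Mod form_radical C Q) (\<lambda>c. the_elem (Q ` c))"
proof -
  let ?R = "form_radical C Q" and ?N = "form_radical G q"
  note GG = comm_group.axioms(2)[OF G] and CC = comm_group.axioms(2)[OF C]
  note R = comm_group.form_radical_normal[OF C, of Q]
  note Rs = normal_imp_subgroup[OF R]
  note CR = normal.factorgroup_is_group[OF R]
  define \<Psi> where "\<Psi> x = ?R #>\<^bsub>C\<^esub> \<Phi> x" for x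
  have \<Phi>c: "\<Phi> x \<in> carrier C" if "x \<in> carrier G" for x using surj that by blast
  have \<Phi>m: "\<Phi> (x \<otimes>\<^bsub>G\<^esub> y) = \<Phi> x \<otimes>\<^bsub>C\<^esub> \<Phi> y" if "x \<in> carrier G" "y \<in> carrier G" for x y
    using hom_mult[OF \<Phi> that] .
  have onto: "\<Psi> ` carrier G = carrier (C Mod ?R)"
    unfolding \<Psi>_def FactGroup_def RCOSETS_def surj[symmetric] by auto
  have hom: "\<Psi> \<in> hom G (C Mod ?R)"
  proof (rule homI)
    fix x y assume xy: "x \<in> carrier G" "y \<in> carrier G"
    show "\<Psi> x \<in> carrier (C Mod ?R)" using onto xy(1) by blast
    show "\<Psi> (x \<otimes>\<^bsub>G\<^esub> y) = \<Psi> x \<otimes>\<^bsub>C Mod ?R\<^esub> \<Psi> y"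
      unfolding \<Psi>_def \<Phi>m[OF xy] FactGroup_def
      using normal.rcos_sum[OF R \<Phi>c[OF xy(1)] \<Phi>c[OF xy(2)]] by simp
  qed
  have N_iff: "x \<in> ?N \<longleftrightarrow> \<Phi> x \<in> ?R" if x: "x \<in> carrier G" for x
  proof -
    have "q (y \<otimes>\<^bsub>G\<^esub> x) = q y \<longleftrightarrow> Q (\<Phi> y \<otimes>\<^bsub>C\<^esub> \<Phi> x) = Q (\<Phi> y)" if y: "y \<in> carrier G" for y
      using q[OF y] q[OF monoid.m_closed[OF group.is_monoid[OF GG] y x]] \<Phi>m[OF y x] by simp
    then have "(\<forall>y\<in>carrier G. q (y \<otimes>\<^bsub>G\<^esub> x) = q y) \<longleftrightarrow> (\<forall>z\<in>carrier C. Q (z \<otimes>\<^bsub>C\<^esub> \<Phi> x) = Q z)"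
      unfolding surj[symmetric] by blast
    then show ?thesis using x \<Phi>c[OF x] unfolding form_radical_def mem_Collect_eq by blast
  qed
  have ker: "kernel G (C Mod ?R) \<Psi> = ?N"
  proof (intro equalityI subsetI)
    fix x assume "x \<in> kernel G (C Mod ?R) \<Psi>"
    then have x: "x \<in> carrier G" "?R #>\<^bsub>C\<^esub> \<Phi> x = ?R"
      unfolding kernel_def \<Psi>_def FactGroup_def by auto
    then show "x \<in> ?N" using group.coset_join1[OF CC x(2) \<Phi>c[OF x(1)] Rs] N_iff by blast
  next
    fix x assume x: "x \<in> ?N"
    then have xc: "x \<in> carrier G" by (simp add: form_radical_def)
    then have "\<Psi> x = ?R"
      unfolding \<Psi>_def using group.coset_join2[OF CC \<Phi>c[OF xc] Rs] N_iff x by blast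
    then show "x \<in> kernel G (C Mod ?R) \<Psi>" using xc by (simp add: kernel_def FactGroup_def)
  qed
  have gh: "group_hom G (C Mod ?R) \<Psi>"
    using hom CR GG by (intro group_hom.intro group_hom_axioms.intro)
  have iso: "(\<lambda>X. the_elem (\<Psi> ` X)) \<in> iso (G Mod ?N) (C Mod ?R)"
    using group_hom.FactGroup_iso_set[OF gh onto] unfolding ker .
  have "the_elem (Q ` the_elem (\<Psi> ` X)) = the_elem (q ` X)" if X: "X \<in> carrier (G Mod ?N)" for X
  proof -
    obtain g where g: "g \<in> carrier G" "X = ?N #>\<^bsub>G\<^esub> g"
      using X unfolding FactGroup_def RCOSETS_def by auto
    have "\<Psi> (n \<otimes>\<^bsub>G\<^esub> g) = \<Psi> g" if n: "n \<in> ?N" for n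
    proof -
      have nc: "n \<in> carrier G" "\<Psi> n = \<one>\<^bsub>C Mod ?R\<^esub>" using n unfolding ker[symmetric] kernel_def by blast+
      have "\<Psi> g \<in> carrier (C Mod ?R)" using onto g(1) by blast
      from monoid.l_one[OF group.is_monoid[OF CR] this] show ?thesis
        unfolding hom_mult[OF hom nc(1) g(1)] nc(2) .
    qed
    moreover have "\<one>\<^bsub>G\<^esub> \<in> ?N"
      using subgroup.one_closed[OF normal_imp_subgroup[OF comm_group.form_radical_normal[OF G]]] .
    ultimately have "\<Psi> ` X = {\<Psi> g}" unfolding g(2) r_coset_def by blast
    then have "the_elem (Q ` the_elem (\<Psi> ` X)) = the_elem (Q ` (?R #>\<^bsub>C\<^esub> \<Phi> g))" by (simp add: \<Psi>_def)
    also have "\<dots> = Q (\<Phi> g)" by (rule comm_group.form_on_coset[OF C \<Phi>c[OF g(1)]])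
    also have "\<dots> = the_elem (q ` X)"
      unfolding g(2) comm_group.form_on_coset[OF G g(1)] by (rule q[OF g(1)])
    finally show ?thesis .
  qed
  then show ?thesis unfolding isometric_def by (intro bexI[OF _ iso] ballI)
qed

lemma isometric_common_target:
  assumes "group G" "group G'" "isometric G q C Q" "isometric G' q' C Q"
  shows "isometric G q G' q'"
proof -
  obtain f g where f: "f \<in> iso G C" "\<And>x. x \<in> carrier G \<Longrightarrow> Q (f x) = q x"
    and g: "g \<in> iso G' C" "\<And>x. x \<in> carrier G' \<Longrightarrow> Q (g x) = q' x"
    using assms(3,4) unfolding isometric_def by blast
  define h where "h = inv_into (carrier G') g"
  have h: "h \<in> iso C G'" unfolding h_def using group.iso_set_sym[OF assms(2) g(1)] .
  have fc: "f x \<in> carrier C" if "x \<in> carrier G" for x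
    using f(1) that by (auto simp: iso_def hom_def)
  have hc: "h y \<in> carrier G'" "g (h y) = y" if "y \<in> carrier C" for y
    using h g(1) that by (auto simp: iso_def hom_def h_def bij_betw_def f_inv_into_f)
  show ?thesis
    unfolding isometric_def
  proof (intro bexI[of _ "h \<circ> f"] ballI)
    show "h \<circ> f \<in> iso G G'" using iso_set_trans[OF f(1) h] .
    fix x assume x: "x \<in> carrier G"
    have "q' (h (f x)) = Q (g (h (f x)))" using g(2) hc(1) fc x by simp
    then show "q' ((h \<circ> f) x) = q x" using hc(2) fc f(2) x by simp
  qed
qed

definition cycle_group :: "signed_seq \<Rightarrow> int list monoid" where
  "cycle_group s = \<lparr>carrier = cycles s, mult = add_list, one = replicate (length s) 0\<rparr>"

lemma comm_group_cycle_group: "comm_group (cycle_group s)"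
proof (rule comm_groupI)
  have z: "chi_seq s (replicate (length s) 0) = 0" by (induction s) simp_all
  have neg: "length cs = length s \<Longrightarrow> chi_seq s (map uminus cs) = - chi_seq s cs" for cs
    by (induction cs s rule: list_induct2) (simp_all add: vec_eq_iff)
  show "\<one>\<^bsub>cycle_group s\<^esub> \<in> carrier (cycle_group s)"
    by (simp add: cycle_group_def cycles_def z)
  fix x assume x: "x \<in> carrier (cycle_group s)"
  show "\<exists>y\<in>carrier (cycle_group s). y \<otimes>\<^bsub>cycle_group s\<^esub> x = \<one>\<^bsub>cycle_group s\<^esub>"
    using x by (intro bexI[of _ "map uminus x"])
      (auto simp: cycle_group_def cycles_def neg intro: nth_equalityI)
  show "\<one>\<^bsub>cycle_group s\<^esub> \<otimes>\<^bsub>cycle_group s\<^esub> x = x"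
    using x by (auto simp: cycle_group_def cycles_def intro: nth_equalityI)
  fix y assume y: "y \<in> carrier (cycle_group s)"
  show "x \<otimes>\<^bsub>cycle_group s\<^esub> y \<in> carrier (cycle_group s)"
    using x y by (simp add: cycle_group_def cycles_def chi_seq_add)
  show "x \<otimes>\<^bsub>cycle_group s\<^esub> y = y \<otimes>\<^bsub>cycle_group s\<^esub> x"
    using x y by (auto simp: cycle_group_def cycles_def intro: nth_equalityI)
  fix z assume z: "z \<in> carrier (cycle_group s)"
  show "x \<otimes>\<^bsub>cycle_group s\<^esub> y \<otimes>\<^bsub>cycle_group s\<^esub> z = x \<otimes>\<^bsub>cycle_group s\<^esub> (y \<otimes>\<^bsub>cycle_group s\<^esub> z)"
    using x y z by (auto simp: cycle_group_def cycles_def intro: nth_equalityI)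
qed

text \<open>The two lifts of an element of \<open>PSL2Z\<close> differ by sign, and conjugates of \<open>XY\<close> have trace \<open>2\<close>.\<close>

lemma lift_SL2Z_factor: "lift_SL2Z (factor ws) = map twist ws"
  unfolding lift_SL2Z_def
proof (rule the_equality)
  have "conjugate_in SL2Z (matX ** matY) (twist w)" for w
    unfolding conjugate_in_def by (rule bexI[of _ "modmat w"]) (simp_all add: twist_def)
  then show "simple_SL2Z (map twist ws) \<and> map to_PSL2Z (map twist ws) = factor ws"
    by (simp add: all_conjugate_def factor_def)
next
  fix ns assume ns: "simple_SL2Z ns \<and> map to_PSL2Z ns = factor ws"
  have tr: "A$1$1 + A$2$2 = 2" if c: "conjugate_in SL2Z (matX ** matY) A" for A
  proof -
    obtain x where x: "x \<in> carrier SL2Z" "A = x ** (matX ** matY) ** inv\<^bsub>SL2Z\<^esub> x"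
      using c unfolding conjugate_in_def by auto
    obtain a b c d where m: "x = mat2 a b c d" by (rule mat2_cases)
    have det: "a * d - b * c = 1" using x(1) m by (simp add: SL2Z_carrier)
    have "A$1$1 + A$2$2 = 2 * (a * d - b * c)"
      unfolding x(2) m inv_SL2Z_mat2[OF det] by (simp add: matX_mat2 matY_mat2 algebra_simps)
    then show ?thesis using det by simp
  qed
  have "conjugate_in SL2Z (matX ** matY) (twist w)" for w
    unfolding conjugate_in_def by (rule bexI[of _ "modmat w"]) (simp_all add: twist_def)
  note trw = tr[OF this]
  have len: "length ns = length ws" using ns by (metis factor_def length_map)
  show "ns = map twist ws"
  proof (rule nth_equalityI)
    fix i assume i: "i < length ns"
    have "to_PSL2Z (ns ! i) = to_PSL2Z (twist (ws ! i))"
      using ns i len by (metis (no_types, lifting) factor_def nth_map)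
    then have "ns ! i = twist (ws ! i) \<or> ns ! i = - twist (ws ! i)"
      by (simp add: to_PSL2Z_eq_iff)
    moreover have "(ns ! i)$1$1 + (ns ! i)$2$2 = 2"
      using ns i by (intro tr) (simp add: all_conjugate_def)
    ultimately show "ns ! i = map twist ws ! i"
      using trw[of "ws ! i"] i len by auto
  qed (simp add: len)
qed

lemma twist_vec: "twist w *v x = x - skew x (cusp_vec w) *s cusp_vec w"
proof -
  obtain a b c d where m: "modmat w = mat2 a b c d" by (rule mat2_cases)
  have det: "a * d - b * c = 1" using modmat_in[of w] m by (simp add: SL2Z_carrier)
  obtain x1 x2 where x: "x = vec2 x1 x2" by (rule vec2_cases)
  have t: "twist w = mat2 (a * d - b * c - a * c) (a * a) (- (c * c)) (a * d - b * c + a * c)"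
    unfolding twist_def m inv_SL2Z_mat2[OF det] by (simp add: matX_mat2 matY_mat2 algebra_simps)
  show ?thesis
    unfolding t x cusp_vec_def m det by (simp add: algebra_simps)
qed

lemma chi_seq_sum:
  assumes "length cs = length s"
  shows "chi_seq s cs = (\<Sum>i<length s. cs ! i *s snd (s ! i))"
    and "q_seq s cs = (\<Sum>i<length s. fst (s ! i) * cs ! i * cs ! i) +
      (\<Sum>j<length s. \<Sum>i<j. skew (cs ! i *s snd (s ! i)) (cs ! j *s snd (s ! j)))"
proof -
  have "chi_seq s cs = (\<Sum>i<length s. cs ! i *s snd (s ! i)) \<and>
    q_seq s cs = (\<Sum>i<length s. fst (s ! i) * cs ! i * cs ! i) +
      (\<Sum>j<length s. \<Sum>i<j. skew (cs ! i *s snd (s ! i)) (cs ! j *s snd (s ! j)))"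
    using assms
  proof (induction s arbitrary: cs rule: rev_induct)
    case (snoc x s)
    then obtain ds d where cs: "cs = ds @ [d]" "length ds = length s"
      by (cases cs rule: rev_cases) auto
    have sk: "skew (\<Sum>i<n. f i) v = (\<Sum>i<n. skew (f i) v)" for n :: nat and f v
      by (induction n) simp_all
    show ?case
      using snoc.IH[OF cs(2)]
      by (simp add: cs chi_seq_append q_seq_append nth_append sk del: skew_simps(5,6))
  qed simp
  then show "chi_seq s cs = (\<Sum>i<length s. cs ! i *s snd (s ! i))"
    "q_seq s cs = (\<Sum>i<length s. fst (s ! i) * cs ! i * cs ! i) +
      (\<Sum>j<length s. \<Sum>i<j. skew (cs ! i *s snd (s ! i)) (cs ! j *s snd (s ! j)))"
    by blast+
qed

text \<open>A transvection moves \<open>x\<^sub>i\<close> by \<open>c\<^sub>i v\<^sub>i\<close> with \<open>c\<^sub>i = - x\<^sub>i \<cdot> v\<^sub>i\<close>, and both \<open>\<chi>\<close> and \<open>q\<close> only depend on these numbers.\<close>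

definition coords :: "modgen list list \<Rightarrow> (nat \<Rightarrow> int^2) \<Rightarrow> int list" where
  "coords ws x = map (\<lambda>i. - skew (x i) (cusp_vec (ws ! i))) [0..<length ws]"

lemma length_coords [simp]: "length (coords ws x) = length ws"
  by (simp add: coords_def)

lemma chi_coords: "chi (map twist ws) x = chi_seq (vec_seq ws) (coords ws x)"
  by (simp add: chi_def chi_seq_sum vec_seq_def twist_vec coords_def vec_eq_iff)

lemma q_coords: "q_form (map twist ws) x = q_seq (vec_seq ws) (coords ws x)"
proof -
  have d: "twist (ws ! i) *v x i - x i = coords ws x ! i *s snd (vec_seq ws ! i)" if "i < length ws" for i
    using that by (simp add: twist_vec coords_def vec_seq_def vec_eq_iff)
  have s: "- skew (x i) (twist (ws ! i) *v x i) = fst (vec_seq ws ! i) * coords ws x ! i * coords ws x ! i"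
    if "i < length ws" for i
  proof -
    have "skew (x i) (twist (ws ! i) *v x i) = skew (x i) (twist (ws ! i) *v x i - x i)"
      by (simp add: skew_def algebra_simps)
    then show ?thesis unfolding d[OF that] using that by (simp add: vec_seq_def coords_def)
  qed
  have l: "length (coords ws x) = length (vec_seq ws)" by (simp add: vec_seq_def)
  show ?thesis
    unfolding chi_seq_sum(2)[OF l] q_form_def sum_negf[symmetric]
    by (intro arg_cong2[of _ _ _ _ "(+)"] sum.cong) (auto simp: vec_seq_def[of ws] s d simp del: skew_simps)
qed

text \<open>The vectors are primitive, so all coordinates \<open>c\<^sub>i\<close> occur: a preimage is a multiple of the image of \<open>b\<close>
  under the matrix that maps \<open>a\<close> to \<open>v\<^sub>i\<close>.\<close>

lemma isometric_cycle_group: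
  assumes "lat_equiv (vec_seq ws) s"
  shows "isometric (transcendental_lattice (factor ws)) (transcendental_form (factor ws))
      (cycle_group s Mod form_radical (cycle_group s) (q_seq s)) (\<lambda>c. the_elem (q_seq s ` c))"
    and "group (transcendental_lattice (factor ws))"
proof -
  define ns where "ns = map twist ws"
  define r where "r = length ws"
  define G where "G = H_sum r\<lparr>carrier := ker_chi ns\<rparr>"
  have len: "length ns = r" by (simp add: ns_def r_def)
  have H: "comm_group H_group"
  proof (rule comm_groupI)
    fix x assume "x \<in> carrier H_group"
    show "\<exists>y\<in>carrier H_group. y \<otimes>\<^bsub>H_group\<^esub> x = \<one>\<^bsub>H_group\<^esub>"
      by (rule bexI[of _ "- x"]) (simp_all add: H_group_def)
  qed (simp_all add: H_group_def add.assoc add.commute)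
  have Hs: "comm_group (H_sum r)"
  proof (rule group.group_comm_groupI)
    show "group (H_sum r)"
      unfolding H_sum_def using comm_group.axioms(2)[OF H] by (intro product_group)
    show "x \<otimes>\<^bsub>H_sum r\<^esub> y = y \<otimes>\<^bsub>H_sum r\<^esub> x" for x y
      by (simp add: H_sum_def H_group_def add.commute)
  qed
  interpret Hs: comm_group "H_sum r" by (rule Hs)
  have mult: "(x \<otimes>\<^bsub>H_sum r\<^esub> y) i = x i + y i" if "i < r" for x y i
    using that by (simp add: H_sum_def H_group_def)
  have coords_mult: "coords ws (x \<otimes>\<^bsub>H_sum r\<^esub> y) = add_list (coords ws x) (coords ws y)" for x y
    by (rule nth_equalityI) (simp_all add: coords_def mult flip: r_def)
  have chi_hom: "chi ns \<in> hom (H_sum r) H_group"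
    by (rule homI) (simp_all add: H_group_def ns_def chi_coords coords_mult chi_seq_add vec_seq_def)
  interpret chi: group_hom "H_sum r" H_group "chi ns"
    using chi_hom H comm_group.axioms(2) by (intro group_hom.intro group_hom_axioms.intro Hs.is_group) blast+
  have sub: "subgroup (ker_chi ns) (H_sum r)"
    unfolding ker_chi_def len by (rule chi.subgroup_kernel)
  have G: "comm_group G"
    unfolding G_def
  proof (rule group.group_comm_groupI)
    show "group (H_sum r\<lparr>carrier := ker_chi ns\<rparr>)"
      using sub Hs.is_group by (rule subgroup.subgroup_is_group)
    show "x \<otimes>\<^bsub>H_sum r\<lparr>carrier := ker_chi ns\<rparr>\<^esub> y = y \<otimes>\<^bsub>H_sum r\<lparr>carrier := ker_chi ns\<rparr>\<^esub> x" for x y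
      by (simp add: H_sum_def H_group_def add.commute)
  qed
  have carrier: "x \<in> carrier G \<longleftrightarrow> x \<in> carrier (H_sum r) \<and> coords ws x \<in> cycles (vec_seq ws)" for x
    unfolding G_def ker_chi_def len
    by (simp add: kernel_def cycles_def ns_def chi_coords H_group_def) (simp add: vec_seq_def)
  have rad: "ker_chi_perp ns = form_radical G (q_form ns)"
    by (simp add: ker_chi_perp_def form_radical_def G_def len)
  have lat: "transcendental_lattice (factor ws) = G Mod form_radical G (q_form ns)"
    unfolding transcendental_lattice_def lift_SL2Z_factor Let_def
    by (simp add: rad G_def len flip: ns_def)
  have form: "transcendental_form (factor ws) = (\<lambda>c. the_elem (q_form ns ` c))"
    by (simp add: transcendental_form_def lift_SL2Z_factor ns_def fun_eq_iff)
  obtain \<theta> where "lat_iso \<theta> (vec_seq ws) s" using assms unfolding lat_equiv_def by blast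
  note \<theta> = lat_isoD[OF this]
  have onto: "coords ws ` carrier G = cycles (vec_seq ws)"
  proof (intro equalityI subsetI)
    fix cs assume cs: "cs \<in> cycles (vec_seq ws)"
    define u where "u w = modmat w *v vec2 0 1" for w
    have u: "skew (u w) (cusp_vec w) = - 1" for w
      unfolding u_def cusp_vec_def skew_SL2Z[OF modmat_in] by simp
    define x where "x = (\<lambda>i\<in>{..<r}. cs ! i *s u (ws ! i))"
    have "coords ws x = cs"
      using cs by (intro nth_equalityI) (simp_all add: coords_def x_def u r_def cycles_def vec_seq_def)
    moreover have "x \<in> carrier (H_sum r)"
      by (simp add: x_def H_sum_def H_group_def)
    ultimately show "cs \<in> coords ws ` carrier G" using cs carrier by blast
  qed (use carrier in blast)
  have "isometric (G Mod form_radical G (q_form ns)) (\<lambda>c. the_elem (q_form ns ` c))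
      (cycle_group s Mod form_radical (cycle_group s) (q_seq s)) (\<lambda>c. the_elem (q_seq s ` c))"
  proof (rule isometric_quotient[OF G comm_group_cycle_group])
    show "\<theta> \<circ> coords ws \<in> hom G (cycle_group s)"
    proof (rule homI)
      fix x y assume "x \<in> carrier G" "y \<in> carrier G"
      then show "(\<theta> \<circ> coords ws) (x \<otimes>\<^bsub>G\<^esub> y) = (\<theta> \<circ> coords ws) x \<otimes>\<^bsub>cycle_group s\<^esub> (\<theta> \<circ> coords ws) y"
        using \<theta>(2) carrier by (simp add: G_def coords_mult cycle_group_def)
    qed (use carrier bij_betwE[OF \<theta>(1)] in \<open>simp add: cycle_group_def\<close>)
    show "(\<theta> \<circ> coords ws) ` carrier G = carrier (cycle_group s)"
      using bij_betw_imp_surj_on[OF \<theta>(1)] unfolding image_comp[symmetric] onto by (simp add: cycle_group_def)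
    show "q_seq s ((\<theta> \<circ> coords ws) x) = q_form ns x" if "x \<in> carrier G" for x
      using that carrier \<theta>(3) by (simp add: ns_def q_coords)
  qed
  then show "isometric (transcendental_lattice (factor ws)) (transcendental_form (factor ws))
      (cycle_group s Mod form_radical (cycle_group s) (q_seq s)) (\<lambda>c. the_elem (q_seq s ` c))"
    unfolding lat form .
  interpret N: normal "form_radical G (q_form ns)" G
    using comm_group.form_radical_normal[OF G] .
  show "group (transcendental_lattice (factor ws))"
    unfolding lat by (rule N.factorgroup_is_group)
qed

lemma isometric_skeletons:
  assumes "t \<noteq> Leaf" "t' \<noteq> Leaf" "leaves t = leaves t'"
  shows "isometric (transcendental_lattice (factor (map ((@) u) (skeleton t))))
      (transcendental_form (factor (map ((@) u) (skeleton t))))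
      (transcendental_lattice (factor (map ((@) u') (skeleton t'))))
      (transcendental_form (factor (map ((@) u') (skeleton t'))))"
proof -
  have "lat_equiv (vec_seq (map ((@) u) (skeleton t))) (skeleton_normal (leaves t))"
    if "t \<noteq> Leaf" for u t
    unfolding vec_seq_prefix
    using lat_equiv_trans[OF lat_equiv_act(2)[OF modmat_in] lat_equiv_skeleton[OF that]] .
  note target = isometric_cycle_group[OF this]
  show ?thesis
    using isometric_common_target[OF target(2)[OF assms(1)] target(2)[OF assms(2)]
        target(1)[OF assms(1)] target(1)[OF assms(2), folded assms(3)]] .
qed

section \<open>Presented groups\<close>

declare word_eq_trans [trans]

lemma word_eq_mult_left: "word_eq R u v \<Longrightarrow> word_eq R (w @ u) (w @ v)"
  and word_eq_mult_right: "word_eq R u v \<Longrightarrow> word_eq R (u @ w) (v @ w)"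
  by (auto intro: word_eq_append word_eq_refl)

lemma word_class_eq_iff: "word_class R u = word_class R v \<longleftrightarrow> word_eq R u v"
proof
  assume "word_class R u = word_class R v"
  then have "v \<in> word_class R u" using word_eq_refl[of R v] by (simp add: word_class_def)
  then show "word_eq R u v" by (simp add: word_class_def)
next
  assume "word_eq R u v"
  then have "word_eq R u w \<longleftrightarrow> word_eq R v w" for w
    using word_eq_trans word_eq_sym by metis
  then show "word_class R u = word_class R v" by (simp add: word_class_def)
qed

lemma inv_word_simps [simp]:
  "inv_word [] = []" "inv_word (u @ v) = inv_word v @ inv_word u"
  "inv_word ((x, e) # u) = inv_word u @ [(x, \<not> e)]" "inv_word (inv_word u) = u"
  by (auto simp: inv_word_def rev_map comp_def case_prod_beta)

lemma word_eq_inv_right: "word_eq R (u @ inv_word u) []"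
proof (induction u)
  case (Cons a u)
  obtain x e where a: "a = (x, e)" by fastforce
  have "word_eq R ([a] @ (u @ inv_word u) @ [(x, \<not> e)]) ([a] @ [] @ [(x, \<not> e)])"
    by (intro word_eq_append word_eq_refl Cons)
  also have "word_eq R ([a] @ [] @ [(x, \<not> e)]) []"
    using word_eq_cancel by (simp add: a)
  finally show ?case by (simp add: a)
qed (simp add: word_eq_refl)

lemma word_eq_inv_left: "word_eq R (inv_word u @ u) []"
  using word_eq_inv_right[of R "inv_word u"] by simp

lemma word_eq_cancel_left:
  assumes "word_eq R (w @ u) (w @ v)"
  shows "word_eq R u v"
proof -
  have *: "word_eq R (inv_word w @ w @ x) x" for x
    using word_eq_mult_right[OF word_eq_inv_left[of R w], of x] by simp
  have "word_eq R u (inv_word w @ w @ u)" using word_eq_sym[OF *] .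
  also have "word_eq R (inv_word w @ w @ u) (inv_word w @ w @ v)"
    using assms by (rule word_eq_mult_left)
  also have "word_eq R (inv_word w @ w @ v) v" by (rule *)
  finally show ?thesis .
qed

lemma word_eq_cancel_mid: "word_eq R (u @ w @ inv_word w @ v) (u @ v)"
    "word_eq R (u @ inv_word w @ w @ v) (u @ v)"
  using word_eq_append[OF word_eq_refl[of R u] word_eq_append[OF word_eq_inv_right[of R w] word_eq_refl[of R v]]]
    word_eq_append[OF word_eq_refl[of R u] word_eq_append[OF word_eq_inv_left[of R w] word_eq_refl[of R v]]]
  by simp_all

lemma word_eq_inv_word:
  assumes "word_eq R u v"
  shows "word_eq R (inv_word u) (inv_word v)"
proof -
  have "word_eq R (inv_word u) (inv_word u @ v @ inv_word v @ [])"
    using word_eq_sym[OF word_eq_cancel_mid(1)[of R "inv_word u" v "[]"]] by simp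
  also have "word_eq R (inv_word u @ v @ inv_word v @ []) (inv_word u @ u @ inv_word v)"
    using word_eq_append[OF word_eq_refl[of R "inv_word u"]
        word_eq_append[OF word_eq_sym[OF assms] word_eq_refl[of R "inv_word v"]]] by simp
  also have "word_eq R (inv_word u @ u @ inv_word v) (inv_word v)"
    using word_eq_cancel_mid(2)[of R "[]" u "inv_word v"] by simp
  finally show ?thesis .
qed

lemma presented_mult:
  "word_class R u \<otimes>\<^bsub>presented_group R\<^esub> word_class R v = word_class R (u @ v)"
proof -
  have "word_class R (u' @ v') = word_class R (u @ v)"
    if "u' \<in> word_class R u" "v' \<in> word_class R v" for u' v'
  proof -
    have "word_eq R (u @ v) (u' @ v')"
      using that by (auto simp: word_class_def intro: word_eq_append)
    then show ?thesis by (simp add: word_class_eq_iff word_eq_sym)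
  qed
  moreover have "u \<in> word_class R u" "v \<in> word_class R v"
    by (simp_all add: word_class_def word_eq_refl)
  ultimately have "(\<Union>u'\<in>word_class R u. \<Union>v'\<in>word_class R v. word_class R (u' @ v')) = word_class R (u @ v)"
    by blast
  then show ?thesis by (simp add: presented_group_def)
qed

lemma presented_carrier: "carrier (presented_group R) = range (word_class R)"
  and presented_one: "\<one>\<^bsub>presented_group R\<^esub> = word_class R []"
  by (simp_all add: presented_group_def)

lemma group_presented: "group (presented_group R)"
proof (rule groupI)
  fix x assume "x \<in> carrier (presented_group R)"
  then obtain u where u: "x = word_class R u" by (auto simp: presented_carrier)
  show "\<one>\<^bsub>presented_group R\<^esub> \<otimes>\<^bsub>presented_group R\<^esub> x = x"
    by (simp add: u presented_one presented_mult)
  show "\<exists>y\<in>carrier (presented_group R). y \<otimes>\<^bsub>presented_group R\<^esub> x = \<one>\<^bsub>presented_group R\<^esub>"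
    by (rule bexI[of _ "word_class R (inv_word u)"])
       (simp_all add: u presented_one presented_mult presented_carrier word_class_eq_iff word_eq_inv_left rangeI)
qed (auto simp: presented_carrier presented_one presented_mult)

lemma presented_inv: "inv\<^bsub>presented_group R\<^esub> (word_class R u) = word_class R (inv_word u)"
  by (rule group.inv_equality[OF group_presented])
     (simp_all add: presented_one presented_mult presented_carrier word_class_eq_iff word_eq_inv_left rangeI)

text \<open>To map a presented group to another one by a map of words, it suffices to check cancellation and the
  relations.\<close>

lemma word_eq_hom:
  assumes "word_eq R u v"
    and "h [] = []" "\<And>u v. h (u @ v) = h u @ h v"
    and "\<And>x e. word_eq S (h [(x, e), (x, \<not> e)]) []"
    and "\<And>u v. (u, v) \<in> R \<Longrightarrow> word_eq S (h u) (h v)"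
  shows "word_eq S (h u) (h v)"
  using assms(1)
proof (induction rule: word_eq.induct)
  case (word_eq_refl u)
  then show ?case by (rule word_eq.word_eq_refl)
next
  case (word_eq_sym u v)
  then show ?case by (blast intro: word_eq.word_eq_sym)
next
  case (word_eq_trans u v w)
  then show ?case by (blast intro: word_eq.word_eq_trans)
next
  case (word_eq_append u u' v v')
  then show ?case by (simp add: assms(3) word_eq.word_eq_append)
qed (simp_all add: assms)

lemma word_eq_mono: "word_eq R u v \<Longrightarrow> R \<subseteq> S \<Longrightarrow> word_eq S u v"
  by (rule word_eq_hom[where h = id, simplified]) (auto intro: word_eq_cancel word_eq_relation)

text \<open>The exponent sum is an invariant of the presented group if the relations are homogeneous, as the braid
  relation and the relations of the fundamental group are.\<close>

definition exponent :: "'x word \<Rightarrow> int" where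
  "exponent w = (\<Sum>(x, e)\<leftarrow>w. if e then 1 else - 1)"

lemma exponent_simps [simp]: "exponent [] = 0" "exponent (u @ v) = exponent u + exponent v"
  "exponent ((x, e) # u) = (if e then 1 else - 1) + exponent u"
  by (simp_all add: exponent_def)

lemma exponent_inv [simp]: "exponent (inv_word u) = - exponent u"
  by (induction u) auto

lemma word_eq_exponent:
  assumes "word_eq R u v" "\<And>u v. (u, v) \<in> R \<Longrightarrow> exponent u = exponent v"
  shows "exponent u = exponent v"
  using assms(1) by (induction rule: word_eq.induct) (simp_all add: assms(2))

lemma eval_word_group:
  assumes "group G" "\<And>x. f x \<in> carrier G"
  shows "eval_word G f u \<in> carrier G"
    and "eval_word G f (u @ v) = eval_word G f u \<otimes>\<^bsub>G\<^esub> eval_word G f v"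
proof -
  interpret group G by fact
  have c: "eval_word G f u \<in> carrier G" for u
    by (induction u) (auto simp: eval_word_def assms(2))
  then show "eval_word G f u \<in> carrier G" .
  show "eval_word G f (u @ v) = eval_word G f u \<otimes>\<^bsub>G\<^esub> eval_word G f v"
    using c by (induction u) (auto simp: eval_word_def assms(2) m_assoc)
qed

lemma word_eq_eval:
  assumes "word_eq R u v" "group G" "\<And>x. f x \<in> carrier G"
    and "\<And>u v. (u, v) \<in> R \<Longrightarrow> eval_word G f u = eval_word G f v"
  shows "eval_word G f u = eval_word G f v"
  using assms(1)
proof (induction rule: word_eq.induct)
  case (word_eq_append u u' v v')
  then show ?case by (simp add: eval_word_group(2)[OF assms(2,3)])
next
  case (word_eq_cancel x e)
  show ?case using group.r_inv[OF assms(2,3)] group.l_inv[OF assms(2,3)] assms(2,3)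
    by (simp add: eval_word_def group.is_monoid)
qed (simp_all add: assms(4))

text \<open>Equality of concrete words in the free group is proved by computing free reductions.\<close>

fun push :: "'x \<times> bool \<Rightarrow> 'x word \<Rightarrow> 'x word" where
  "push a [] = [a]"
| "push a (b # w) = (if fst a = fst b \<and> snd a \<noteq> snd b then w else a # b # w)"

definition reduce :: "'x word \<Rightarrow> 'x word" where
  "reduce w = foldr push w []"

lemma word_eq_push: "word_eq R (push a w) (a # w)"
proof (cases w)
  case (Cons b v)
  show ?thesis
  proof (cases "fst a = fst b \<and> snd a \<noteq> snd b")
    case True
    then have "b = (fst a, \<not> snd a)" by (cases b) auto
    then have "word_eq R ([a, b] @ v) ([] @ v)"
      using word_eq_mult_right[OF word_eq_cancel[of R "fst a" "snd a"], of v] by simp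
    from word_eq_sym[OF this] show ?thesis using True Cons by simp
  next
    case False
    then have "push a w = a # w" using Cons by auto
    then show ?thesis by (simp add: word_eq_refl)
  qed
qed (simp add: word_eq_refl)

lemma word_eq_reduce: "word_eq R (reduce w) w"
proof (induction w)
  case (Cons a w)
  have "word_eq R (reduce (a # w)) (a # reduce w)"
    using word_eq_push by (simp add: reduce_def)
  also have "word_eq R (a # reduce w) (a # w)"
    using word_eq_mult_left[OF Cons, of "[a]"] by simp
  finally show ?case .
qed (simp add: reduce_def word_eq_refl)

lemma word_eq_reduceI: "reduce u = reduce v \<Longrightarrow> word_eq R u v"
  using word_eq_trans[OF word_eq_sym[OF word_eq_reduce[of R u]]] word_eq_reduce[of R v] by simp

section \<open>Braids on three strands\<close>

abbreviation braid_eq :: "braid_gen word \<Rightarrow> braid_gen word \<Rightarrow> bool" where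
  "braid_eq \<equiv> word_eq braid_rels"

abbreviation s1 :: "braid_gen \<times> bool" where "s1 \<equiv> (Sigma1, True)"
abbreviation s2 :: "braid_gen \<times> bool" where "s2 \<equiv> (Sigma2, True)"

lemma braid_relation: "braid_eq (u @ [s1, s2, s1] @ v) (u @ [s2, s1, s2] @ v)"
  by (intro word_eq_append word_eq_refl word_eq_relation) (simp add: braid_rels_def)

definition full_twist :: "braid_gen word" where
  "full_twist = [s1, s2, s1, s1, s2, s1]"

text \<open>The half twist \<open>\<Delta> = \<sigma>\<^sub>1 \<sigma>\<^sub>2 \<sigma>\<^sub>1\<close> exchanges \<open>\<sigma>\<^sub>1\<close> and \<open>\<sigma>\<^sub>2\<close> by conjugation, so its square is central.\<close>

lemma full_twist_central: "braid_eq (full_twist @ w) (w @ full_twist)"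
proof -
  have 1: "braid_eq (full_twist @ [s1]) ([s1] @ full_twist)"
  proof -
    have "braid_eq (full_twist @ [s1]) [s1, s2, s1, s2, s1, s2, s1]"
      using braid_relation[of "[s1, s2, s1]" "[s1]"] by (simp add: full_twist_def)
    also have "braid_eq [s1, s2, s1, s2, s1, s2, s1] ([s1] @ full_twist)"
      using word_eq_sym[OF braid_relation[of "[s1]" "[s1, s2, s1]"]] by (simp add: full_twist_def)
    finally show ?thesis .
  qed
  have 2: "braid_eq (full_twist @ [s2]) ([s2] @ full_twist)"
  proof -
    have "braid_eq (full_twist @ [s2]) [s1, s2, s1, s1, s1, s2, s1]"
      using word_eq_sym[OF braid_relation[of "[s1, s2, s1, s1]" "[]"]] by (simp add: full_twist_def)
    also have "braid_eq [s1, s2, s1, s1, s1, s2, s1] [s2, s1, s2, s1, s1, s2, s1]"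
      using braid_relation[of "[]" "[s1, s1, s2, s1]"] by simp
    finally show ?thesis by (simp add: full_twist_def)
  qed
  have inv: "braid_eq (full_twist @ [(x, False)]) ([(x, False)] @ full_twist)"
    if x: "braid_eq (full_twist @ [(x, True)]) ([(x, True)] @ full_twist)" for x
  proof -
    have "braid_eq ([(x, True)] @ full_twist @ [(x, False)]) (full_twist @ [(x, True)] @ [(x, False)])"
      using word_eq_mult_right[OF word_eq_sym[OF x], of "[(x, False)]"] by simp
    also have "braid_eq (full_twist @ [(x, True)] @ [(x, False)]) full_twist"
      using word_eq_cancel_mid(1)[of braid_rels full_twist "[(x, True)]" "[]"] by simp
    also have "braid_eq full_twist ([(x, True)] @ [(x, False)] @ full_twist)"
      using word_eq_sym[OF word_eq_cancel_mid(1)[of braid_rels "[]" "[(x, True)]" full_twist]] by simp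
    finally show ?thesis by (rule word_eq_cancel_left)
  qed
  have letter: "braid_eq (full_twist @ [a]) ([a] @ full_twist)" for a
    using 1 2 inv[OF 1] inv[OF 2] by (cases a; cases "fst a"; cases "snd a") auto
  show ?thesis
  proof (induction w)
    case (Cons a w)
    have "braid_eq (full_twist @ [a] @ w) ([a] @ full_twist @ w)"
      using word_eq_mult_right[OF letter, of a w] by simp
    also have "braid_eq ([a] @ full_twist @ w) ([a] @ w @ full_twist)"
      using Cons by (rule word_eq_mult_left)
    finally show ?case by simp
  qed (simp add: word_eq_refl)
qed

primrec twists :: "nat \<Rightarrow> braid_gen word" where
  "twists 0 = []"
| "twists (Suc n) = full_twist @ twists n"

lemma twists_add: "twists (m + n) = twists m @ twists n"
  by (induction m) simp_all

lemma twists_central: "braid_eq (twists n @ w) (w @ twists n)"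
proof (induction n)
  case (Suc n)
  have "braid_eq (full_twist @ twists n @ w) (full_twist @ w @ twists n)"
    using Suc by (rule word_eq_mult_left)
  also have "braid_eq (full_twist @ w @ twists n) (w @ full_twist @ twists n)"
    using word_eq_mult_right[OF full_twist_central[of w], of "twists n"] by simp
  finally show ?case by simp
qed (simp add: word_eq_refl)

lemma exponent_twists: "exponent (twists n) = 6 * int n"
  by (induction n) (simp_all add: full_twist_def)

text \<open>Lifts of the generators, \<open>X \<mapsto> (\<sigma>\<^sub>2 \<sigma>\<^sub>1)\<^sup>-\<^sup>1\<close> and \<open>Y \<mapsto> \<sigma>\<^sub>2 \<sigma>\<^sub>1\<^sup>2\<close>, chosen so that \<open>XY\<close> lifts to \<open>\<sigma>\<^sub>1\<close> itself and
  \<open>X\<^sup>3\<close>, \<open>Y\<^sup>2\<close> lift to \<open>\<Delta>\<^sup>-\<^sup>2\<close>, \<open>\<Delta>\<^sup>2\<close>.\<close>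

primrec lift_gen :: "modgen \<Rightarrow> braid_gen word" where
  "lift_gen GX = inv_word [s2, s1]"
| "lift_gen GY = [s2, s1, s1]"

definition lift_word :: "modgen list \<Rightarrow> braid_gen word" where
  "lift_word w = concat (map lift_gen w)"

lemma lift_word_simps [simp]: "lift_word [] = []" "lift_word (c # w) = lift_gen c @ lift_word w"
  "lift_word (u @ v) = lift_word u @ lift_word v"
  by (simp_all add: lift_word_def)

lemma lift_XXX: "braid_eq (full_twist @ lift_word [GX, GX, GX]) []"
proof -
  have "braid_eq ([] @ full_twist @ lift_word [GX, GX, GX]) ([] @ [s2, s1, s2, s1, s2, s1] @ lift_word [GX, GX, GX])"
    using braid_relation[of "[]" "[s1, s2, s1] @ lift_word [GX, GX, GX]"]
    by (simp add: full_twist_def)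
  also have "braid_eq ([] @ [s2, s1, s2, s1, s2, s1] @ lift_word [GX, GX, GX]) []"
    using word_eq_inv_right[of braid_rels "[s2, s1, s2, s1, s2, s1]"] by simp
  finally show ?thesis by simp
qed

lemma lift_YY: "braid_eq (lift_word [GY, GY]) full_twist"
proof -
  have "braid_eq (lift_word [GY, GY]) [s2, s1, s2, s1, s2, s1]"
    using braid_relation[of "[s2, s1]" "[s1]"] by simp
  also have "braid_eq [s2, s1, s2, s1, s2, s1] full_twist"
    using word_eq_sym[OF braid_relation[of "[]" "[s1, s2, s1]"]] by (simp add: full_twist_def)
  finally show ?thesis .
qed

lemma lift_letters:
  "braid_eq [s1] (lift_word [GX, GY])"
  "braid_eq [(Sigma1, False)] (lift_word [GY, GX, GX])"
  "braid_eq [s2] (full_twist @ lift_word [GX, GX, GY, GX, GX])"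
  "braid_eq [(Sigma2, False)] (lift_word [GX, GY, GX])"
proof -
  show "braid_eq [s1] (lift_word [GX, GY])" "braid_eq [(Sigma2, False)] (lift_word [GX, GY, GX])"
    by (rule word_eq_reduceI, simp add: reduce_def)+
  have i1: "braid_eq (lift_word [GY, GX, GX]) [(Sigma1, False)]"
  proof -
    have "braid_eq (lift_word [GY, GX, GX]) ([(Sigma1, False)] @ [s1, s2, s1] @ [s1] @ inv_word [s2, s1, s2, s1])"
      by (rule word_eq_reduceI) (simp add: reduce_def)
    also have "braid_eq ([(Sigma1, False)] @ [s1, s2, s1] @ [s1] @ inv_word [s2, s1, s2, s1])
        ([(Sigma1, False)] @ [s2, s1, s2] @ [s1] @ inv_word [s2, s1, s2, s1])"
      by (rule braid_relation)
    also have "braid_eq ([(Sigma1, False)] @ [s2, s1, s2] @ [s1] @ inv_word [s2, s1, s2, s1]) [(Sigma1, False)]"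
      by (rule word_eq_reduceI) (simp add: reduce_def)
    finally show ?thesis .
  qed
  then show "braid_eq [(Sigma1, False)] (lift_word [GY, GX, GX])" by (rule word_eq_sym)
  have "braid_eq (full_twist @ lift_word [GX, GX, GY, GX, GX])
      ([s2, s1, s2, s1, s2, s1] @ lift_word [GX, GX] @ lift_word [GY, GX, GX])"
    using braid_relation[of "[]" "[s1, s2, s1] @ lift_word [GX, GX, GY, GX, GX]"]
    by (simp add: full_twist_def)
  also have "braid_eq ([s2, s1, s2, s1, s2, s1] @ lift_word [GX, GX] @ lift_word [GY, GX, GX])
      ([s2, s1, s2, s1, s2, s1] @ lift_word [GX, GX] @ [(Sigma1, False)])"
    by (intro word_eq_mult_left i1)
  also have "braid_eq ([s2, s1, s2, s1, s2, s1] @ lift_word [GX, GX] @ [(Sigma1, False)]) [s2]"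
    by (rule word_eq_reduceI) (simp add: reduce_def)
  finally show "braid_eq [s2] (full_twist @ lift_word [GX, GX, GY, GX, GX])" by (rule word_eq_sym)
qed

text \<open>Up to full twists every braid is a product of the lifts of \<open>X\<close> and \<open>Y\<close>; nonnegative powers suffice because
  inverses of letters are words in these lifts as well.\<close>

lemma braid_normal: "\<exists>n w. braid_eq v (twists n @ lift_word w)"
proof (induction v)
  case Nil
  show ?case using word_eq_refl by (intro exI[of _ 0] exI[of _ "[]"]) simp
next
  case (Cons a v)
  then obtain n w where v: "braid_eq v (twists n @ lift_word w)" by blast
  obtain m u where a: "braid_eq [a] (twists m @ lift_word u)"
  proof (cases a)
    case (Pair x e)
    have "\<exists>m u. braid_eq [(x, e)] (twists m @ lift_word u)"
    proof (cases x; cases e)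
      assume "x = Sigma1" "e"
      then show ?thesis using lift_letters(1) by (intro exI[of _ 0] exI[of _ "[GX, GY]"]) simp
    next
      assume "x = Sigma1" "\<not> e"
      then show ?thesis using lift_letters(2) by (intro exI[of _ 0] exI[of _ "[GY, GX, GX]"]) simp
    next
      assume "x = Sigma2" "e"
      then show ?thesis using lift_letters(3) by (intro exI[of _ 1] exI[of _ "[GX, GX, GY, GX, GX]"]) simp
    next
      assume "x = Sigma2" "\<not> e"
      then show ?thesis using lift_letters(4) by (intro exI[of _ 0] exI[of _ "[GX, GY, GX]"]) simp
    qed
    then show ?thesis using that Pair by blast
  qed
  have "braid_eq ([a] @ v) ((twists m @ lift_word u) @ (twists n @ lift_word w))"
    using a v by (rule word_eq_append)
  also have "braid_eq ((twists m @ lift_word u) @ (twists n @ lift_word w)) (twists m @ twists n @ lift_word u @ lift_word w)"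
    using word_eq_mult_left[OF word_eq_mult_right[OF word_eq_sym[OF twists_central[of n "lift_word u"]], of "lift_word w"], of "twists m"]
    by simp
  finally show ?case
    by (intro exI[of _ "m + n"] exI[of _ "u @ w"]) (simp add: twists_add)
qed

text \<open>Inserting a relator of the modular group into the lift changes the braid by a full twist.\<close>

lemma lift_kernel:
  assumes "modmat w = mat 1 \<or> modmat w = - mat 1"
  shows "\<exists>m n. braid_eq (twists m @ lift_word w) (twists n)"
  using assms
proof (induction w rule: modmat_kernel_induct)
  case Nil
  show ?case using word_eq_refl by (intro exI[of _ 0]) simp
next
  case (XXX u v)
  then obtain m n where mn: "braid_eq (twists m @ lift_word (u @ v)) (twists n)" by blast
  have split: "lift_word (u @ [GX, GX, GX] @ v) = lift_word u @ lift_word [GX, GX, GX] @ lift_word v"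
    by (simp only: lift_word_simps(3))
  have "braid_eq (twists (m + 1) @ lift_word (u @ [GX, GX, GX] @ v))
      (twists m @ lift_word u @ full_twist @ lift_word [GX, GX, GX] @ lift_word v)"
    unfolding split
    using word_eq_mult_right[OF full_twist_central[of "twists m @ lift_word u"], of "lift_word [GX, GX, GX] @ lift_word v"]
    by (simp only: append_assoc twists.simps Suc_eq_plus1[symmetric])
  also have "braid_eq (twists m @ lift_word u @ full_twist @ lift_word [GX, GX, GX] @ lift_word v)
      (twists m @ lift_word (u @ v))"
    using word_eq_mult_left[OF word_eq_mult_right[OF lift_XXX, of "lift_word v"], of "twists m @ lift_word u"]
    by (simp only: append_assoc append_Nil lift_word_simps(3))
  also note mn
  finally have "braid_eq (twists (m + 1) @ lift_word (u @ [GX, GX, GX] @ v)) (twists n)" .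
  then show ?case by blast
next
  case (YY u v)
  then obtain m n where mn: "braid_eq (twists m @ lift_word (u @ v)) (twists n)" by blast
  have "braid_eq (lift_word (u @ [GY, GY] @ v)) (lift_word u @ full_twist @ lift_word v)"
    using word_eq_mult_left[OF word_eq_mult_right[OF lift_YY, of "lift_word v"], of "lift_word u"] by simp
  also have "braid_eq (lift_word u @ full_twist @ lift_word v) (full_twist @ lift_word (u @ v))"
    using word_eq_mult_right[OF word_eq_sym[OF full_twist_central[of "lift_word u"]], of "lift_word v"] by simp
  finally have "braid_eq (twists m @ lift_word (u @ [GY, GY] @ v)) (twists m @ full_twist @ lift_word (u @ v))"
    by (rule word_eq_mult_left)
  also have "braid_eq (twists m @ full_twist @ lift_word (u @ v)) (full_twist @ twists m @ lift_word (u @ v))"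
    using word_eq_mult_right[OF twists_central[of m full_twist], of "lift_word (u @ v)"] by simp
  also have "braid_eq (full_twist @ twists m @ lift_word (u @ v)) (full_twist @ twists n)"
    using mn by (rule word_eq_mult_left)
  finally have "braid_eq (twists m @ lift_word (u @ [GY, GY] @ v)) (twists (n + 1))" by simp
  then show ?case by blast
qed

definition braid_mat :: "braid_gen word \<Rightarrow> int^2^2" where
  "braid_mat = eval_word SL2Z braid_gen_matrix"

lemma braid_gen_matrix_mat2: "braid_gen_matrix Sigma1 = mat2 1 1 0 1"
  "braid_gen_matrix Sigma2 = mat2 0 1 (- 1) 2"
  by (simp_all add: matX_mat2 matY_mat2 inv_SL2Z_mat2)

lemma braid_gen_matrix_in [simp]: "braid_gen_matrix x \<in> carrier SL2Z"
  by (cases x) (simp_all add: braid_gen_matrix_mat2 mat2_in del: braid_gen_matrix.simps)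

lemma braid_mat_append: "braid_mat (u @ v) = braid_mat u ** braid_mat v"
  and braid_mat_in [simp]: "braid_mat u \<in> carrier SL2Z"
  using eval_word_group[OF group_SL2Z braid_gen_matrix_in] by (simp_all add: braid_mat_def)

lemma braid_mat_simps: "braid_mat [] = mat 1" "braid_mat [s1] = mat2 1 1 0 1"
  "braid_mat [s2] = mat2 0 1 (- 1) 2" "braid_mat [(Sigma1, False)] = mat2 1 (- 1) 0 1"
  "braid_mat [(Sigma2, False)] = mat2 2 (- 1) 1 0"
  by (simp_all add: braid_mat_def eval_word_def braid_gen_matrix_mat2 inv_SL2Z_mat2 del: braid_gen_matrix.simps)

lemma braid_mat_cong:
  assumes "braid_eq u v"
  shows "braid_mat u = braid_mat v"
proof -
  have "braid_mat [s1, s2, s1] = braid_mat [s2, s1, s2]"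
    using braid_mat_append[of "[s1]" "[s2, s1]"] braid_mat_append[of "[s2]" "[s1]"]
      braid_mat_append[of "[s2]" "[s1, s2]"] braid_mat_append[of "[s1]" "[s2]"]
    by (simp add: braid_mat_simps)
  then show ?thesis
    unfolding braid_mat_def
    by (intro word_eq_eval[OF assms group_SL2Z braid_gen_matrix_in]) (auto simp: braid_rels_def)
qed

lemma braid_mat_inv: "braid_mat (inv_word u) = inv\<^bsub>SL2Z\<^esub> (braid_mat u)"
proof -
  have "braid_mat (inv_word u @ u) = braid_mat []"
    by (rule braid_mat_cong) (rule word_eq_inv_left)
  then have "braid_mat (inv_word u) ** braid_mat u = mat 1"
    by (simp add: braid_mat_append braid_mat_simps)
  then show ?thesis
    using SL2Z.inv_equality[of "braid_mat (inv_word u)" "braid_mat u"] by simp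
qed

lemma braid_mat_lift: "braid_mat (lift_word w) = modmat w \<or> braid_mat (lift_word w) = - modmat w"
proof (induction w)
  case (Cons c w)
  have "braid_mat (lift_gen GX) = - matX"
    using braid_mat_append[of "[(Sigma1, False)]" "[(Sigma2, False)]"]
    by (simp add: braid_mat_simps matX_mat2)
  moreover have "braid_mat (lift_gen GY) = - matY"
    using braid_mat_append[of "[s2]" "[s1, s1]"] braid_mat_append[of "[s1]" "[s1]"]
    by (simp add: braid_mat_simps matY_mat2)
  ultimately show ?case
    using Cons by (cases c) (auto simp: braid_mat_append modmat_Cons simp del: lift_gen.simps)
qed (simp add: braid_mat_simps)

lemma braid_mat_full_twist: "braid_mat (twists n) = mat 1 \<or> braid_mat (twists n) = - mat 1"
proof (induction n)
  case (Suc n)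
  have "braid_mat full_twist = braid_mat (lift_word [GY, GY])"
    by (rule braid_mat_cong) (rule word_eq_sym[OF lift_YY])
  then have "braid_mat full_twist = mat 1 \<or> braid_mat full_twist = - mat 1"
    using braid_mat_lift[of "[GY, GY]"] by (auto simp: modmat_YY)
  with Suc show ?case by (auto simp: braid_mat_append)
qed (simp add: braid_mat_simps)

text \<open>The kernel of the projection to the modular group is generated by the full twist, which has
  exponent sum \<open>6\<close>.  So a braid is determined by its image and its exponent sum.\<close>

lemma braid_eqI:
  assumes "to_PSL2Z (braid_mat u) = to_PSL2Z (braid_mat v)" "exponent u = exponent v"
  shows "braid_eq u v"
proof -
  let ?v = "u @ inv_word v"
  have bm: "braid_mat ?v = mat 1 \<or> braid_mat ?v = - mat 1"
    using assms(1) SL2Z.r_inv[OF braid_mat_in[of v]]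
    by (auto simp: to_PSL2Z_eq_iff braid_mat_append braid_mat_inv)
  obtain n w where nw: "braid_eq ?v (twists n @ lift_word w)" using braid_normal by blast
  have "braid_mat ?v = braid_mat (twists n) ** braid_mat (lift_word w)"
    unfolding braid_mat_append[symmetric] by (rule braid_mat_cong[OF nw])
  with braid_mat_lift[of w] braid_mat_full_twist[of n]
  have "braid_mat ?v = modmat w \<or> braid_mat ?v = - modmat w"
    by (elim disjE) simp_all
  with bm have "modmat w = mat 1 \<or> modmat w = - mat 1"
    by (elim disjE) (simp_all add: equation_minus_iff)
  then obtain m k where mk: "braid_eq (twists m @ lift_word w) (twists k)" using lift_kernel by blast
  have "braid_eq (twists m @ ?v) (twists m @ twists n @ lift_word w)"
    using nw by (rule word_eq_mult_left)
  also have "braid_eq (twists m @ twists n @ lift_word w) (twists n @ twists m @ lift_word w)"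
    using word_eq_mult_right[OF twists_central[of m "twists n"], of "lift_word w"] by simp
  also have "braid_eq (twists n @ twists m @ lift_word w) (twists n @ twists k)"
    using mk by (rule word_eq_mult_left)
  finally have t: "braid_eq (twists m @ ?v) (twists (n + k))" by (simp add: twists_add)
  have "exponent (twists m @ ?v) = exponent (twists (n + k))"
    using t by (rule word_eq_exponent) (auto simp: braid_rels_def)
  then have "m = n + k" using assms(2) by (simp add: exponent_twists)
  then have "braid_eq (twists m @ ?v) (twists m @ [])" using t by simp
  then have "braid_eq ?v []" by (rule word_eq_cancel_left)
  then have "braid_eq (?v @ v) ([] @ v)" by (rule word_eq_mult_right)
  moreover have "braid_eq u (?v @ v)"
    using word_eq_sym[OF word_eq_cancel_mid(2)[of braid_rels u v "[]"]] by simp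
  ultimately show ?thesis using word_eq_trans by fastforce
qed

text \<open>The lift to the braid group of the factor attached to a word.\<close>

definition half_twist :: "modgen list \<Rightarrow> braid_gen word" where
  "half_twist w = lift_word w @ [s1] @ inv_word (lift_word w)"

lemma braid_mat_half_twist: "to_PSL2Z (braid_mat (half_twist w)) = to_PSL2Z (twist w)"
proof -
  have XY: "matX ** matY = mat2 1 1 0 1" by (simp add: matX_mat2 matY_mat2)
  have "braid_mat (half_twist w) = braid_mat (lift_word w) ** (mat2 1 1 0 1 ** inv\<^bsub>SL2Z\<^esub> (braid_mat (lift_word w)))"
    unfolding half_twist_def braid_mat_append braid_mat_simps braid_mat_inv ..
  with braid_mat_lift[of w] have "braid_mat (half_twist w) = twist w"
    unfolding twist_def XY by (elim disjE) (simp_all add: inv_minus_SL2Z matrix_mul_assoc)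
  then show ?thesis by simp
qed

lemma exponent_half_twist: "exponent (half_twist w) = 1"
  by (simp add: half_twist_def)

lemma half_twist_cong: "to_PSL2Z (twist w) = to_PSL2Z (twist w') \<Longrightarrow> braid_eq (half_twist w) (half_twist w')"
  by (rule braid_eqI) (simp_all add: braid_mat_half_twist exponent_half_twist)

lemma B3_to_SL2Z_class: "B3_to_SL2Z (word_class braid_rels u) = braid_mat u"
proof -
  have "braid_mat ` word_class braid_rels u = {braid_mat u}"
    using braid_mat_cong word_eq_refl by (fastforce simp: word_class_def)
  then show ?thesis by (simp add: B3_to_SL2Z_def braid_mat_def)
qed

text \<open>All conjugates of \<open>\<sigma>\<^sub>1\<close> have exponent sum \<open>1\<close>, so the image in \<open>PSL2Z\<close> determines them.\<close>

lemma lift_B3_factor: "lift_B3 (factor ws) = map (\<lambda>w. word_class braid_rels (half_twist w)) ws"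
  unfolding lift_B3_def
proof (rule the_equality)
  have "conjugate_in B3 sigma1 (word_class braid_rels (half_twist w))" for w
    unfolding conjugate_in_def
    by (rule bexI[of _ "word_class braid_rels (lift_word w)"])
       (simp_all add: B3_def sigma1_def presented_mult presented_inv presented_carrier half_twist_def)
  then show "simple_B3 (map (\<lambda>w. word_class braid_rels (half_twist w)) ws) \<and>
      map (to_PSL2Z \<circ> B3_to_SL2Z) (map (\<lambda>w. word_class braid_rels (half_twist w)) ws) = factor ws"
    by (simp add: all_conjugate_def factor_def B3_to_SL2Z_class braid_mat_half_twist)
next
  fix bs assume bs: "simple_B3 bs \<and> map (to_PSL2Z \<circ> B3_to_SL2Z) bs = factor ws"
  then have len: "length bs = length ws" by (metis factor_def length_map)
  show "bs = map (\<lambda>w. word_class braid_rels (half_twist w)) ws"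
  proof (rule nth_equalityI)
    fix i assume i: "i < length bs"
    then have "conjugate_in B3 sigma1 (bs ! i)" using bs by (simp add: all_conjugate_def)
    then obtain g where g: "bs ! i = word_class braid_rels (g @ [s1] @ inv_word g)"
      unfolding conjugate_in_def B3_def
      by (auto simp: sigma1_def presented_mult presented_inv presented_carrier)
    have "(to_PSL2Z \<circ> B3_to_SL2Z) (bs ! i) = factor ws ! i"
      using bs i by (metis nth_map)
    then have "to_PSL2Z (braid_mat (g @ [s1] @ inv_word g)) = to_PSL2Z (braid_mat (half_twist (ws ! i)))"
      using i len by (simp add: g B3_to_SL2Z_class braid_mat_half_twist factor_def)
    then have "braid_eq (g @ [s1] @ inv_word g) (half_twist (ws ! i))"
      by (rule braid_eqI) (simp add: exponent_half_twist)
    then show "bs ! i = map (\<lambda>w. word_class braid_rels (half_twist w)) ws ! i"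
      using i len by (simp add: g word_class_eq_iff)
  qed (simp add: len)
qed

section \<open>The fundamental group\<close>

subsection \<open>The Artin action\<close>

lemma subst_word_simps [simp]: "subst_word f [] = []"
  "subst_word f (u @ v) = subst_word f u @ subst_word f v"
  "subst_word f ((x, e) # u) = (if e then f x else inv_word (f x)) @ subst_word f u"
  by (simp_all add: subst_word_def)

lemma subst_word_inv: "subst_word f (inv_word u) = inv_word (subst_word f u)"
  by (induction u) auto

lemma artin_simps [simp]: "artin [] u = u" "artin (v @ w) u = artin v (artin w u)"
  "artin (s # w) u = subst_word (artin_gen s) (artin w u)"
  by (simp_all add: artin_def)

lemma artin_hom [simp]: "artin w [] = []" "artin w (u @ v) = artin w u @ artin w v"
  "artin w (inv_word u) = inv_word (artin w u)"
  by (induction w) (simp_all add: subst_word_inv)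

lemma artin_Cons: "artin w ((x, e) # u) = (if e then artin w [(x, True)] else inv_word (artin w [(x, True)])) @ artin w u"
  using artin_hom(2)[of w "[(x, e)]" u] artin_hom(3)[of w "[(x, True)]"] by (cases e) simp_all

lemma artin_cong:
  assumes "word_eq {} u v"
  shows "word_eq R (artin w u) (artin w v)"
  using assms
proof (rule word_eq_hom[where h = "artin w"])
  fix x e
  show "word_eq R (artin w [(x, e), (x, \<not> e)]) []"
    unfolding artin_Cons[of w x e] artin_Cons[of w x "\<not> e"]
    using word_eq_inv_right[of R "artin w [(x, True)]"] word_eq_inv_left[of R "artin w [(x, True)]"]
    by (cases e) simp_all
qed simp_all

lemma artin_eqI:
  assumes "\<And>x. word_eq R (artin v [(x, True)]) (artin w [(x, True)])"
  shows "word_eq R (artin v u) (artin w u)"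
proof (induction u)
  case (Cons a u)
  obtain x e where a: "a = (x, e)" by fastforce
  show ?case
    unfolding a artin_Cons[of _ x e]
    using assms[of x] word_eq_inv_word[OF assms[of x]] Cons by (cases e) (auto intro: word_eq_append)
qed (simp add: word_eq_refl)

text \<open>The braid relation and the cancellations are checked on the three generators of the free group.\<close>

lemma artin_braid_eq: "braid_eq v w \<Longrightarrow> word_eq R (artin v u) (artin w u)"
proof -
  have "braid_eq v w \<Longrightarrow> word_eq {} (artin v u) (artin w u)" for u
  proof (induction arbitrary: u rule: word_eq.induct)
    case (word_eq_sym u v)
    then show ?case by (blast intro: word_eq.word_eq_sym)
  next
    case (word_eq_trans u v w)
    then show ?case by (blast intro: word_eq.word_eq_trans)
  next
    case (word_eq_append v v' w w')
    have "word_eq {} (artin v (artin w u)) (artin v (artin w' u))"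
      by (rule artin_cong) (rule word_eq_append)
    also have "word_eq {} (artin v (artin w' u)) (artin v' (artin w' u))"
      by (rule word_eq_append)
    finally show ?case by simp
  next
    case (word_eq_cancel x e)
    have "word_eq {} (artin [(x, e), (x, \<not> e)] [(y, True)]) (artin [] [(y, True)])" for y
      by (rule word_eq_reduceI) (cases x; cases e; cases y; simp add: reduce_def)
    then show ?case by (rule artin_eqI)
  next
    case (word_eq_relation v w)
    then have "v = [s1, s2, s1]" "w = [s2, s1, s2]" by (simp_all add: braid_rels_def)
    then have "word_eq {} (artin v [(y, True)]) (artin w [(y, True)])" for y
      by (intro word_eq_reduceI) (cases y; simp add: reduce_def)
    then show ?case by (rule artin_eqI)
  qed (rule word_eq.word_eq_refl)
  then show "braid_eq v w \<Longrightarrow> word_eq R (artin v u) (artin w u)"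
    using word_eq_mono by blast
qed

lemma artin_cancel: "word_eq R (artin w (artin (inv_word w) u)) u" "word_eq R (artin (inv_word w) (artin w u)) u"
  using artin_braid_eq[OF word_eq_inv_right[of _ w], of R u] artin_braid_eq[OF word_eq_inv_left[of _ w], of R u]
  by simp_all

lemma exponent_artin: "exponent (artin w u) = exponent u"
proof -
  have g: "exponent (artin_gen s x) = 1" for s x
    by (cases "(s, x)" rule: artin_gen.cases) simp_all
  have "exponent (subst_word (artin_gen s) u) = exponent u" for s u
    by (induction u) (auto simp: g)
  then show ?thesis by (induction w) simp_all
qed

text \<open>The Artin action with free reduction at every step, which keeps concrete words short.\<close>

definition artin_reduced :: "braid_gen word \<Rightarrow> free_gen word \<Rightarrow> free_gen word" where
  "artin_reduced w u = foldr (\<lambda>s u. reduce (subst_word (artin_gen s) u)) w u"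

lemma artin_reduced_eq: "word_eq R (artin_reduced w u) (artin w u)"
proof -
  have "word_eq {} (artin_reduced w u) (artin w u)"
  proof (induction w)
    case (Cons s w)
    have "word_eq {} (artin_reduced (s # w) u) (artin [s] (artin_reduced w u))"
      using word_eq_reduce by (simp add: artin_reduced_def)
    also have "word_eq {} (artin [s] (artin_reduced w u)) (artin [s] (artin w u))"
      by (rule artin_cong) (rule Cons)
    finally show ?case by simp
  qed (simp add: artin_reduced_def word_eq_refl)
  then show ?thesis by (rule word_eq_mono) simp
qed

subsection \<open>Presentations\<close>

definition pi_rels :: "modgen list list \<Rightarrow> (free_gen word \<times> free_gen word) set" where
  "pi_rels ws = {(artin v [(x, True)], [(x, True)]) | w v x. w \<in> set ws \<and> braid_eq (half_twist w) v}"

lemma fundamental_group_factor: "fundamental_group (factor ws) = presented_group (pi_rels ws)"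
proof -
  have "{(artin w [(x, True)], [(x, True)]) | b w x. b \<in> set (lift_B3 (factor ws)) \<and> w \<in> b} = pi_rels ws"
    unfolding lift_B3_factor pi_rels_def by (auto simp: word_class_def)
  then show ?thesis unfolding fundamental_group_def by (rule arg_cong)
qed

lemma pi_rels_trivial:
  assumes "w \<in> set ws" "braid_eq (half_twist w) v"
  shows "word_eq (pi_rels ws) (artin v u) u"
proof -
  have "word_eq (pi_rels ws) (artin v [(x, True)]) (artin [] [(x, True)])" for x
    using assms by (auto simp: pi_rels_def intro: word_eq_relation)
  then show ?thesis using artin_eqI[of _ v "[]"] by simp
qed

text \<open>If the conjugates of the braids by \<open>g\<close> act trivially modulo \<open>R\<close>, then the action of \<open>g\<close> maps the
  fundamental group to the group presented by \<open>R\<close>.\<close>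

lemma pi_rels_hom:
  assumes "\<And>w u. w \<in> set ws \<Longrightarrow> word_eq R (artin (g @ half_twist w @ inv_word g) u) u"
    and "word_eq (pi_rels ws) u v"
  shows "word_eq R (artin g u) (artin g v)"
  using assms(2)
proof (rule word_eq_hom[where h = "artin g"])
  fix x e
  show "word_eq R (artin g [(x, e), (x, \<not> e)]) []"
    using artin_cong[OF word_eq_cancel[of "{}" x e], of R g] by simp
next
  fix u v assume "(u, v) \<in> pi_rels ws"
  then obtain w x b where b: "w \<in> set ws" "braid_eq (half_twist w) b" "u = artin b [(x, True)]" "v = [(x, True)]"
    by (auto simp: pi_rels_def)
  have "braid_eq (g @ b) ((g @ half_twist w @ inv_word g) @ g)"
  proof -
    have "braid_eq (g @ b) (g @ half_twist w)"
      using word_eq_mult_left[OF word_eq_sym[OF b(2)]] .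
    also have "braid_eq (g @ half_twist w) ((g @ half_twist w @ inv_word g) @ g)"
      using word_eq_sym[OF word_eq_cancel_mid(2)[of braid_rels "g @ half_twist w" g "[]"]] by simp
    finally show ?thesis .
  qed
  then have "word_eq R (artin (g @ b) [(x, True)]) (artin ((g @ half_twist w @ inv_word g) @ g) [(x, True)])"
    by (rule artin_braid_eq)
  also have "word_eq R (artin ((g @ half_twist w @ inv_word g) @ g) [(x, True)]) (artin g [(x, True)])"
    using assms(1)[OF b(1), of "artin g [(x, True)]"] by (simp only: artin_simps)
  finally show "word_eq R (artin g u) (artin g v)" by (simp add: b)
qed simp_all

lemma presented_iso:
  assumes "\<And>u v. word_eq R u v \<Longrightarrow> word_eq S (f u) (f v)" "\<And>u v. word_eq S u v \<Longrightarrow> word_eq R (g u) (g v)"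
    and "\<And>u v. f (u @ v) = f u @ f v" "\<And>u. word_eq R (g (f u)) u" "\<And>u. word_eq S (f (g u)) u"
  shows "presented_group R \<cong> presented_group S"
proof -
  define h where "h c = the_elem ((\<lambda>u. word_class S (f u)) ` c)" for c
  have h: "h (word_class R u) = word_class S (f u)" for u
  proof -
    have "(\<lambda>u. word_class S (f u)) ` word_class R u = {word_class S (f u)}"
    proof (intro equalityI subsetI)
      fix c assume "c \<in> (\<lambda>u. word_class S (f u)) ` word_class R u"
      then obtain v where "word_eq R u v" "c = word_class S (f v)" by (auto simp: word_class_def)
      then show "c \<in> {word_class S (f u)}"
        using word_eq_sym[OF assms(1)] by (simp add: word_class_eq_iff)
    qed (auto simp: word_class_def word_eq_refl)
    then show ?thesis by (simp add: h_def)
  qed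
  have "h \<in> iso (presented_group R) (presented_group S)"
  proof (rule isoI)
    show "h \<in> hom (presented_group R) (presented_group S)"
      by (rule homI) (auto simp: presented_carrier presented_mult h assms(3))
    show "bij_betw h (carrier (presented_group R)) (carrier (presented_group S))"
      unfolding presented_carrier
    proof (rule bij_betwI')
      fix x y assume "x \<in> range (word_class R)" "y \<in> range (word_class R)"
      then obtain u v where uv: "x = word_class R u" "y = word_class R v" by blast
      have "word_eq R u v" if "word_eq S (f u) (f v)"
        using word_eq_trans[OF word_eq_trans[OF word_eq_sym[OF assms(4)] assms(2)[OF that]] assms(4)] .
      then show "h x = h y \<longleftrightarrow> x = y"
        using assms(1) by (auto simp: uv h word_class_eq_iff)
    next
      fix y assume "y \<in> range (word_class S)"
      then obtain v where "y = word_class S v" by blast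
      then show "\<exists>x\<in>range (word_class R). y = h x"
        using word_eq_sym[OF assms(5)] by (intro bexI[of _ "word_class R (g v)"]) (auto simp: h word_class_eq_iff)
    qed (auto simp: h)
  qed
  then show ?thesis by (auto simp: is_iso_def)
qed

lemma fundamental_group_conj:
  "fundamental_group (factor ws) \<cong> fundamental_group (factor (map ((@) g) ws))"
  unfolding fundamental_group_factor
proof (rule presented_iso[where f = "artin (lift_word g)" and g = "artin (inv_word (lift_word g))"])
  let ?g = "lift_word g" and ?ws = "map ((@) g) ws"
  have conj: "half_twist (g @ w) = ?g @ half_twist w @ inv_word ?g" for w
    by (simp add: half_twist_def)
  show "word_eq (pi_rels ?ws) (artin ?g u) (artin ?g v)" if "word_eq (pi_rels ws) u v" for u v
    using that
  proof (rule pi_rels_hom[rotated])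
    fix w u assume "w \<in> set ws"
    then show "word_eq (pi_rels ?ws) (artin (?g @ half_twist w @ inv_word ?g) u) u"
      unfolding conj[symmetric] by (intro pi_rels_trivial[of "g @ w"]) (simp_all add: word_eq_refl)
  qed
  show "word_eq (pi_rels ws) (artin (inv_word ?g) u) (artin (inv_word ?g) v)" if "word_eq (pi_rels ?ws) u v" for u v
    using that
  proof (rule pi_rels_hom[rotated])
    fix w' u assume "w' \<in> set ?ws"
    then obtain w where w: "w \<in> set ws" "w' = g @ w" by auto
    have "braid_eq (half_twist w) (inv_word ?g @ half_twist w' @ inv_word (inv_word ?g))"
    proof -
      have "braid_eq (inv_word ?g @ ?g @ half_twist w @ inv_word ?g @ ?g) (half_twist w @ inv_word ?g @ ?g)"
        using word_eq_cancel_mid(2)[of braid_rels "[]" ?g "half_twist w @ inv_word ?g @ ?g"] by simp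
      also have "braid_eq (half_twist w @ inv_word ?g @ ?g) (half_twist w)"
        using word_eq_cancel_mid(2)[of braid_rels "half_twist w" ?g "[]"] by simp
      finally show ?thesis unfolding w(2) conj using word_eq_sym by simp
    qed
    then show "word_eq (pi_rels ws) (artin (inv_word ?g @ half_twist w' @ inv_word (inv_word ?g)) u) u"
      by (rule pi_rels_trivial[OF w(1)])
  qed
qed (simp_all add: artin_cancel)

text \<open>The relations only depend on the set of braids, and each braid is determined by its image in \<open>PSL2Z\<close>.\<close>

lemma fundamental_group_cong:
  assumes "set (factor ws) = set (factor ws')"
  shows "fundamental_group (factor ws) = fundamental_group (factor ws')"
proof -
  have "pi_rels ws \<subseteq> pi_rels ws'" if sub: "set (factor ws) \<subseteq> set (factor ws')" for ws ws'
  proof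
    fix r assume "r \<in> pi_rels ws"
    then obtain w v x where w: "w \<in> set ws" "braid_eq (half_twist w) v" "r = (artin v [(x, True)], [(x, True)])"
      by (auto simp: pi_rels_def)
    then have "to_PSL2Z (twist w) \<in> set (factor ws')" using sub by (auto simp: factor_def)
    then obtain w' where w': "w' \<in> set ws'" "to_PSL2Z (twist w') = to_PSL2Z (twist w)"
      by (auto simp: factor_def)
    have "braid_eq (half_twist w') v"
      using word_eq_trans[OF half_twist_cong[OF w'(2)] w(2)] .
    then show "r \<in> pi_rels ws'" using w'(1) w(3) unfolding pi_rels_def by blast
  qed
  then have "pi_rels ws = pi_rels ws'" using assms by blast
  then show ?thesis by (simp add: fundamental_group_factor)
qed

lemma twist_cong: "cls w = cls w' \<Longrightarrow> to_PSL2Z (twist w) = to_PSL2Z (twist w')"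
  unfolding twist_cls by (simp only: cls_append cls_inv[symmetric])

text \<open>Conjugation by \<open>X\<^sup>2Y\<close> moves the base edge across a vertex and rotates the sequence cyclically, which does
  not change the set of factors.\<close>

lemma fundamental_group_skeleton_step:
  "fundamental_group (factor (skeleton (Node (Node a b) c))) \<cong>
   fundamental_group (factor (skeleton (Node b (Node c a))))"
proof -
  let ?W = "[GX, GX, GY]"
  have c: "cls (?W @ [GY] @ [GX, GY]) = cls [GY]" "cls (?W @ [GY] @ ?W) = cls [GX, GY]"
    by (simp_all add: cls_def to_PSL2Z_eq_iff modmat_Cons matX_mat2 matY_mat2 mat_1_mat2)
  have comp: "map ((@) u) (map ((@) v) ws) = map ((@) (u @ v)) ws" for u v :: "modgen list" and ws
    by simp
  have f: "factor (map ((@) u) ws) = factor (map ((@) v) ws)" if "cls u = cls v" for u v ws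
    using that by (auto simp: factor_def cls_append intro!: twist_cong)
  have "factor (map ((@) ?W) (skeleton (Node b (Node c a)))) =
      factor (map ((@) ?W) (branch b)) @ factor (map ((@) (?W @ [GY] @ [GX, GY])) (branch c)) @
      factor (map ((@) (?W @ [GY] @ ?W)) (branch a))"
    by (simp only: skeleton.simps branch.simps map_append comp factor_append append_assoc)
  also have "\<dots> = factor (map ((@) ?W) (branch b)) @ factor (map ((@) [GY]) (branch c)) @
      factor (map ((@) [GX, GY]) (branch a))"
    unfolding f[OF c(1)] f[OF c(2)] ..
  finally have "set (factor (skeleton (Node (Node a b) c))) = set (factor (map ((@) ?W) (skeleton (Node b (Node c a)))))"
    by (auto simp: factor_append)
  then show ?thesis
    using fundamental_group_cong group.iso_sym[OF _ fundamental_group_conj[of "skeleton (Node b (Node c a))" ?W]]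
      group_presented fundamental_group_factor by metis
qed

subsection \<open>Cyclic fundamental groups\<close>

text \<open>If the generators are identified, every word equals the power of one generator given by its exponent.\<close>

lemma word_eq_exponentI:
  fixes u v :: "free_gen word"
  assumes "\<And>x. word_eq R [(Alpha1, True)] [(x, True)]" "exponent u = exponent v"
  shows "word_eq R u v"
proof -
  define pw :: "int \<Rightarrow> free_gen word" where
    "pw n = (if n \<ge> 0 then replicate (nat n) (Alpha1, True) else replicate (nat (- n)) (Alpha1, False))" for n
  have pos: "word_eq R ((Alpha1, True) # pw n) (pw (1 + n))" for n
  proof (cases "n \<ge> 0")
    case True
    then have "pw (1 + n) = (Alpha1, True) # pw n"
      by (simp add: pw_def nat_add_distrib)
    then show ?thesis by (simp add: word_eq_refl)
  next
    case False
    then have "nat (- n) = Suc (nat (- n - 1))" by simp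
    then have "pw n = (Alpha1, False) # pw (1 + n)"
      using False by (cases "n = - 1") (simp_all add: pw_def)
    then show ?thesis
      using word_eq_mult_right[OF word_eq_cancel[of R Alpha1 True], of "pw (1 + n)"] by simp
  qed
  have neg: "word_eq R ((Alpha1, False) # pw n) (pw (n - 1))" for n
  proof -
    have "word_eq R ([(Alpha1, False)] @ pw n) ([(Alpha1, False)] @ [(Alpha1, True)] @ pw (n - 1))"
      using pos[of "n - 1"] by (intro word_eq_mult_left) (simp add: word_eq_sym)
    also have "word_eq R ([(Alpha1, False)] @ [(Alpha1, True)] @ pw (n - 1)) (pw (n - 1))"
      using word_eq_mult_right[OF word_eq_cancel[of R Alpha1 False], of "pw (n - 1)"] by simp
    finally show ?thesis by simp
  qed
  have "word_eq R u (pw (exponent u))" for u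
  proof (induction u)
    case (Cons a u)
    obtain x e where a: "a = (x, e)" by fastforce
    have "word_eq R [(x, e)] [(Alpha1, e)]"
      using word_eq_sym[OF assms(1)[of x]] word_eq_sym[OF word_eq_inv_word[OF assms(1)[of x]]]
      by (cases e) simp_all
    then have "word_eq R ([(x, e)] @ u) ([(Alpha1, e)] @ pw (exponent u))"
      using Cons by (rule word_eq_append)
    also have "word_eq R ([(Alpha1, e)] @ pw (exponent u)) (pw (exponent ((x, e) # u)))"
      using pos[of "exponent u"] neg[of "exponent u"] by (cases e) simp_all
    finally show ?case by (simp add: a)
  qed (simp add: pw_def word_eq_refl)
  then show ?thesis using assms(2) word_eq_trans word_eq_sym by metis
qed

lemma presented_integer:
  fixes R :: "(free_gen word \<times> free_gen word) set"
  assumes "\<And>x. word_eq R [(Alpha1, True)] [(x, True)]"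
    and "\<And>u v. (u, v) \<in> R \<Longrightarrow> exponent u = exponent v"
  shows "presented_group R \<cong> integer_group"
proof -
  have iff: "word_eq R u v \<longleftrightarrow> exponent u = exponent v" for u v
    using word_eq_exponent[OF _ assms(2)] word_eq_exponentI[OF assms(1)] by blast
  define h where "h c = the_elem (exponent ` c)" for c :: "free_gen word set"
  have h: "h (word_class R u) = exponent u" for u
  proof -
    have "exponent ` word_class R u = {exponent u}" by (auto simp: word_class_def iff)
    then show ?thesis by (simp add: h_def)
  qed
  have "h \<in> iso (presented_group R) integer_group"
  proof (rule isoI)
    show "h \<in> hom (presented_group R) integer_group"
      by (rule homI) (auto simp: presented_carrier presented_mult h)
    show "bij_betw h (carrier (presented_group R)) (carrier integer_group)"
      unfolding presented_carrier
    proof (rule bij_betwI')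
      fix x y assume "x \<in> range (word_class R)" "y \<in> range (word_class R)"
      then obtain u v where "x = word_class R u" "y = word_class R v" by blast
      then show "h x = h y \<longleftrightarrow> x = y" by (simp add: h word_class_eq_iff iff)
    next
      fix n :: int
      have e: "exponent (replicate k (Alpha1, e)) = int k * (if e then 1 else - 1)" for k e
        by (induction k) (auto simp: algebra_simps)
      have "n = exponent (if n \<ge> 0 then replicate (nat n) (Alpha1, True) else replicate (nat (- n)) (Alpha1, False))"
        by (simp add: e)
      then show "\<exists>x\<in>range (word_class R). n = h x" using h by (metis rangeI)
    qed auto
  qed
  then show ?thesis by (auto simp: is_iso_def)
qed

text \<open>The braid \<open>\<beta> \<sigma>\<^sub>1 \<beta>\<^sup>-\<^sup>1\<close> acts trivially only if \<open>\<beta>(\<alpha>\<^sub>1) = \<beta>(\<alpha>\<^sub>2)\<close>: apply it to \<open>\<beta>(\<alpha>\<^sub>2)\<close>, and use \<open>\<sigma>\<^sub>1(\<alpha>\<^sub>2) = \<alpha>\<^sub>1\<close>.\<close>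

lemma pi_rels_half_twist:
  assumes "w \<in> set ws"
  shows "word_eq (pi_rels ws) (artin (lift_word w) [(Alpha1, True)]) (artin (lift_word w) [(Alpha2, True)])"
proof -
  let ?u = "[(Alpha2, True)] :: free_gen word"
  have "braid_eq (half_twist w @ lift_word w) (lift_word w @ [s1])"
    using word_eq_cancel_mid(2)[of braid_rels "lift_word w @ [s1]" "lift_word w" "[]"]
    by (simp add: half_twist_def)
  then have "word_eq (pi_rels ws) (artin (half_twist w @ lift_word w) ?u) (artin (lift_word w @ [s1]) ?u)"
    by (rule artin_braid_eq)
  moreover have "word_eq (pi_rels ws) (artin (half_twist w @ lift_word w) ?u) (artin (lift_word w) ?u)"
    using pi_rels_trivial[OF assms word_eq_refl] by simp
  ultimately show ?thesis using word_eq_trans word_eq_sym by fastforce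
qed

text \<open>The relations that a branch contributes, in the coordinates of the free group given by a braid \<open>p\<close>.
  For the three branches below \<open>p\<close> is chosen to make them short.\<close>

definition branch_rels :: "braid_gen word \<Rightarrow> btree \<Rightarrow> (free_gen word \<times> free_gen word) set" where
  "branch_rels p t = (\<lambda>w. (artin (p @ lift_word w) [(Alpha1, True)], artin (p @ lift_word w) [(Alpha2, True)])) ` set (branch t)"

lemma word_eq_cancel_right:
  assumes "word_eq R (u @ w) (v @ w)"
  shows "word_eq R u v"
proof -
  have "word_eq R u (u @ w @ inv_word w @ [])"
    using word_eq_sym[OF word_eq_cancel_mid(1)[of R u w "[]"]] by simp
  also have "word_eq R (u @ w @ inv_word w @ []) (v @ w @ inv_word w @ [])"
    using word_eq_mult_right[OF assms, of "inv_word w"] by simp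
  also have "word_eq R (v @ w @ inv_word w @ []) v"
    using word_eq_cancel_mid(1)[of R v w "[]"] by simp
  finally show ?thesis .
qed

text \<open>The relation of one leaf, multiplied by \<open>l\<close> and \<open>r\<close> and freely reduced.\<close>

lemma branch_rels_concrete:
  assumes "w \<in> set (branch t)"
    and "reduce (l @ artin_reduced (p @ lift_word w) [(Alpha1, True)] @ r) = reduce u"
    and "reduce (l @ artin_reduced (p @ lift_word w) [(Alpha2, True)] @ r) = reduce v"
  shows "word_eq (branch_rels p t) u v"
proof -
  let ?R = "branch_rels p t"
  let ?A = "\<lambda>x. artin (p @ lift_word w) [(x, True)]" and ?A' = "\<lambda>x. artin_reduced (p @ lift_word w) [(x, True)]"
  have "word_eq ?R u (l @ ?A' Alpha1 @ r)" using assms(2) by (intro word_eq_reduceI) simp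
  also have "word_eq ?R (l @ ?A' Alpha1 @ r) (l @ ?A Alpha1 @ r)"
    by (intro word_eq_append word_eq_refl artin_reduced_eq)
  also have "word_eq ?R (?A Alpha1) (?A Alpha2)"
    using assms(1) by (intro word_eq_relation) (auto simp: branch_rels_def simp del: artin_simps)
  then have "word_eq ?R (l @ ?A Alpha1 @ r) (l @ ?A Alpha2 @ r)"
    by (intro word_eq_append word_eq_refl)
  also have "word_eq ?R (l @ ?A Alpha2 @ r) (l @ ?A' Alpha2 @ r)"
    by (intro word_eq_append word_eq_refl word_eq_sym[OF artin_reduced_eq])
  also have "word_eq ?R (l @ ?A' Alpha2 @ r) v" using assms(3) by (intro word_eq_reduceI) simp
  finally show ?thesis .
qed

abbreviation a1 :: "free_gen \<times> bool" where "a1 \<equiv> (Alpha1, True)"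
abbreviation a2 :: "free_gen \<times> bool" where "a2 \<equiv> (Alpha2, True)"
abbreviation a3 :: "free_gen \<times> bool" where "a3 \<equiv> (Alpha3, True)"

abbreviation cherry :: btree where "cherry \<equiv> Node Leaf Leaf"

text \<open>The three leaves give \<open>abc = bab\<close> and \<open>ab = ca = bc\<close>.\<close>

lemma branch_rels_leaf_cherry:
  "word_eq (branch_rels [s2, s1] (Node Leaf cherry)) [a1] [a2]"
  "word_eq (branch_rels [s2, s1] (Node Leaf cherry)) [a1] [a3]"
proof -
  let ?R = "branch_rels [s2, s1] (Node Leaf cherry)"
  have 1: "word_eq ?R [a1, a2, a3] [a2, a1, a2]"
    by (rule branch_rels_concrete[where w = "[GX, GY, GX]" and l = "[]" and r = "[a1, a2]"])
       (simp_all add: reduce_def artin_reduced_def)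
  have 2: "word_eq ?R [a1, a2] [a3, a1]"
    by (rule branch_rels_concrete[where w = "[GX, GX, GY, GX, GY, GX]" and l = "[]" and r = "[a1]"])
       (simp_all add: reduce_def artin_reduced_def)
  have 3: "word_eq ?R [a3, a1] [a2, a3]"
    by (rule branch_rels_concrete[where w = "[GX, GX, GY, GX, GX, GY, GX]" and l = "[a3]" and r = "[]"])
       (simp_all add: reduce_def artin_reduced_def)
  have "word_eq ?R [a2, a1, a2] [a2, a2, a3]"
    using word_eq_mult_left[OF word_eq_trans[OF 2 3], of "[a2]"] by simp
  from word_eq_trans[OF 1 this] have "word_eq ?R ([a1] @ [a2, a3]) ([a2] @ [a2, a3])" by simp
  then show e: "word_eq ?R [a1] [a2]" by (rule word_eq_cancel_right)
  have "word_eq ?R [a1, a1] [a3, a1]"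
    using word_eq_trans[OF word_eq_mult_left[OF e, of "[a1]"]] 2 by simp
  then show "word_eq ?R [a1] [a3]" using word_eq_cancel_right[of ?R "[a1]" "[a1]" "[a3]"] by simp
qed

text \<open>The three leaves give \<open>ab = ca = bc\<close> and \<open>bcb = abc\<close>.\<close>

lemma branch_rels_cherry_leaf:
  "word_eq (branch_rels [] (Node cherry Leaf)) [a1] [a2]"
  "word_eq (branch_rels [] (Node cherry Leaf)) [a1] [a3]"
proof -
  let ?R = "branch_rels [] (Node cherry Leaf)"
  have 1: "word_eq ?R [a1, a2] [a3, a1]"
    by (rule branch_rels_concrete[where w = "[GX, GY, GX, GY, GX]" and l = "[]" and r = "[a1]"])
       (simp_all add: reduce_def artin_reduced_def)
  have 2: "word_eq ?R [a3, a1] [a2, a3]"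
    by (rule branch_rels_concrete[where w = "[GX, GY, GX, GX, GY, GX]" and l = "[a3]" and r = "[]"])
       (simp_all add: reduce_def artin_reduced_def)
  have 3: "word_eq ?R [a2, a3, a2] [a1, a2, a3]"
    by (rule branch_rels_concrete[where w = "[GX, GX, GY, GX]" and l = "[a2, a3]" and r = "[]"])
       (simp_all add: reduce_def artin_reduced_def)
  note 12 = word_eq_trans[OF 1 2]
  have "word_eq ?R [a1, a2, a2] [a2, a3, a2]" using word_eq_mult_right[OF 12, of "[a2]"] by simp
  also note 3
  also have "word_eq ?R [a1, a2, a3] [a1, a1, a2]"
    using word_eq_mult_left[OF word_eq_sym[OF 12], of "[a1]"] by simp
  finally have "word_eq ?R ([a1] @ [a2] @ [a2]) ([a1] @ [a1] @ [a2])" by simp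
  then have "word_eq ?R ([a2] @ [a2]) ([a1] @ [a2])" by (rule word_eq_cancel_left)
  then have "word_eq ?R [a2] [a1]" by (rule word_eq_cancel_right)
  then show e: "word_eq ?R [a1] [a2]" by (rule word_eq_sym)
  have "word_eq ?R [a1, a1] [a3, a1]"
    using word_eq_trans[OF word_eq_mult_left[OF e, of "[a1]"]] 1 by simp
  then show "word_eq ?R [a1] [a3]" using word_eq_cancel_right[of ?R "[a1]" "[a1]" "[a3]"] by simp
qed

text \<open>Three of the leaves give the relations \<open>aba = cab = aca\<close> and \<open>bca = cbc\<close>.\<close>

lemma branch_rels_cherry_cherry:
  "word_eq (branch_rels [s1] (Node cherry cherry)) [a1] [a2]"
  "word_eq (branch_rels [s1] (Node cherry cherry)) [a1] [a3]"
proof -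
  let ?R = "branch_rels [s1] (Node cherry cherry)"
  have 1: "word_eq ?R [a1, a2, a1] [a3, a1, a2]"
    by (rule branch_rels_concrete[where w = "[GX, GY, GX, GY, GX]" and l = "[]" and r = "[a1, a2]"])
       (simp_all add: reduce_def artin_reduced_def)
  have 2: "word_eq ?R [a3, a1, a2] [a1, a3, a1]"
    by (rule branch_rels_concrete[where w = "[GX, GY, GX, GX, GY, GX]" and l = "[a3]" and r = "[a1]"])
       (simp_all add: reduce_def artin_reduced_def)
  have 3: "word_eq ?R [a2, a3, a1] [a3, a2, a3]"
    by (rule branch_rels_concrete[where w = "[GX, GX, GY, GX, GX, GY, GX]" and l = "[a2, a3]" and r = "[]"])
       (simp_all add: reduce_def artin_reduced_def)
  have "word_eq ?R ([a1] @ [a2] @ [a1]) ([a1] @ [a3] @ [a1])" using word_eq_trans[OF 1 2] by simp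
  then have "word_eq ?R ([a2] @ [a1]) ([a3] @ [a1])" by (rule word_eq_cancel_left)
  then have e: "word_eq ?R [a2] [a3]" by (rule word_eq_cancel_right)
  have "word_eq ?R [a3, a3, a1] [a2, a3, a1]" using word_eq_mult_right[OF word_eq_sym[OF e], of "[a3, a1]"] by simp
  also note 3
  also have "word_eq ?R [a3, a2, a3] [a3, a3, a3]"
    using word_eq_mult_left[OF word_eq_mult_right[OF e, of "[a3]"], of "[a3]"] by simp
  finally have "word_eq ?R ([a3, a3] @ [a1]) ([a3, a3] @ [a3])" by simp
  then show f: "word_eq ?R [a1] [a3]" by (rule word_eq_cancel_left)
  show "word_eq ?R [a1] [a2]" using word_eq_trans[OF f word_eq_sym[OF e]] .
qed

text \<open>Suppose that a branch \<open>s\<close> at the end of \<open>g\<close> identifies the generators in the coordinates given by \<open>p\<close>.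
  Transported by \<open>g p\<^sup>-\<^sup>1\<close>, the generators are arbitrary elements of exponent \<open>1\<close>, so those are all identified.\<close>

lemma fundamental_group_integer:
  assumes sub: "\<And>w. w \<in> set (branch s) \<Longrightarrow> g @ w \<in> set ws"
    and cyclic: "\<And>x. word_eq (branch_rels p s) [a1] [(x, True)]"
  shows "fundamental_group (factor ws) \<cong> integer_group"
  unfolding fundamental_group_factor
proof (rule presented_integer)
  let ?R = "pi_rels ws" and ?c = "lift_word g @ inv_word p"
  have cancel: "word_eq R' (artin ?c [(x, e), (x, \<not> e)]) []" for x e and R' :: "(free_gen word \<times> free_gen word) set"
    using artin_cong[OF word_eq_cancel[of "{}" x e], of R' ?c] by simp
  have transfer: "word_eq ?R (artin ?c u) (artin ?c v)" if "word_eq (branch_rels p s) u v" for u v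
    using that
  proof (rule word_eq_hom[where h = "artin ?c"])
    fix u v assume "(u, v) \<in> branch_rels p s"
    then obtain w where w: "w \<in> set (branch s)" "u = artin (p @ lift_word w) [a1]" "v = artin (p @ lift_word w) [a2]"
      by (auto simp: branch_rels_def simp del: artin_simps)
    have "braid_eq (?c @ p @ lift_word w) (lift_word (g @ w))"
      using word_eq_cancel_mid(2)[of braid_rels "lift_word g" p "lift_word w"] by simp
    then have c: "word_eq ?R (artin ?c (artin (p @ lift_word w) x)) (artin (lift_word (g @ w)) x)" for x
      unfolding artin_simps(2)[of ?c, symmetric] by (rule artin_braid_eq)
    have "word_eq ?R (artin ?c u) (artin (lift_word (g @ w)) [a1])" unfolding w by (rule c)
    also have "word_eq ?R (artin (lift_word (g @ w)) [a1]) (artin (lift_word (g @ w)) [a2])"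
      by (rule pi_rels_half_twist) (rule sub[OF w(1)])
    also have "word_eq ?R (artin (lift_word (g @ w)) [a2]) (artin ?c v)" unfolding w by (rule word_eq_sym[OF c])
    finally show "word_eq ?R (artin ?c u) (artin ?c v)" .
  qed (rule artin_hom cancel)+
  define S where "S = {(u, v). word_eq ?R (artin ?c u) (artin ?c v)}"
  have S: "word_eq ?R (artin ?c u) (artin ?c v)" if "word_eq S u v" for u v
    using that
  proof (rule word_eq_hom[where h = "artin ?c"])
    fix u v assume "(u, v) \<in> S"
    then show "word_eq ?R (artin ?c u) (artin ?c v)" by (simp add: S_def)
  qed (rule artin_hom cancel)+
  fix x
  have "word_eq S (artin (inv_word ?c) [a1]) (artin (inv_word ?c) [(x, True)])"
  proof (rule word_eq_exponentI)
    show "word_eq S [a1] [(y, True)]" for y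
      using transfer[OF cyclic] by (intro word_eq_relation) (simp add: S_def)
  qed (simp add: exponent_artin)
  from S[OF this] have "word_eq ?R (artin ?c (artin (inv_word ?c) [a1])) (artin ?c (artin (inv_word ?c) [(x, True)]))" .
  then show "word_eq ?R [a1] [(x, True)]"
    using artin_cancel(1)[of ?R ?c "[a1]"] artin_cancel(1)[of ?R ?c "[(x, True)]"] by (blast intro: word_eq_trans word_eq_sym)
next
  fix u v assume "(u, v) \<in> pi_rels ws"
  then show "exponent u = exponent v" by (auto simp: pi_rels_def exponent_artin)
qed

lemma leaves_small:
  "leaves t = 1 \<longleftrightarrow> t = Leaf" "leaves t = 2 \<longleftrightarrow> t = cherry"
proof -
  show 1: "leaves t = 1 \<longleftrightarrow> t = Leaf" for t
  proof (cases t)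
    case (Node l r)
    then show ?thesis using leaves_pos[of l] leaves_pos[of r] by (simp del: leaves_pos)
  qed simp
  show "leaves t = 2 \<longleftrightarrow> t = cherry"
  proof (cases t)
    case (Node l r)
    then have "leaves t = 2 \<longleftrightarrow> leaves l = 1 \<and> leaves r = 1"
      using leaves_pos[of l] leaves_pos[of r] by (auto simp del: leaves_pos)
    then show ?thesis using 1 Node by simp
  qed simp
qed

definition small_trees :: "btree set" where
  "small_trees = {Node Leaf cherry, Node cherry Leaf, Node cherry cherry}"

text \<open>A minimal subtree with at least three leaves has subtrees with at most two leaves each.\<close>

lemma small_subtree:
  "leaves t \<ge> 3 \<Longrightarrow> \<exists>g s. s \<in> small_trees \<and> (\<forall>w\<in>set (branch s). g @ w \<in> set (branch t))"
proof (induction t)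
  case (Node l r)
  consider "leaves l \<ge> 3" | "leaves r \<ge> 3" | "leaves l \<le> 2" "leaves r \<le> 2" by linarith
  then show ?case
  proof cases
    case 1
    then obtain g s where "s \<in> small_trees" "\<forall>w\<in>set (branch s). g @ w \<in> set (branch l)"
      using Node.IH(1) by blast
    then show ?thesis by (intro exI[of _ "[GX, GY] @ g"] exI[of _ s]) auto
  next
    case 2
    then obtain g s where "s \<in> small_trees" "\<forall>w\<in>set (branch s). g @ w \<in> set (branch r)"
      using Node.IH(2) by blast
    then show ?thesis by (intro exI[of _ "[GX, GX, GY] @ g"] exI[of _ s]) auto
  next
    case 3
    have "(leaves l = 1 \<or> leaves l = 2) \<and> (leaves r = 1 \<or> leaves r = 2)"
      using 3 leaves_pos[of l] leaves_pos[of r] by linarith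
    then have "Node l r \<in> small_trees"
      using Node.prems unfolding leaves_small by (auto simp: small_trees_def)
    then show ?thesis by (intro exI[of _ "[]"] exI[of _ "Node l r"]) simp
  qed
qed simp

lemma fundamental_group_small:
  assumes "s \<in> small_trees" "\<And>w. w \<in> set (branch s) \<Longrightarrow> g @ w \<in> set ws"
  shows "fundamental_group (factor ws) \<cong> integer_group"
proof -
  have "\<exists>p. \<forall>x. word_eq (branch_rels p s) [a1] [(x, True)]"
  proof -
    have all: "\<forall>x. word_eq R [a1] [(x, True)]" if "word_eq R [a1] [a2]" "word_eq R [a1] [a3]" for R
    proof
      show "word_eq R [a1] [(x, True)]" for x using that word_eq_refl by (cases x) auto
    qed
    show ?thesis
      using assms(1) all branch_rels_leaf_cherry all branch_rels_cherry_leaf all branch_rels_cherry_cherry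
      unfolding small_trees_def by blast
  qed
  then show ?thesis using fundamental_group_integer[OF assms(2)] by blast
qed

lemma fundamental_group_iso_trans:
  "fundamental_group (factor ws) \<cong> G \<Longrightarrow> fundamental_group (factor ws') \<cong> fundamental_group (factor ws) \<Longrightarrow>
   fundamental_group (factor ws') \<cong> G"
  using iso_trans by blast

lemma fundamental_group_iso_sym:
  "fundamental_group (factor ws) \<cong> G \<Longrightarrow> G \<cong> fundamental_group (factor ws)"
  using group.iso_sym[OF group_presented] unfolding fundamental_group_factor by blast

text \<open>If neither side of the base edge has at least three leaves, both sides are cherries, and moving the base edge
  across a vertex makes one side a leaf and the other one a branch with three leaves.\<close>

lemma fundamental_group_skeleton_integer:
  assumes "leaves t \<ge> 4"
  shows "fundamental_group (factor (skeleton t)) \<cong> integer_group"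
proof -
  have big: "fundamental_group (factor (skeleton (Node l r))) \<cong> integer_group"
    if "leaves l \<ge> 3 \<or> leaves r \<ge> 3" for l r
    using that
  proof
    assume "leaves l \<ge> 3"
    then obtain g s where "s \<in> small_trees" "\<forall>w\<in>set (branch s). g @ w \<in> set (branch l)"
      using small_subtree by blast
    then show ?thesis by (intro fundamental_group_small[of s g]) auto
  next
    assume "leaves r \<ge> 3"
    then obtain g s where "s \<in> small_trees" "\<forall>w\<in>set (branch s). g @ w \<in> set (branch r)"
      using small_subtree by blast
    then show ?thesis by (intro fundamental_group_small[of s "[GY] @ g"]) auto
  qed
  obtain l r where t: "t = Node l r" using assms by (cases t) auto
  show ?thesis
  proof (cases "leaves l \<ge> 3 \<or> leaves r \<ge> 3")
    case False
    then have "leaves l = 2" using assms t by simp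
    then have l: "l = cherry" by (simp only: leaves_small)
    have "fundamental_group (factor (skeleton (Node Leaf (Node r Leaf)))) \<cong> integer_group"
      using assms t \<open>leaves l = 2\<close> by (intro big) simp
    then show ?thesis unfolding t l
      by (rule fundamental_group_iso_trans) (rule fundamental_group_skeleton_step)
  qed (use big t in simp)
qed

text \<open>Trees with at most three leaves differ by a move of the base edge only.\<close>

lemma fundamental_group_skeletons:
  assumes "t \<noteq> Leaf" "t' \<noteq> Leaf" "leaves t = leaves t'"
  shows "fundamental_group (factor (map ((@) u) (skeleton t))) \<cong>
    fundamental_group (factor (map ((@) u') (skeleton t')))"
    and "leaves t \<ge> 4 \<Longrightarrow> fundamental_group (factor (map ((@) u) (skeleton t))) \<cong> integer_group"
proof -
  have conj: "fundamental_group (factor (map ((@) u) ws)) \<cong> fundamental_group (factor ws)" for u ws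
    by (rule fundamental_group_iso_sym[OF fundamental_group_conj])
  have int: "fundamental_group (factor (map ((@) u) (skeleton t))) \<cong> integer_group" if "leaves t \<ge> 4" for t u
    using fundamental_group_iso_trans[OF fundamental_group_skeleton_integer[OF that] conj] .
  then show "leaves t \<ge> 4 \<Longrightarrow> fundamental_group (factor (map ((@) u) (skeleton t))) \<cong> integer_group" .
  show "fundamental_group (factor (map ((@) u) (skeleton t))) \<cong>
    fundamental_group (factor (map ((@) u') (skeleton t')))"
  proof (cases "leaves t \<ge> 4")
    case True
    then show ?thesis
      using iso_trans[OF int fundamental_group_iso_sym[OF int]] assms(3) by metis
  next
    case False
    define T where "T = (if leaves t = 2 then cherry else Node Leaf cherry)"
    have small: "fundamental_group (factor (map ((@) u) (skeleton s))) \<cong> fundamental_group (factor (skeleton T))"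
      if s: "s \<noteq> Leaf" "leaves s = leaves t" for s u
    proof -
      obtain l r where lr: "s = Node l r" using s(1) by (cases s) auto
      have refl: "fundamental_group (factor (skeleton T)) \<cong> fundamental_group (factor (skeleton T))"
        by (rule iso_refl)
      have "leaves l + leaves r \<le> 3" using False s(2) lr by simp
      then consider "leaves l = 1" "leaves r = 1" | "leaves l = 1" "leaves r = 2" | "leaves l = 2" "leaves r = 1"
        using leaves_pos[of l] leaves_pos[of r] by linarith
      then have "fundamental_group (factor (skeleton s)) \<cong> fundamental_group (factor (skeleton T))"
      proof cases
        case 1
        then have "T = cherry" using s(2) lr by (simp add: T_def)
        moreover have "s = cherry" using 1 lr unfolding leaves_small by simp
        ultimately have "s = T" by simp
        then show ?thesis using refl by simp
      next
        case 2
        then have "leaves t = 3" using s(2) lr by simp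
        then have "T = Node Leaf cherry" by (simp add: T_def)
        moreover have "s = Node Leaf cherry" using 2 lr unfolding leaves_small by simp
        ultimately have "s = T" by simp
        then show ?thesis using refl by simp
      next
        case 3
        then have "leaves t = 3" using s(2) lr by simp
        then have "T = Node Leaf cherry" by (simp add: T_def)
        moreover have "s = Node cherry Leaf" using 3 lr unfolding leaves_small by simp
        ultimately show ?thesis using fundamental_group_skeleton_step[of Leaf Leaf Leaf] by simp
      qed
      then show ?thesis using conj by (rule fundamental_group_iso_trans)
    qed
    show ?thesis
      using iso_trans[OF small[OF assms(1) refl] fundamental_group_iso_sym[OF small[OF assms(2) assms(3)[symmetric]]]] .
  qed
qed

section \<open>The family of factorizations\<close>

text \<open>A tree with base edge at its root, together with a word that moves the base half-edge.  Besides the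
  empty word only \<open>XY\<close> occurs, for a tree whose right subtree is a leaf: from the base edge, \<open>XY\<close> read
  backwards leads to the half-edge of the loop at that leaf that lies on the outer face.\<close>

definition marked_trees :: "nat \<Rightarrow> (btree \<times> modgen list) set" where
  "marked_trees k = (\<lambda>t. (t, [])) ` trees (Suc k) \<union> (\<lambda>t. (Node t Leaf, [GX, GY])) ` trees k"

definition marked_factor :: "btree \<times> modgen list \<Rightarrow> (int^2^2) set list" where
  "marked_factor m = factor (map ((@) (snd m)) (skeleton (fst m)))"

definition marked_end :: "btree \<times> modgen list \<Rightarrow> bool list \<times> nat" where
  "marked_end m = word_act (fst m) (modinv (snd m)) base_end"

lemma card_marked_trees:
  "finite (marked_trees k)" "of_nat (card (marked_trees k)) = T_tilde k"
proof -
  have "card (marked_trees k) = card (trees (Suc k)) + card (trees k)"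
    unfolding marked_trees_def
    by (subst card_Un_disjoint) (auto simp: card_image inj_on_def)
  then show "of_nat (card (marked_trees k)) = T_tilde k" by (simp add: T_tilde_card)
  show "finite (marked_trees k)" by (simp add: marked_trees_def)
qed

lemma marked_trees_cases:
  assumes "m \<in> marked_trees k"
  obtains t where "m = (t, [])" "t \<noteq> Leaf" "leaves t = k + 2"
  | t where "m = (Node t Leaf, [GX, GY])" "leaves t = k + 1"
proof -
  from assms consider t where "m = (t, [])" "t \<in> trees (Suc k)"
    | t where "m = (Node t Leaf, [GX, GY])" "t \<in> trees k"
    unfolding marked_trees_def by blast
  then show ?thesis
  proof cases
    case (1 t)
    then show ?thesis using that(1)[of t] by (cases t) (simp_all add: trees_def)
  next
    case (2 t)
    then show ?thesis using that(2)[of t] by (simp add: trees_def)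
  qed
qed

lemma marked_tree:
  assumes "m \<in> marked_trees k"
  shows "fst m \<noteq> Leaf" "leaves (fst m) = k + 2" "snd m = [] \<or> snd m = [GX, GY]"
  using assms by (auto elim: marked_trees_cases)

lemma monodromy_group_marked:
  assumes "m \<in> marked_trees k"
  shows "monodromy_group PSL2Z (marked_factor m) = stab (fst m) (marked_end m)"
    and "marked_end m \<in> ends (fst m)"
  using monodromy_group_conj[OF marked_tree(1)[OF assms]]
    word_act_ends[OF marked_tree(1)[OF assms] base_end_ends[OF marked_tree(1)[OF assms]]]
  by (simp_all add: marked_factor_def marked_end_def)

lemma marked_end_values: "marked_end (t, []) = base_end" "marked_end (Node t Leaf, [GX, GY]) = ([True], 2)"
  by (simp_all add: marked_end_def)

text \<open>The element \<open>YX\<close> belongs to the stabilizer iff the base half-edge lies on a loop, which recovers the mark.\<close>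

lemma monodromy_group_inj:
  assumes m: "m \<in> marked_trees k" "m' \<in> marked_trees k"
    and eq: "monodromy_group PSL2Z (marked_factor m) = monodromy_group PSL2Z (marked_factor m')"
  shows "m = m'"
proof -
  have stab: "stab (fst m) (marked_end m) = stab (fst m') (marked_end m')"
    using eq monodromy_group_marked(1) m by simp
  note ends = monodromy_group_marked(2)[OF m(1)] monodromy_group_marked(2)[OF m(2)]
  have loop: "cls [GY, GX] \<in> stab (fst n) (marked_end n) \<longleftrightarrow> snd n \<noteq> []" if n: "n \<in> marked_trees k" for n
    using n
  proof (cases rule: marked_trees_cases)
    case (1 t)
    then show ?thesis
      using cls_in_stab_iff[OF marked_tree(1)[OF n] monodromy_group_marked(2)[OF n]]
      by (simp add: marked_end_values)
  next
    case (2 t)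
    then show ?thesis
      using cls_in_stab_iff[OF marked_tree(1)[OF n] monodromy_group_marked(2)[OF n]]
      by (simp add: marked_end_values)
  qed
  have mark: "snd m = snd m'" using loop[OF m(1)] loop[OF m(2)] stab marked_tree(3) m by metis
  have "marked_end m = marked_end m' \<and> word_act (fst m) (snd m) (marked_end m) = base_end \<and>
      word_act (fst m') (snd m') (marked_end m') = base_end"
    using m(1)
  proof (cases rule: marked_trees_cases)
    case (1 t)
    with mark have "snd m' = []" by simp
    with 1 show ?thesis by (simp add: marked_end_def)
  next
    case (2 t)
    with mark m(2) obtain t' where "m' = (Node t' Leaf, [GX, GY])"
      by (auto elim: marked_trees_cases)
    with 2 show ?thesis by (simp add: marked_end_values)
  qed
  then have e: "marked_end m = marked_end m'" "word_act (fst m) (snd m) (marked_end m) = base_end"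
    "word_act (fst m') (snd m') (marked_end m') = base_end" by blast+
  have "fst m = fst m'"
    using marked_tree(1)[OF m(1)] marked_tree(1)[OF m(2)] ends(1) ends(2)[folded e(1)] e(2)
      e(3)[folded mark e(1)] stab[folded e(1)]
    by (rule stab_determines_tree)
  with mark show ?thesis by (simp add: prod_eq_iff)
qed

theorem theorem1p2p1:
  fixes k :: nat
  shows "\<exists>M :: (int^2^2) set list set.
    finite M \<and> of_nat (card M) = T_tilde k \<and>
    (\<forall>m\<in>M. simple_PSL2Z m \<and> length m = k + 2) \<and>
    (\<forall>m\<in>M. monodromy_at_infinity PSL2Z m =
        to_PSL2Z (matX ** matY) [^]\<^bsub>PSL2Z\<^esub> (- 5 * int k - 4)) \<and>
    (\<forall>m\<in>M. \<forall>m'\<in>M.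
        isometric (transcendental_lattice m) (transcendental_form m)
                  (transcendental_lattice m') (transcendental_form m')) \<and>
    (\<forall>m\<in>M. \<forall>m'\<in>M. fundamental_group m \<cong> fundamental_group m') \<and>
    (k \<ge> 2 \<longrightarrow> (\<forall>m\<in>M. fundamental_group m \<cong> integer_group)) \<and>
    (\<forall>m\<in>M. \<forall>m'\<in>M. m \<noteq> m' \<longrightarrow> \<not> strongly_equivalent PSL2Z m m') \<and>
    (\<forall>m\<in>M. \<forall>m'\<in>M. m \<noteq> m' \<longrightarrow> monodromy_group PSL2Z m \<noteq> monodromy_group PSL2Z m') \<and>
    (\<forall>m\<in>M. subgroup (monodromy_group PSL2Z m) PSL2Z \<and>
        card (rcosets\<^bsub>PSL2Z\<^esub> (monodromy_group PSL2Z m)) = 6 * (k + 1))"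
proof (intro exI[of _ "marked_factor ` marked_trees k"] conjI ballI impI)
  let ?P = "marked_trees k" and ?M = "marked_factor ` marked_trees k"
  have groups: "monodromy_group PSL2Z m \<noteq> monodromy_group PSL2Z m'"
    if "m \<in> ?M" "m' \<in> ?M" "m \<noteq> m'" for m m'
    using that monodromy_group_inj by blast
  have "inj_on marked_factor ?P"
    by (rule inj_onI) (metis monodromy_group_inj)
  then show "of_nat (card ?M) = T_tilde k"
    using card_marked_trees(2) by (simp add: card_image)
  show "finite ?M" using card_marked_trees(1) by simp
  fix m assume "m \<in> ?M"
  then obtain p where p: "p \<in> ?P" "m = marked_factor p" by blast
  note t = marked_tree[OF p(1)]
  show "simple_PSL2Z m" unfolding p(2) marked_factor_def by (rule simple_factor)
  show "length m = k + 2"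
    using t by (simp add: p(2) marked_factor_def factor_def length_skeleton)
  have exponent: "6 - 5 * int (k + 2) = - 5 * int k - 4" by simp
  show "monodromy_at_infinity PSL2Z m = to_PSL2Z (matX ** matY) [^]\<^bsub>PSL2Z\<^esub> (- 5 * int k - 4)"
    unfolding p(2) marked_factor_def monodromy_skeleton[OF t(1,3)] t(2) exponent ..
  show "subgroup (monodromy_group PSL2Z m) PSL2Z"
    unfolding p(2) monodromy_group_marked(1)[OF p(1)]
    by (rule subgroup_stab[OF t(1) monodromy_group_marked(2)[OF p(1)]])
  show "card (rcosets\<^bsub>PSL2Z\<^esub> (monodromy_group PSL2Z m)) = 6 * (k + 1)"
    unfolding p(2) monodromy_group_marked(1)[OF p(1)]
    using index_stab[OF t(1) monodromy_group_marked(2)[OF p(1)]] t(2) by simp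
  show "fundamental_group m \<cong> integer_group" if "k \<ge> 2"
    unfolding p(2) marked_factor_def
    using fundamental_group_skeletons(2)[OF t(1) t(1) refl] t(2) that by simp
  fix m' assume m': "m' \<in> ?M"
  then obtain p' where p': "p' \<in> ?P" "m' = marked_factor p'" by blast
  note t' = marked_tree[OF p'(1)]
  have same: "leaves (fst p) = leaves (fst p')" using t(2) t'(2) by simp
  show "isometric (transcendental_lattice m) (transcendental_form m)
      (transcendental_lattice m') (transcendental_form m')"
    unfolding p(2) p'(2) marked_factor_def by (rule isometric_skeletons[OF t(1) t'(1) same])
  show "fundamental_group m \<cong> fundamental_group m'"
    unfolding p(2) p'(2) marked_factor_def by (rule fundamental_group_skeletons(1)[OF t(1) t'(1) same])
  assume "m \<noteq> m'"
  then show distinct: "monodromy_group PSL2Z m \<noteq> monodromy_group PSL2Z m'"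
    using groups \<open>m \<in> ?M\<close> m' by blast
  then show "\<not> strongly_equivalent PSL2Z m m'"
    using strongly_equivalent_monodromy_group factor_carrier
    unfolding p(2) p'(2) marked_factor_def by blast
qed

end
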